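(* Let $M$ be a $C^\infty$ real hypersurface in $\mathbb{C}^2$ and $p\in M$, and suppose $M$ admits a good coordinate at $p$. If $\Delta_1(M,p)=\infty$, then the following three conditions are equivalent: (i) there exists $\gamma\in\Gamma^{\rm reg}$ tangent to $M$ at $p$ to infinite order; (ii) there exists a good coordinate $(z,w)$ for $M$ at $p$ on which $F$ is flat at the origin; (iii) there exists a good coordinate $(z,w)$ for $M$ at $p$ such that the radius of convergence of the power series $\mathcal{S}(z)$ associated with this coordinate is positive.
   Context: A good coordinate for $M$ at $p$ is a holomorphic coordinate $(z,w)\in\mathbb{C}\times\mathbb{C}$ centered at $p$ in which $M$ has the local defining function $r=2\operatorname{Re}(w)+F(z,\bar z)$, where $F$ is a real-valued $C^\infty$ function near $0\in\mathbb{C}$ with $F(0)=0$ and $\nabla F(0)=0$. $F$ is flat at $0$ if all its Taylor coefficients at $0$ vanish. When $\Delta_1(M,p)=\infty$, the Taylor series of $F$ at $0$ on such a coordinate consists only of pure terms (monomials $z^j$ or $\bar z^j$), so it can be written as $2\sum_{j\ge2}\operatorname{Re}(c_jz^j)$ with uniquely determined $c_j\in\mathbb{C}$; define the formal power series $\mathcal{S}(z)=\sum_{j\ge2}c_jz^j$. $\operatorname{ord}(h)$ is order of vanishing at $0$. $\Gamma$ is the set of germs of nonconstant holomorphic maps $\gamma:(\mathbb{C},0)\to(\mathbb{C}^2,p)$ (good parametrization); $\Delta_1(M,p)=\sup_{\gamma\in\Gamma}\operatorname{ord}(r\circ\gamma)/\operatorname{ord}(\gamma-p)$ for a local defining function $r$;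 $\Gamma^{\rm reg}=\{\gamma\in\Gamma:\operatorname{ord}(\gamma-p)=1\}$. $\gamma$ is tangent to $M$ at $p$ to infinite order if $(r\circ\gamma)(t)=O(t^N)$ for all $N$. *)

theory Defs
  imports "HOL-Analysis.Analysis"
begin

definition dderiv :: "('a::real_normed_vector \<Rightarrow> 'b::real_normed_vector) \<Rightarrow> 'a \<Rightarrow> 'a \<Rightarrow> 'b" where
  "dderiv f v x = frechet_derivative f (at x) v"

fun Ck_on :: "nat \<Rightarrow> 'a::euclidean_space set \<Rightarrow> ('a \<Rightarrow> 'b::real_normed_vector) \<Rightarrow> bool" where
  "Ck_on 0 U f = continuous_on U f"
| "Ck_on (Suc k) U f = (f differentiable_on U \<and> (\<forall>b\<in>Basis. Ck_on k U (dderiv f b)))"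

definition smooth_on :: "'a::euclidean_space set \<Rightarrow> ('a \<Rightarrow> 'b::real_normed_vector) \<Rightarrow> bool" where
  "smooth_on U f \<longleftrightarrow> (\<forall>k. Ck_on k U f)"

fun iter_dderiv :: "'a::real_normed_vector list \<Rightarrow> ('a \<Rightarrow> 'b::real_normed_vector) \<Rightarrow> 'a \<Rightarrow> 'b" where
  "iter_dderiv [] f = f"
| "iter_dderiv (v # vs) f = dderiv (iter_dderiv vs f) v"

definition holo2_on :: "(complex \<times> complex) set \<Rightarrow> (complex \<times> complex \<Rightarrow> complex) \<Rightarrow> bool" where
  "holo2_on U f \<longleftrightarrow> (\<forall>x\<in>U. f differentiable (at x) \<and>
      (\<forall>v. dderiv f (\<i> * fst v, \<i> * snd v) x = \<i> * dderiv f v x))"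

definition holo_map2_on :: "(complex \<times> complex) set \<Rightarrow> (complex \<times> complex \<Rightarrow> complex \<times> complex) \<Rightarrow> bool" where
  "holo_map2_on U \<Phi> \<longleftrightarrow> holo2_on U (\<lambda>q. fst (\<Phi> q)) \<and> holo2_on U (\<lambda>q. snd (\<Phi> q))"

definition holo_chart :: "(complex \<times> complex) set \<Rightarrow> (complex \<times> complex \<Rightarrow> complex \<times> complex) \<Rightarrow> bool" where
  "holo_chart U \<Phi> \<longleftrightarrow> open U \<and> holo_map2_on U \<Phi> \<and> inj_on \<Phi> U \<and> open (\<Phi> ` U) \<and>
     (\<exists>\<Psi>. holo_map2_on (\<Phi> ` U) \<Psi> \<and> (\<forall>x\<in>U. \<Psi> (\<Phi> x) = x))"

definition local_defining_function ::
  "(complex \<times> complex) set \<Rightarrow> complex \<times> complex \<Rightarrow> (complex \<times> complex \<Rightarrow> real) \<Rightarrow> bool" where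
  "local_defining_function M q r \<longleftrightarrow> (\<exists>U. open U \<and> q \<in> U \<and> smooth_on U r \<and>
      (\<forall>x\<in>U. frechet_derivative r (at x) \<noteq> (\<lambda>_. 0)) \<and>
      M \<inter> U = {x\<in>U. r x = 0})"

definition smooth_real_hypersurface :: "(complex \<times> complex) set \<Rightarrow> bool" where
  "smooth_real_hypersurface M \<longleftrightarrow> (\<forall>q\<in>M. \<exists>r. local_defining_function M q r)"

definition ldf :: "(complex \<times> complex) set \<Rightarrow> complex \<times> complex \<Rightarrow> (complex \<times> complex \<Rightarrow> real)" where
  "ldf M p = (SOME r. local_defining_function M p r)"

definition good_coordinate ::
  "(complex \<times> complex) set \<Rightarrow> complex \<times> complex \<Rightarrow> (complex \<times> complex \<Rightarrow> complex \<times> complex)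
     \<Rightarrow> (complex \<Rightarrow> real) \<Rightarrow> bool" where
  "good_coordinate M p \<Phi> F \<longleftrightarrow> (\<exists>U. p \<in> U \<and> holo_chart U \<Phi> \<and> \<Phi> p = 0 \<and>
      (\<exists>W. open W \<and> (\<lambda>q. fst (\<Phi> q)) ` U \<subseteq> W \<and> smooth_on W F) \<and>
      F 0 = 0 \<and> (\<forall>v. dderiv F v 0 = 0) \<and>
      M \<inter> U = {q\<in>U. 2 * Re (snd (\<Phi> q)) + F (fst (\<Phi> q)) = 0})"

definition flat_at0 :: "(complex \<Rightarrow> real) \<Rightarrow> bool" where
  "flat_at0 F \<longleftrightarrow> (\<forall>vs \<in> lists {1, \<i>}. iter_dderiv vs F 0 = 0)"

definition dz :: "(complex \<Rightarrow> complex) \<Rightarrow> complex \<Rightarrow> complex" where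
  "dz g x = (dderiv g 1 x - \<i> * dderiv g \<i> x) / 2"

text \<open>Coefficients c_j of the pure terms z^j in the Taylor series of F at 0:
  c_j = (d/dz)^j F (0) / j!, and S(z) = sum over j>=2 of c_j z^j.\<close>
definition S_coeff :: "(complex \<Rightarrow> real) \<Rightarrow> nat \<Rightarrow> complex" where
  "S_coeff F j = (if 2 \<le> j then (dz ^^ j) (\<lambda>z. complex_of_real (F z)) 0 / of_nat (fact j) else 0)"

definition vanishes_to_order :: "(complex \<Rightarrow> 'b::real_normed_vector) \<Rightarrow> nat \<Rightarrow> bool" where
  "vanishes_to_order h N \<longleftrightarrow> (\<exists>C \<delta>. \<delta> > 0 \<and> (\<forall>t. cmod t < \<delta> \<longrightarrow> norm (h t) \<le> C * cmod t ^ N))"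

definition vanish_ord :: "(complex \<Rightarrow> 'b::real_normed_vector) \<Rightarrow> enat" where
  "vanish_ord h = Sup {enat N | N. vanishes_to_order h N}"

definition Gamma :: "complex \<times> complex \<Rightarrow> (complex \<Rightarrow> complex \<times> complex) set" where
  "Gamma p = {\<gamma>. \<gamma> 0 = p \<and> (\<exists>\<epsilon>>0. (\<lambda>t. fst (\<gamma> t)) holomorphic_on ball 0 \<epsilon> \<and>
       (\<lambda>t. snd (\<gamma> t)) holomorphic_on ball 0 \<epsilon> \<and> (\<exists>t\<in>ball 0 \<epsilon>. \<gamma> t \<noteq> p))}"

definition Gamma_reg :: "complex \<times> complex \<Rightarrow> (complex \<Rightarrow> complex \<times> complex) set" where
  "Gamma_reg p = {\<gamma> \<in> Gamma p. vanish_ord (\<lambda>t. \<gamma> t - p) = 1}"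

definition Delta1 :: "(complex \<times> complex) set \<Rightarrow> complex \<times> complex \<Rightarrow> ereal" where
  "Delta1 M p = (SUP \<gamma>\<in>Gamma p. ereal_of_enat (vanish_ord (\<lambda>t. ldf M p (\<gamma> t)))
                                 / ereal_of_enat (vanish_ord (\<lambda>t. \<gamma> t - p)))"

definition tangent_inf_order :: "(complex \<times> complex) set \<Rightarrow> complex \<times> complex \<Rightarrow> (complex \<Rightarrow> complex \<times> complex) \<Rightarrow> bool" where
  "tangent_inf_order M p \<gamma> \<longleftrightarrow> (\<forall>N. vanishes_to_order (\<lambda>t. ldf M p (\<gamma> t)) N)"

end

theory Submission
  imports Defs "HOL-Complex_Analysis.Complex_Analysis"
begin

text \<open>
  In a good coordinate, a local defining function is comparable to \<open>2 Re w + F(z)\<close>, and the shear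
  \<open>w \<mapsto> w - g(z)\<close> replaces \<open>F\<close> by \<open>F + 2 Re g\<close>. If \<open>F\<close> is flat, the curve \<open>w = 0\<close> is tangent to
  infinite order. Conversely a regular curve tangent to infinite order is a graph \<open>w = g(z)\<close>, and the
  shear by \<open>g\<close> makes \<open>F\<close> flat. If \<open>\<S>\<close> converges, the shear by \<open>-\<S>\<close> removes the pure terms of \<open>F\<close>.

  What remains is that the mixed terms of \<open>F\<close> vanish when \<open>\<Delta>\<^sub>1 = \<infinity>\<close>, that is, that the Laplacian of \<open>F\<close> is flat.
  A curve \<open>(a, b)\<close> of order \<open>m\<close> with contact order at least \<open>K m\<close> gives \<open>F \<circ> a + 2 Re b = O(\<bar>t\<bar>\<^sup>K\<^sup>m)\<close>.
  Taking Laplacians kills the unknown harmonic function \<open>Re b\<close> and leaves \<open>\<bar>a'\<bar>\<^sup>2 (\<Delta> F) \<circ> a\<close>; by interpolation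
  against bounded derivatives it is still \<open>O(\<bar>t\<bar>\<^sup>K\<^sup>m\<^sup>/\<^sup>4)\<close>. Since \<open>a\<close> has order exactly \<open>m\<close> and is
  open, \<open>\<Delta> F = O(\<bar>z\<bar>\<^sup>L)\<close> for every \<open>L\<close>. All flatness statements are of infinite order, so the loss of
  a factor in the exponent is harmless and no Taylor expansion of \<open>F\<close> is needed.
\<close>

section \<open>Smooth functions\<close>

text \<open>\<open>Delta1\<close> and tangency speak about \<open>ldf\<close>, a defining function
  picked by \<open>SOME\<close>. It is tied to a good coordinate only through two-sided inequalities
  with \<open>rho\<close>, obtained from nearby points of \<open>M\<close> and Lipschitz bounds, so
  no smooth quotient of the two functions has to be constructed. The charts satisfy
  \<open>holo2_on\<close>, which does not assert continuity of the derivative; their Lipschitz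
  bounds come from Cauchy's estimate. \<open>Delta1 M p = \<infinity>\<close> supplies curves of
  ever larger contact ratio, but no single curve of infinite contact. The Laplacian avoids the
  search for a limit curve: its having order \<open>L\<close> at \<open>0\<close> is a statement
  about \<open>F\<close> alone, and each \<open>L\<close> may use its own curve. Each of two
  derivatives halves the known order, and dividing by |a'|^2 costs \<open>2 * (m - 1)\<close>; hence
  contact \<open>4 * (L + 2) * m\<close> is enough for order \<open>L\<close>. A flat Laplacian
  leaves only the pure derivatives at \<open>0\<close> free, because every higher mixed derivative
  of \<open>F\<close> is a derivative of the Laplacian.\<close>

lemma dderiv_eqI: "(f has_derivative D) (at x) \<Longrightarrow> dderiv f v x = D v"
  unfolding dderiv_def using frechet_derivative_at by metis

lemma has_derivative_dderiv:
  "f differentiable at x \<Longrightarrow> (f has_derivative (\<lambda>v. dderiv f v x)) (at x)"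
  unfolding dderiv_def using frechet_derivative_works[of f "at x"] by simp

lemma differentiable_on_openD:
  "f differentiable_on U \<Longrightarrow> open U \<Longrightarrow> x \<in> U \<Longrightarrow> f differentiable at x"
  using differentiable_on_eq_differentiable_at by blast

lemma dderiv_cong:
  assumes "open U" "x \<in> U" "\<And>y. y \<in> U \<Longrightarrow> f y = g y"
  shows "dderiv f v x = dderiv g v x"
proof -
  \<comment> \<open>\<open>frechet_derivative\<close> is a choice among all derivatives, so equal
    sets of candidates give equal choices, even at points without a derivative.\<close>
  have "(f has_derivative D) (at x) \<longleftrightarrow> (g has_derivative D) (at x)" for D
    using assms has_derivative_transform_within_open[of f D x UNIV U g]
      has_derivative_transform_within_open[of g D x UNIV U f] by auto
  then show ?thesis
    unfolding dderiv_def frechet_derivative_def by simp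
qed

lemma Ck_on_cong:
  assumes "open U" "\<And>x. x \<in> U \<Longrightarrow> f x = g x" "Ck_on k U f"
  shows "Ck_on k U g"
  using assms(2,3)
proof (induction k arbitrary: f g)
  case 0
  then show ?case using continuous_on_cong by force
next
  case (Suc k)
  have "g differentiable at x" if "x \<in> U" for x
  proof -
    have "(f has_derivative (\<lambda>v. dderiv f v x)) (at x)"
      using Suc.prems(2) that differentiable_on_openD[OF _ \<open>open U\<close>]
      by (auto intro!: has_derivative_dderiv)
    then have "(g has_derivative (\<lambda>v. dderiv f v x)) (at x)"
      using has_derivative_transform_within_open[OF _ \<open>open U\<close> that] Suc.prems(1) by blast
    then show ?thesis unfolding differentiable_def by blast
  qed
  moreover have "Ck_on k U (dderiv g b)" if "b \<in> Basis" for b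
    using Suc.IH[of "dderiv f b" "dderiv g b"] Suc.prems dderiv_cong[OF \<open>open U\<close>, of _ f g] that
    by auto
  ultimately show ?case
    by (simp add: differentiable_at_imp_differentiable_on)
qed

lemma Ck_on_subset:
  assumes "V \<subseteq> U" "Ck_on k U f"
  shows "Ck_on k V f"
  using assms(2)
proof (induction k arbitrary: f)
  case 0
  then show ?case using assms(1) continuous_on_subset by auto
next
  case (Suc k)
  then show ?case using assms(1) differentiable_on_subset by auto
qed

lemma Ck_on_SucD: "Ck_on (Suc k) U f \<Longrightarrow> Ck_on k U f"
  by (induction k arbitrary: f) (auto simp: differentiable_imp_continuous_on)

text \<open>The entry point for the closure rules below: an explicit derivative formula takes the
  place of \<open>dderiv\<close>, with which it has to agree only on \<open>U\<close>.\<close>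

lemma Ck_on_SucI:
  assumes "open U" "\<And>x. x \<in> U \<Longrightarrow> (f has_derivative D x) (at x)"
    "\<And>b. b \<in> Basis \<Longrightarrow> Ck_on k U (\<lambda>x. D x b)"
  shows "Ck_on (Suc k) U f"
proof -
  have "Ck_on k U (dderiv f b)" if "b \<in> Basis" for b
    using Ck_on_cong[OF \<open>open U\<close> _ assms(3)[OF that], of "dderiv f b"]
      dderiv_eqI[OF assms(2)] by simp
  moreover have "f differentiable_on U"
    using assms(2) differentiable_at_imp_differentiable_on differentiable_def by blast
  ultimately show ?thesis by simp
qed

lemma Ck_on_has_derivative:
  assumes "Ck_on (Suc k) U f" "open U" "x \<in> U"
  shows "(f has_derivative (\<lambda>v. dderiv f v x)) (at x)"
  using assms differentiable_on_openD has_derivative_dderiv by fastforce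

lemma Ck_on_add:
  assumes "open U" "Ck_on k U f" "Ck_on k U g"
  shows "Ck_on k U (\<lambda>x. f x + g x)"
  using assms(2,3)
proof (induction k arbitrary: f g)
  case 0
  then show ?case by (simp add: continuous_on_add)
next
  case (Suc k)
  show ?case
  proof (rule Ck_on_SucI[OF \<open>open U\<close>])
    show "((\<lambda>x. f x + g x) has_derivative (\<lambda>v. dderiv f v x + dderiv g v x)) (at x)"
      if "x \<in> U" for x
      using Suc.prems Ck_on_has_derivative[OF _ \<open>open U\<close> that] has_derivative_add by blast
  qed (use Suc in auto)
qed

lemma Ck_on_linear:
  assumes "open U" "bounded_linear L" "Ck_on k U f"
  shows "Ck_on k U (\<lambda>x. L (f x))"
  using assms(3)
proof (induction k arbitrary: f)
  case 0
  then show ?case using assms(2) by (simp add: bounded_linear.continuous_on)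
next
  case (Suc k)
  show ?case
  proof (rule Ck_on_SucI[OF \<open>open U\<close>])
    show "((\<lambda>x. L (f x)) has_derivative (\<lambda>v. L (dderiv f v x))) (at x)"
      if "x \<in> U" for x
      using bounded_linear.has_derivative[OF assms(2) Ck_on_has_derivative[OF Suc.prems \<open>open U\<close> that]] .
  qed (use Suc in auto)
qed

lemma Ck_on_mult:
  fixes f g :: "'a::euclidean_space \<Rightarrow> 'b::real_normed_algebra"
  assumes "open U" "Ck_on k U f" "Ck_on k U g"
  shows "Ck_on k U (\<lambda>x. f x * g x)"
  using assms(2,3)
proof (induction k arbitrary: f g)
  case 0
  then show ?case by (simp add: continuous_on_mult)
next
  case (Suc k)
  show ?case
  proof (rule Ck_on_SucI[OF \<open>open U\<close>])
    show "((\<lambda>x. f x * g x) has_derivative (\<lambda>v. f x * dderiv g v x + dderiv f v x * g x)) (at x)"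
      if "x \<in> U" for x
      using Suc.prems Ck_on_has_derivative[OF _ \<open>open U\<close> that] has_derivative_mult by blast
    show "Ck_on k U (\<lambda>x. f x * dderiv g b x + dderiv f b x * g x)" if "b \<in> Basis" for b
      \<comment> \<open>The product rule contains the undifferentiated factors, which are needed at
        the lower level \<open>k\<close>.\<close>
      using that Suc.prems Ck_on_SucD[of k U]
      by (intro Ck_on_add[OF \<open>open U\<close>] Suc.IH) auto
  qed
qed

text \<open>The derivative in a direction \<open>b\<close> is \<open>deriv g\<close> times the
  constant \<open>b\<close>, so the induction stays within the holomorphic functions.\<close>

lemma Ck_on_holomorphic:
  assumes "open U" "g holomorphic_on U"
  shows "Ck_on k U g"
  using assms(2)
proof (induction k arbitrary: g)
  case 0
  then show ?case by (simp add: holomorphic_on_imp_continuous_on)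
next
  case (Suc k)
  show ?case
  proof (rule Ck_on_SucI[OF \<open>open U\<close>])
    show "(g has_derivative (\<lambda>v. deriv g x * v)) (at x)" if "x \<in> U" for x
      using holomorphic_derivI[OF Suc.prems \<open>open U\<close> that] has_field_derivative_imp_has_derivative
      by blast
    show "Ck_on k U (\<lambda>x. deriv g x * b)" for b
      using Suc.IH[OF holomorphic_deriv[OF Suc.prems \<open>open U\<close>]]
      by (intro Ck_on_linear[OF \<open>open U\<close> bounded_linear_mult_left])
  qed
qed

lemma dderiv_complex:
  assumes "f differentiable at x"
  shows "dderiv f v x = Re v *\<^sub>R dderiv f 1 x + Im v *\<^sub>R dderiv f \<i> x"
proof -
  interpret bounded_linear "\<lambda>v. dderiv f v x"
    using has_derivative_bounded_linear[OF has_derivative_dderiv[OF assms]] .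
  have "v = Re v *\<^sub>R 1 + Im v *\<^sub>R \<i>"
    by (simp add: complex_eq_iff)
  then show ?thesis
    by (metis add scaleR)
qed

lemma has_derivative_compose_holomorphic:
  assumes "g differentiable at (a t)" "a holomorphic_on U" "open U" "t \<in> U"
  shows "((\<lambda>t. g (a t)) has_derivative (\<lambda>v. dderiv g (deriv a t * v) (a t))) (at t)"
  using has_derivative_compose[OF has_field_derivative_imp_has_derivative[OF
        holomorphic_derivI[OF assms(2-4)]] has_derivative_dderiv[OF assms(1)]] .

text \<open>The inner map will be the first component of a curve. The chain rule produces only
  products of \<open>deriv a\<close>, which is holomorphic, with the two real partials of
  \<open>g\<close> composed with \<open>a\<close>, to which the induction hypothesis
  applies.\<close>

lemma Ck_on_compose_holomorphic:
  fixes g :: "complex \<Rightarrow> complex"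
  assumes "open U" "open W" "a holomorphic_on U" "a ` U \<subseteq> W" "Ck_on k W g"
  shows "Ck_on k U (\<lambda>t. g (a t))"
  using assms(5)
proof (induction k arbitrary: g)
  case 0
  then show ?case
    using continuous_on_compose2[OF _ holomorphic_on_imp_continuous_on[OF assms(3)] assms(4)] by simp
next
  case (Suc k)
  have diff: "g differentiable at w" if "w \<in> W" for w
    using Suc.prems differentiable_on_openD[of g, OF _ \<open>open W\<close> that] by simp
  show ?case
  proof (rule Ck_on_SucI[OF \<open>open U\<close>])
    \<comment> \<open>Real and imaginary parts enter through \<open>of_real\<close> and complex
      multiplication, because \<open>Ck_on_mult\<close> treats products in an algebra rather than
      scalar multiples.\<close>
    show "((\<lambda>t. g (a t)) has_derivative (\<lambda>v. of_real (Re (deriv a t * v)) * dderiv g 1 (a t)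
        + of_real (Im (deriv a t * v)) * dderiv g \<i> (a t))) (at t)" if "t \<in> U" for t
    proof -
      have "g differentiable at (a t)"
        using diff assms(4) that by auto
      have "(\<lambda>v. dderiv g (deriv a t * v) (a t)) = (\<lambda>v. of_real (Re (deriv a t * v)) * dderiv g 1 (a t)
        + of_real (Im (deriv a t * v)) * dderiv g \<i> (a t))"
        unfolding dderiv_complex[OF \<open>g differentiable at (a t)\<close>, of "deriv a t * _"] scaleR_conv_of_real ..
      then show ?thesis
        using has_derivative_compose_holomorphic[OF \<open>g differentiable at (a t)\<close> assms(3,1) that]
        by metis
    qed
    fix b :: complex
    have d: "Ck_on k U (\<lambda>t. deriv a t * b)"
      using Ck_on_holomorphic[OF \<open>open U\<close>] holomorphic_deriv[OF assms(3,1)]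
      by (intro Ck_on_linear[OF \<open>open U\<close> bounded_linear_mult_left])
    have "Ck_on k W (dderiv g 1)" "Ck_on k W (dderiv g \<i>)"
      using Suc.prems by (auto simp: Basis_complex_def)
    then have g: "Ck_on k U (\<lambda>t. dderiv g 1 (a t))" "Ck_on k U (\<lambda>t. dderiv g \<i> (a t))"
      using Suc.IH by blast+
    show "Ck_on k U (\<lambda>t. of_real (Re (deriv a t * b)) * dderiv g 1 (a t)
        + of_real (Im (deriv a t * b)) * dderiv g \<i> (a t))"
      using Ck_on_linear[OF \<open>open U\<close> _ d, of "\<lambda>z. complex_of_real (Re z)"]
        Ck_on_linear[OF \<open>open U\<close> _ d, of "\<lambda>z. complex_of_real (Im z)"]
      by (intro Ck_on_add Ck_on_mult g \<open>open U\<close>)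
        (auto intro: bounded_linear_compose[OF bounded_linear_of_real] bounded_linear_Re bounded_linear_Im)
  qed
qed

lemma smooth_on_dderiv:
  "smooth_on U f \<Longrightarrow> b \<in> Basis \<Longrightarrow> smooth_on U (dderiv f b)"
  unfolding smooth_on_def by (metis Ck_on.simps(2))

lemma smooth_on_differentiable:
  "smooth_on U f \<Longrightarrow> open U \<Longrightarrow> x \<in> U \<Longrightarrow> f differentiable at x"
  unfolding smooth_on_def by (metis Ck_on.simps(2) differentiable_on_openD)

lemma smooth_on_subset: "V \<subseteq> U \<Longrightarrow> smooth_on U f \<Longrightarrow> smooth_on V f"
  unfolding smooth_on_def using Ck_on_subset by blast

lemma smooth_on_add:
  "open U \<Longrightarrow> smooth_on U f \<Longrightarrow> smooth_on U g \<Longrightarrow> smooth_on U (\<lambda>x. f x + g x)"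
  unfolding smooth_on_def using Ck_on_add by blast

lemma smooth_on_linear:
  "open U \<Longrightarrow> bounded_linear L \<Longrightarrow> smooth_on U f \<Longrightarrow> smooth_on U (\<lambda>x. L (f x))"
  unfolding smooth_on_def using Ck_on_linear by blast

lemma smooth_on_holomorphic: "open U \<Longrightarrow> g holomorphic_on U \<Longrightarrow> smooth_on U g"
  unfolding smooth_on_def using Ck_on_holomorphic by blast

lemma smooth_on_compose_holomorphic:
  fixes g :: "complex \<Rightarrow> complex"
  shows "open U \<Longrightarrow> open W \<Longrightarrow> a holomorphic_on U \<Longrightarrow> a ` U \<subseteq> W \<Longrightarrow> smooth_on W g
    \<Longrightarrow> smooth_on U (\<lambda>t. g (a t))"
  unfolding smooth_on_def using Ck_on_compose_holomorphic by blast

section \<open>Orders of vanishing and flatness\<close>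

lemma vanishes_to_order_iff:
  "vanishes_to_order h N \<longleftrightarrow> (\<exists>C. \<forall>\<^sub>F t in nhds 0. norm (h t) \<le> C * cmod t ^ N)"
  unfolding vanishes_to_order_def eventually_nhds_metric by auto

lemma vanishes_to_order_pos:
  assumes "vanishes_to_order h N"
  obtains C where "C > 0" "\<forall>\<^sub>F t in nhds 0. norm (h t) \<le> C * cmod t ^ N"
proof -
  obtain C where C: "\<forall>\<^sub>F t in nhds 0. norm (h t) \<le> C * cmod t ^ N"
    using assms vanishes_to_order_iff by blast
  have "\<forall>\<^sub>F t in nhds 0. norm (h t) \<le> max C 1 * cmod t ^ N"
    using C by (rule eventually_mono)
      (smt (verit) mult_right_mono norm_ge_zero zero_le_power)
  then show ?thesis using that[of "max C 1"] by simp
qed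

lemma vanishes_to_order_ball:
  assumes "vanishes_to_order h N"
  obtains C d where "C > 0" "d > 0" "\<And>t. cmod t < d \<Longrightarrow> norm (h t) \<le> C * cmod t ^ N"
proof -
  obtain C where "C > 0" "\<forall>\<^sub>F t in nhds 0. norm (h t) \<le> C * cmod t ^ N"
    using vanishes_to_order_pos[OF assms] .
  then show ?thesis
    using that unfolding eventually_nhds_metric by (auto simp: dist_norm)
qed

lemma vanishes_to_order_compare:
  assumes "vanishes_to_order g N" "\<forall>\<^sub>F t in nhds 0. norm (h t) \<le> K * norm (g t)"
  shows "vanishes_to_order h N"
proof -
  obtain C where C: "C > 0" "\<forall>\<^sub>F t in nhds 0. norm (g t) \<le> C * cmod t ^ N"
    using vanishes_to_order_pos[OF assms(1)] by blast
  have "\<forall>\<^sub>F t in nhds 0. norm (h t) \<le> (\<bar>K\<bar> * C) * cmod t ^ N"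
    using C(2) assms(2)
  proof eventually_elim
    case (elim t)
    have "norm (h t) \<le> \<bar>K\<bar> * norm (g t)"
      using elim(2) by (smt (verit) mult_right_mono norm_ge_zero)
    also have "\<dots> \<le> \<bar>K\<bar> * (C * cmod t ^ N)"
      using elim(1) by (simp add: mult_left_mono)
    finally show ?case by (simp add: mult.assoc)
  qed
  then show ?thesis unfolding vanishes_to_order_iff by blast
qed

lemma vanishes_to_order_cong:
  assumes "vanishes_to_order g N" "\<forall>\<^sub>F t in nhds 0. h t = g t"
  shows "vanishes_to_order h N"
  using vanishes_to_order_compare[OF assms(1), of h 1] eventually_mono[OF assms(2), of "\<lambda>t. norm (h t) \<le> 1 * norm (g t)"]
  by simp

lemma eventually_cmod_less: "e > 0 \<Longrightarrow> \<forall>\<^sub>F t in nhds (0::complex). cmod t < e"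
  unfolding eventually_nhds_metric by auto

lemma eventually_in_ball0: "e > 0 \<Longrightarrow> \<forall>\<^sub>F t in nhds (0::complex). t \<in> ball 0 e"
  by (rule eventually_mono[OF eventually_cmod_less]) auto

lemma vanishes_to_order_mono:
  assumes "vanishes_to_order h M" "N \<le> M"
  shows "vanishes_to_order h N"
proof -
  obtain C where C: "C > 0" "\<forall>\<^sub>F t in nhds 0. norm (h t) \<le> C * cmod t ^ M"
    using vanishes_to_order_pos[OF assms(1)] by blast
  have "\<forall>\<^sub>F t in nhds 0. norm (h t) \<le> C * cmod t ^ N"
    using C(2) eventually_cmod_less[OF zero_less_one]
  proof eventually_elim
    case (elim t)
    have "C * cmod t ^ M \<le> C * cmod t ^ N"
      using elim(2) assms(2) C(1) by (intro mult_left_mono power_decreasing) auto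
    then show ?case using elim(1) by linarith
  qed
  then show ?thesis unfolding vanishes_to_order_iff by blast
qed

lemma vanishes_to_order_add:
  assumes "vanishes_to_order f N" "vanishes_to_order g N"
  shows "vanishes_to_order (\<lambda>t. f t + g t) N"
proof -
  obtain C D where *: "\<forall>\<^sub>F t in nhds 0. norm (f t) \<le> C * cmod t ^ N"
    "\<forall>\<^sub>F t in nhds 0. norm (g t) \<le> D * cmod t ^ N"
    using assms unfolding vanishes_to_order_iff by blast
  have "\<forall>\<^sub>F t in nhds 0. norm (f t + g t) \<le> (C + D) * cmod t ^ N"
    using * by eventually_elim (smt (verit) distrib_right norm_triangle_ineq)
  then show ?thesis unfolding vanishes_to_order_iff by blast
qed

lemma vanishes_to_order_linear:
  assumes "vanishes_to_order f N" "bounded_linear L"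
  shows "vanishes_to_order (\<lambda>t. L (f t)) N"
proof -
  obtain K where "\<And>x. norm (L x) \<le> norm x * K"
    using bounded_linear.bounded[OF assms(2)] by blast
  then show ?thesis
    using vanishes_to_order_compare[OF assms(1), of "\<lambda>t. L (f t)" K] by (simp add: mult.commute)
qed

lemma vanishes_to_order_0:
  assumes "isCont h 0"
  shows "vanishes_to_order h 0"
proof -
  have "\<forall>\<^sub>F t in nhds 0. dist (h t) (h 0) < 1"
    using assms by (auto simp: isCont_def tendsto_at_iff_tendsto_nhds intro: tendstoD)
  then have "\<forall>\<^sub>F t in nhds 0. norm (h t) \<le> (norm (h 0) + 1) * cmod t ^ 0"
  proof (rule eventually_mono)
    show "norm (h t) \<le> (norm (h 0) + 1) * cmod t ^ 0" if "dist (h t) (h 0) < 1" for t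
      using that norm_triangle_sub[of "h t" "h 0"] by (simp add: dist_norm)
  qed
  then show ?thesis unfolding vanishes_to_order_iff by blast
qed

lemma vanishes_to_order_1:
  assumes "h differentiable at 0" "h 0 = 0"
  shows "vanishes_to_order h 1"
proof -
  obtain D where D: "(h has_derivative D) (at 0)"
    using assms(1) differentiable_def by blast
  then interpret bounded_linear D by (rule has_derivative_bounded_linear)
  obtain K where K: "\<And>x. norm (D x) \<le> norm x * K"
    using bounded by blast
  obtain d where "d > 0" and d: "\<And>y. norm (y - 0) < d \<Longrightarrow> norm (h y - h 0 - D (y - 0)) \<le> 1 * norm (y - 0)"
    using D[unfolded has_derivative_at_alt] zero_less_one by blast
  have "norm (h t) \<le> (K + 1) * cmod t" if "cmod t < d" for t
    using d[of t] K[of t] norm_triangle_sub[of "h t" "D t"] that assms(2)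
    by (simp add: algebra_simps)
  then have "\<forall>\<^sub>F t in nhds 0. norm (h t) \<le> (K + 1) * cmod t ^ 1"
    unfolding eventually_nhds_metric using \<open>d > 0\<close> by auto
  then show ?thesis unfolding vanishes_to_order_iff by blast
qed

lemma vanishes_to_order_eq_0:
  assumes "vanishes_to_order h N" "N > 0"
  shows "h 0 = 0"
proof -
  obtain C d where "d > 0" "\<And>t. cmod t < d \<Longrightarrow> norm (h t) \<le> C * cmod t ^ N"
    using vanishes_to_order_ball[OF assms(1)] by metis
  from this(2)[of 0] \<open>d > 0\<close> show ?thesis using assms(2) by (simp add: zero_power)
qed

text \<open>A bound off the origin forces the right value at the origin in the limit. The
  interpolation below and the estimate of the Laplacian along a curve both divide by powers of a
  distance to \<open>0\<close>, and so give punctured bounds only.\<close>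

lemma vanishes_to_order_punctured:
  assumes "isCont h 0" "\<forall>\<^sub>F t in at 0. norm (h t) \<le> C * cmod t ^ N"
  shows "vanishes_to_order h N"
proof -
  have "((\<lambda>t. norm (h t)) \<longlongrightarrow> norm (h 0)) (at 0)"
    using assms(1) isCont_def tendsto_norm by blast
  moreover have "((\<lambda>t. C * cmod t ^ N) \<longlongrightarrow> C * cmod 0 ^ N) (at 0)"
    by (intro tendsto_intros)
  ultimately have "norm (h 0) \<le> C * cmod 0 ^ N"
    using tendsto_le[OF _ _ _ assms(2)] at_neq_bot by blast
  then have "\<forall>\<^sub>F t in nhds 0. norm (h t) \<le> C * cmod t ^ N"
    using assms(2) unfolding eventually_nhds_conv_at by blast
  then show ?thesis unfolding vanishes_to_order_iff by blast
qed

text \<open>The positive \<open>m\<close> makes \<open>a t\<close> tend to \<open>0\<close>, where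
  the bound on \<open>h\<close> is available.\<close>

lemma vanishes_to_order_compose:
  assumes "vanishes_to_order h N" "vanishes_to_order a m" "m > 0"
  shows "vanishes_to_order (\<lambda>t. h (a t)) (m * N)"
proof -
  obtain C where C: "C > 0" "\<forall>\<^sub>F t in nhds 0. norm (h t) \<le> C * cmod t ^ N"
    using vanishes_to_order_pos[OF assms(1)] by blast
  obtain D where D: "D > 0" "\<forall>\<^sub>F t in nhds 0. norm (a t) \<le> D * cmod t ^ m"
    using vanishes_to_order_pos[OF assms(2)] by blast
  have "((\<lambda>t. D * cmod t ^ m) \<longlongrightarrow> D * cmod 0 ^ m) (nhds 0)"
    by (intro tendsto_intros filterlim_ident)
  then have "((\<lambda>t. D * cmod t ^ m) \<longlongrightarrow> 0) (nhds 0)"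
    using assms(3) by (simp add: zero_power)
  then have "(a \<longlongrightarrow> 0) (nhds 0)"
    by (rule Lim_null_comparison[OF D(2)])
  then have "\<forall>\<^sub>F t in nhds 0. norm (h (a t)) \<le> C * cmod (a t) ^ N"
    by (rule eventually_compose_filterlim[OF C(2)])
  then have "\<forall>\<^sub>F t in nhds 0. norm (h (a t)) \<le> (C * D ^ N) * cmod t ^ (m * N)"
    using D(2)
  proof eventually_elim
    case (elim t)
    have "C * cmod (a t) ^ N \<le> C * (D * cmod t ^ m) ^ N"
      using elim(2) C(1) by (intro mult_left_mono power_mono) auto
    then show ?case
      using elim(1) by (simp add: power_mult_distrib power_mult mult.assoc)
  qed
  then show ?thesis unfolding vanishes_to_order_iff by blast
qed

lemma smooth_on_isCont: "smooth_on U f \<Longrightarrow> open U \<Longrightarrow> x \<in> U \<Longrightarrow> isCont f x"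
  using smooth_on_differentiable differentiable_imp_continuous_within by blast

lemma has_vector_derivative_line:
  assumes "g differentiable at (z + s *\<^sub>R v)"
  shows "((\<lambda>s. g (z + s *\<^sub>R v)) has_vector_derivative dderiv g v (z + s *\<^sub>R v)) (at s within T)"
proof -
  have D: "(g has_derivative (\<lambda>u. dderiv g u (z + s *\<^sub>R v))) (at (z + s *\<^sub>R v))"
    by (rule has_derivative_dderiv[OF assms])
  then interpret bounded_linear "\<lambda>u. dderiv g u (z + s *\<^sub>R v)"
    by (rule has_derivative_bounded_linear)
  have "((\<lambda>s. z + s *\<^sub>R v) has_derivative (\<lambda>r. r *\<^sub>R v)) (at s within T)"
    by (auto intro!: derivative_eq_intros)
  from has_derivative_compose[OF this D] show ?thesis
    by (simp add: has_vector_derivative_def scaleR)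
qed

text \<open>The Landau--Kolmogorov interpolation argument: comparing \<open>f\<close> at distance \<open>\<bar>z\<bar>\<^sup>N\<close>
  from \<open>z\<close> costs half of the order, which is harmless for infinite order.\<close>

lemma vanishes_to_order_dderiv:
  assumes smooth: "smooth_on (ball 0 e) f" and "e > 0" and v: "v \<in> {1, \<i>}"
    and van: "vanishes_to_order f (2 * N)"
  shows "vanishes_to_order (dderiv f v) N"
proof -
  have [simp]: "v \<in> Basis" "cmod v = 1"
    using v by (auto simp: Basis_complex_def)
  note s1 = smooth_on_dderiv[OF smooth \<open>v \<in> Basis\<close>]
  note s2 = smooth_on_dderiv[OF s1 \<open>v \<in> Basis\<close>]
  have c1: "isCont (dderiv f v) 0"
    using smooth_on_isCont[OF s1] \<open>e > 0\<close> by simp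
  show ?thesis
  \<comment> \<open>For \<open>N = 0\<close> the step length used below would be 1, whatever
    \<open>z\<close> is; here boundedness near \<open>0\<close> follows from continuity.\<close>
  proof (cases "N = 0")
    case True
    then show ?thesis using vanishes_to_order_0[OF c1] by simp
  next
    case False
    have "compact (dderiv (dderiv f v) v ` cball 0 (e/2))"
      using smooth_on_isCont[OF s2] \<open>e > 0\<close>
      by (intro compact_continuous_image continuous_at_imp_continuous_on) auto
    then obtain B where B: "\<And>z. z \<in> cball 0 (e/2) \<Longrightarrow> norm (dderiv (dderiv f v) v z) \<le> B"
      using compact_imp_bounded bounded_iff by (metis imageI)
    obtain C d where "C > 0" "d > 0" and C: "\<And>z. cmod z < d \<Longrightarrow> norm (f z) \<le> C * cmod z ^ (2 * N)"
      using vanishes_to_order_ball[OF van] by blast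
    \<comment> \<open>\<open>d/2\<close> keeps the displaced point within reach of the bound
      \<open>C\<close>, \<open>e/4\<close> keeps the segment inside the ball of radius
      \<open>e/2\<close> where \<open>B\<close> bounds the second derivative, and 1 gives
      \<open>h \<le> cmod z\<close>.\<close>
    define d' where "d' = min (min (d/2) (e/4)) 1"
    have "d' > 0" using \<open>d > 0\<close> \<open>e > 0\<close> by (simp add: d'_def)
    have bound: "norm (dderiv f v z) \<le> (C * 2 ^ (2 * N) + C + B) * cmod z ^ N"
      if z: "cmod z < d'" "z \<noteq> 0" for z
    proof -
      define h where "h = cmod z ^ N"
      have "h > 0" "h \<le> cmod z"
        using z False power_decreasing[of 1 N "cmod z"] by (auto simp: h_def d'_def)
      have hh: "cmod z ^ (2 * N) = h * h"
        unfolding h_def mult_2 power_add ..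
      have small: "cmod (z + s *\<^sub>R v) \<le> 2 * cmod z" if "s \<in> {0..h}" for s
      proof -
        have "cmod (s *\<^sub>R v) \<le> cmod z"
          using that \<open>h \<le> cmod z\<close> by auto
        then show ?thesis using norm_triangle_ineq[of z "s *\<^sub>R v"] by linarith
      qed
      have in_cball: "z + s *\<^sub>R v \<in> cball 0 (e/2)" and in_ball: "z + s *\<^sub>R v \<in> ball 0 e"
        if "s \<in> {0..h}" for s
        using small[OF that] z \<open>e > 0\<close> by (auto simp: d'_def)
      have d1: "((\<lambda>s. g (z + s *\<^sub>R v)) has_vector_derivative dderiv g v (z + s *\<^sub>R v)) (at s within {0..h})"
        if g: "smooth_on (ball 0 e) g" and s: "s \<in> {0..h}" for g :: "complex \<Rightarrow> 'a" and s
        by (intro has_vector_derivative_line smooth_on_differentiable[OF g _ in_ball[OF s]]) simp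
      have deriv_close: "norm (dderiv f v (z + s *\<^sub>R v) - dderiv f v z) \<le> B * h" if s: "s \<in> {0..h}" for s
      proof -
        have "norm (dderiv f v (z + s *\<^sub>R v) - dderiv f v (z + 0 *\<^sub>R v)) \<le> B * norm (s - 0)"
        proof (rule differentiable_bound[of "{0..h}" "\<lambda>s. dderiv f v (z + s *\<^sub>R v)"
              "\<lambda>s r. r *\<^sub>R dderiv (dderiv f v) v (z + s *\<^sub>R v)"])
          show "((\<lambda>s. dderiv f v (z + s *\<^sub>R v)) has_derivative
            (\<lambda>r. r *\<^sub>R dderiv (dderiv f v) v (z + s *\<^sub>R v))) (at s within {0..h})"
            if "s \<in> {0..h}" for s
            using d1[OF s1 that] by (simp add: has_vector_derivative_def)
          show "onorm (\<lambda>r. r *\<^sub>R dderiv (dderiv f v) v (z + s *\<^sub>R v)) \<le> B" if "s \<in> {0..h}" for s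
            using B[OF in_cball[OF that]] by (intro onorm_le) (simp add: mult.commute[of B] mult_left_mono)
        qed (use s \<open>h > 0\<close> in auto)
        moreover have "B \<ge> 0"
          using order_trans[OF norm_ge_zero B[of 0]] \<open>e > 0\<close> by simp
        then have "B * \<bar>s\<bar> \<le> B * h" using s by (intro mult_left_mono) auto
        ultimately show ?thesis by simp
      qed
      have "norm (f (z + h *\<^sub>R v) - f (z + 0 *\<^sub>R v) - (h - 0) *\<^sub>R dderiv f v (z + 0 *\<^sub>R v)) \<le> norm (h - 0) * (B * h)"
      proof (rule vector_differentiable_bound_linearization[where S = "{0..h}"])
        show "((\<lambda>s. f (z + s *\<^sub>R v)) has_vector_derivative dderiv f v (z + s *\<^sub>R v)) (at s within {0..h})"
          if "s \<in> {0..h}" for s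
          using d1[OF smooth that] .
      qed (use \<open>h > 0\<close> deriv_close in \<open>auto simp: closed_segment_eq_real_ivl\<close>)
      then have "norm (f (z + h *\<^sub>R v) - f z - h *\<^sub>R dderiv f v z) \<le> B * h * h"
        using \<open>h > 0\<close> by (simp add: mult.commute)
      moreover have "norm (f (z + h *\<^sub>R v)) \<le> C * 2 ^ (2 * N) * h * h"
      proof -
        have l: "cmod (z + h *\<^sub>R v) \<le> 2 * cmod z" using small \<open>h > 0\<close> by auto
        then have "norm (f (z + h *\<^sub>R v)) \<le> C * cmod (z + h *\<^sub>R v) ^ (2 * N)"
          using z by (intro C) (auto simp: d'_def)
        also have "\<dots> \<le> C * (2 * cmod z) ^ (2 * N)"
          using l \<open>C > 0\<close> by (intro mult_left_mono power_mono) auto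
        finally show ?thesis by (simp add: power_mult_distrib hh mult.assoc)
      qed
      moreover have "norm (f z) \<le> C * h * h"
        using C[of z] z \<open>d > 0\<close> by (simp add: hh mult.assoc d'_def)
      moreover have "norm (h *\<^sub>R dderiv f v z) \<le> norm (f (z + h *\<^sub>R v) - f z - h *\<^sub>R dderiv f v z)
          + norm (f (z + h *\<^sub>R v)) + norm (f z)"
        using norm_triangle_ineq4[of "f (z + h *\<^sub>R v)" "f (z + h *\<^sub>R v) - f z - h *\<^sub>R dderiv f v z"]
          norm_triangle_ineq4[of "f (z + h *\<^sub>R v) - (f (z + h *\<^sub>R v) - f z - h *\<^sub>R dderiv f v z)" "f z"]
        by simp
      \<comment> \<open>All terms on the right are of size \<open>h * h\<close>: the values of
        \<open>f\<close> because \<open>cmod z ^ (2 * N) = h * h\<close>, the remainder because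
        \<open>B\<close> bounds the second derivative. Cancelling one \<open>h\<close> leaves order
        \<open>N\<close>.\<close>
      ultimately have "h * norm (dderiv f v z) \<le> h * ((C * 2 ^ (2 * N) + C + B) * h)"
        using \<open>h > 0\<close> by (simp add: algebra_simps)
      then show ?thesis
        using \<open>h > 0\<close> mult_le_cancel_left_pos unfolding h_def by blast
    qed
    have "\<forall>\<^sub>F t in at 0. norm (dderiv f v t) \<le> (C * 2 ^ (2 * N) + C + B) * cmod t ^ N"
      unfolding eventually_at using \<open>d' > 0\<close> bound by auto
    then show ?thesis by (rule vanishes_to_order_punctured[OF c1])
  qed
qed

text \<open>Mean value inequality on the closed disc of radius \<open>cmod z\<close>, where both
  partials are at most a constant times \<open>cmod z ^ N\<close>. Unlike differentiation, this
  direction loses nothing and gains one order.\<close>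

lemma vanishes_to_order_SucI:
  assumes smooth: "smooth_on (ball 0 e) f" and "e > 0" and "f 0 = 0"
    and v1: "vanishes_to_order (dderiv f 1) N" and vi: "vanishes_to_order (dderiv f \<i>) N"
  shows "vanishes_to_order f (Suc N)"
proof -
  obtain C d where "C > 0" "d > 0" and C: "\<And>z. cmod z < d \<Longrightarrow> norm (dderiv f 1 z) \<le> C * cmod z ^ N"
    using vanishes_to_order_ball[OF v1] by blast
  obtain D d' where "D > 0" "d' > 0" and D: "\<And>z. cmod z < d' \<Longrightarrow> norm (dderiv f \<i> z) \<le> D * cmod z ^ N"
    using vanishes_to_order_ball[OF vi] by blast
  define \<delta> where "\<delta> = min e (min d d')"
  have "norm (f z) \<le> (C + D) * cmod z ^ Suc N" if z: "cmod z < \<delta>" for z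
  proof -
    have "norm (f z - f 0) \<le> ((C + D) * cmod z ^ N) * norm (z - 0)"
    proof (rule differentiable_bound[of "cball 0 (cmod z)"])
      fix x :: complex assume x: "x \<in> cball 0 (cmod z)"
      have diff: "f differentiable at x"
        using smooth_on_differentiable[OF smooth] x z by (auto simp: \<delta>_def)
      show "(f has_derivative (\<lambda>v. dderiv f v x)) (at x within cball 0 (cmod z))"
        using has_derivative_dderiv[OF diff] has_derivative_at_withinI by blast
      show "onorm (\<lambda>v. dderiv f v x) \<le> (C + D) * cmod z ^ N"
      proof (rule onorm_le)
        fix v
        have "norm (dderiv f v x) \<le> \<bar>Re v\<bar> * norm (dderiv f 1 x) + \<bar>Im v\<bar> * norm (dderiv f \<i> x)"
          using dderiv_complex[OF diff, of v] by (metis norm_scaleR norm_triangle_ineq)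
        also have "\<dots> \<le> cmod v * (C * cmod x ^ N) + cmod v * (D * cmod x ^ N)"
          using C[of x] D[of x] x z
          by (intro add_mono mult_mono abs_Re_le_cmod abs_Im_le_cmod) (auto simp: \<delta>_def)
        also have "\<dots> = (C + D) * cmod x ^ N * cmod v"
          by (simp add: algebra_simps)
        also have "\<dots> \<le> (C + D) * cmod z ^ N * cmod v"
          using x \<open>C > 0\<close> \<open>D > 0\<close> by (intro mult_right_mono mult_left_mono power_mono) auto
        finally show "norm (dderiv f v x) \<le> (C + D) * cmod z ^ N * cmod v" .
      qed
    qed auto
    then show ?thesis using \<open>f 0 = 0\<close> by (simp add: algebra_simps)
  qed
  moreover have "\<delta> > 0" using \<open>e > 0\<close> \<open>d > 0\<close> \<open>d' > 0\<close> by (simp add: \<delta>_def)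
  ultimately show ?thesis unfolding vanishes_to_order_def by blast
qed

text \<open>Growth form of infinite order. It survives comparison and substitution, and losing a
  constant factor in the exponent is invisible in it; \<open>flat_at0_iff_flatO\<close> links it to
  derivatives at \<open>0\<close>.\<close>

definition flatO :: "(complex \<Rightarrow> 'b::real_normed_vector) \<Rightarrow> bool" where
  "flatO h \<longleftrightarrow> (\<forall>N. vanishes_to_order h N)"

lemma flatO_eq_0: "flatO h \<Longrightarrow> h 0 = 0"
  unfolding flatO_def using vanishes_to_order_eq_0[of h 1] by simp

lemma flatO_add: "flatO f \<Longrightarrow> flatO g \<Longrightarrow> flatO (\<lambda>t. f t + g t)"
  unfolding flatO_def using vanishes_to_order_add by blast

lemma flatO_linear: "flatO f \<Longrightarrow> bounded_linear L \<Longrightarrow> flatO (\<lambda>t. L (f t))"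
  unfolding flatO_def using vanishes_to_order_linear by blast

lemma flatO_cong: "flatO f \<Longrightarrow> \<forall>\<^sub>F t in nhds 0. g t = f t \<Longrightarrow> flatO g"
  unfolding flatO_def using vanishes_to_order_cong by blast

lemma flatO_dderiv:
  "smooth_on (ball 0 e) f \<Longrightarrow> e > 0 \<Longrightarrow> v \<in> {1, \<i>} \<Longrightarrow> flatO f \<Longrightarrow> flatO (dderiv f v)"
  unfolding flatO_def using vanishes_to_order_dderiv by blast

lemma flatO_iter_dderiv:
  assumes "smooth_on (ball 0 e) f" "e > 0" "flatO f" "vs \<in> lists {1, \<i>}"
  shows "smooth_on (ball 0 e) (iter_dderiv vs f) \<and> flatO (iter_dderiv vs f)"
  using assms(4)
proof (induction vs)
  case Nil
  then show ?case using assms by simp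
next
  case (Cons v vs)
  then show ?case
    using flatO_dderiv[of e "iter_dderiv vs f" v] smooth_on_dderiv[of "ball 0 e" "iter_dderiv vs f" v]
      assms(2) by (auto simp: Basis_complex_def)
qed

text \<open>A growth bound passes to derivatives by interpolation, and a flat function is 0 at the
  origin; conversely, vanishing derivatives are integrated back one order at a time.\<close>

lemma flat_at0_iff_flatO:
  assumes smooth: "smooth_on (ball 0 e) F" and e: "e > 0"
  shows "flat_at0 F \<longleftrightarrow> flatO F"
proof
  assume "flatO F"
  then show "flat_at0 F"
    unfolding flat_at0_def using flatO_iter_dderiv[OF smooth e] flatO_eq_0 by blast
next
  assume flat: "flat_at0 F"
  have sm: "smooth_on (ball 0 e) (iter_dderiv vs F)" if "vs \<in> lists {1, \<i>}" for vs
    using that by (induction vs) (auto intro: smooth smooth_on_dderiv simp: Basis_complex_def)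
  \<comment> \<open>The induction treats all words at once, since order \<open>Suc N\<close> for
    \<open>vs\<close> needs order \<open>N\<close> for the longer words
    \<open>v # vs\<close>.\<close>
  have "\<forall>vs\<in>lists {1, \<i>}. vanishes_to_order (iter_dderiv vs F) N" for N
  proof (induction N)
    case 0
    show ?case
    proof
      fix vs assume "vs \<in> lists {1::complex, \<i>}"
      then have "isCont (iter_dderiv vs F) 0"
        using smooth_on_isCont[OF sm, of vs 0] e by simp
      then show "vanishes_to_order (iter_dderiv vs F) 0" by (rule vanishes_to_order_0)
    qed
  next
    case (Suc N)
    show ?case
    proof
      fix vs assume vs: "vs \<in> lists {1::complex, \<i>}"
      then have "v # vs \<in> lists {1, \<i>}" if "v \<in> {1, \<i>}" for v
        using that by simp
      then have "vanishes_to_order (dderiv (iter_dderiv vs F) v) N" if "v \<in> {1, \<i>}" for v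
        using Suc that by (metis iter_dderiv.simps(2))
      then show "vanishes_to_order (iter_dderiv vs F) (Suc N)"
        using flat vs by (intro vanishes_to_order_SucI[OF sm[OF vs] e]) (auto simp: flat_at0_def)
    qed
  qed
  then show "flatO F" unfolding flatO_def by (metis iter_dderiv.simps(1) lists.Nil)
qed

section \<open>Wirtinger derivatives\<close>

text \<open>Prepares Schwarz's theorem, as the second difference is symmetric in \<open>u\<close>
  and \<open>v\<close>. Real values matter: the mean value theorem as an equation is used twice,
  first in direction \<open>u\<close> on the increment in direction \<open>v\<close>, then in
  direction \<open>v\<close> on \<open>dderiv f u\<close>.\<close>

lemma second_difference_MVT:
  fixes f :: "complex \<Rightarrow> real"
  assumes sm: "smooth_on (ball x e) f" and u: "u \<in> {1, \<i>}" and v: "v \<in> {1, \<i>}"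
    and h: "0 < h" "2 * h < e"
  obtains y where "dist x y \<le> 2 * h"
    "f (x + h *\<^sub>R u + h *\<^sub>R v) - f (x + h *\<^sub>R u) - f (x + h *\<^sub>R v) + f x
      = h * (h * dderiv (dderiv f u) v y)"
proof -
  have uv: "cmod u = 1" "cmod v = 1" "u \<in> Basis"
    using u v by (auto simp: Basis_complex_def)
  have near: "dist x (x + s *\<^sub>R u + t *\<^sub>R v) \<le> 2 * h" if "0 \<le> s" "s \<le> h" "0 \<le> t" "t \<le> h" for s t
    using norm_triangle_ineq[of "s *\<^sub>R u" "t *\<^sub>R v"] that uv
    by (simp add: dist_commute[of x], simp add: dist_norm add.assoc)
  then have ball: "x + s *\<^sub>R u + t *\<^sub>R v \<in> ball x e" if "0 \<le> s" "s \<le> h" "0 \<le> t" "t \<le> h" for s t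
    using that h by force
  define g where "g s = f (x + s *\<^sub>R u + h *\<^sub>R v) - f (x + s *\<^sub>R u)" for s
  have line: "((\<lambda>s. k (z + s *\<^sub>R w)) has_real_derivative dderiv k w (z + s *\<^sub>R w)) (at s)"
    if "smooth_on (ball x e) k" "z + s *\<^sub>R w \<in> ball x e" for k :: "complex \<Rightarrow> real" and z w s
    using has_vector_derivative_line[of k z s w] smooth_on_differentiable[OF that(1) open_ball that(2)]
    by (simp add: has_real_derivative_iff_has_vector_derivative)
  have "DERIV g s :> dderiv f u (x + s *\<^sub>R u + h *\<^sub>R v) - dderiv f u (x + s *\<^sub>R u)"
    if "0 \<le> s" "s \<le> h" for s
    unfolding g_def
    using line[OF sm, of "x + h *\<^sub>R v" s u] line[OF sm, of x s u] ball[OF that, of h] ball[OF that, of 0] h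
    by (intro DERIV_diff) (auto simp: algebra_simps)
  then obtain s where s: "0 < s" "s < h" and
    gs: "g h - g 0 = (h - 0) * (dderiv f u (x + s *\<^sub>R u + h *\<^sub>R v) - dderiv f u (x + s *\<^sub>R u))"
    using MVT2[OF h(1), of g "\<lambda>s. dderiv f u (x + s *\<^sub>R u + h *\<^sub>R v) - dderiv f u (x + s *\<^sub>R u)"]
    by auto
  have "DERIV (\<lambda>t. dderiv f u (x + s *\<^sub>R u + t *\<^sub>R v)) t :> dderiv (dderiv f u) v (x + s *\<^sub>R u + t *\<^sub>R v)"
    if "0 \<le> t" "t \<le> h" for t
    using line[OF smooth_on_dderiv[OF sm uv(3)], of "x + s *\<^sub>R u" t v] ball[of s t] that s by simp
  then obtain t where t: "0 < t" "t < h" and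
    "dderiv f u (x + s *\<^sub>R u + h *\<^sub>R v) - dderiv f u (x + s *\<^sub>R u + 0 *\<^sub>R v)
      = (h - 0) * dderiv (dderiv f u) v (x + s *\<^sub>R u + t *\<^sub>R v)"
    using MVT2[OF h(1), of "\<lambda>t. dderiv f u (x + s *\<^sub>R u + t *\<^sub>R v)"
        "\<lambda>t. dderiv (dderiv f u) v (x + s *\<^sub>R u + t *\<^sub>R v)"] by auto
  with gs have "g h - g 0 = h * (h * dderiv (dderiv f u) v (x + s *\<^sub>R u + t *\<^sub>R v))"
    by simp
  then show ?thesis
    using that[of "x + s *\<^sub>R u + t *\<^sub>R v"] near[of s t] s t by (simp add: g_def)
qed

text \<open>Schwarz's theorem. Both second differences coincide, so one mixed derivative at some
  point equals the other at some other point, both within \<open>2 * h\<close> of \<open>x\<close>;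
  continuity then excludes a gap at \<open>x\<close>.\<close>

lemma dderiv_commute_real:
  fixes f :: "complex \<Rightarrow> real"
  assumes sm: "smooth_on U f" and "open U" "x \<in> U" and u: "u \<in> {1, \<i>}" and v: "v \<in> {1, \<i>}"
  shows "dderiv (dderiv f u) v x = dderiv (dderiv f v) u x"
proof (rule ccontr)
  assume neq: "\<not> ?thesis"
  have uv: "u \<in> Basis" "v \<in> Basis"
    using u v by (auto simp: Basis_complex_def)
  obtain e where "e > 0" and e: "ball x e \<subseteq> U"
    using \<open>open U\<close> \<open>x \<in> U\<close> openE by blast
  define \<epsilon> where "\<epsilon> = \<bar>dderiv (dderiv f u) v x - dderiv (dderiv f v) u x\<bar> / 2"
  have "\<epsilon> > 0" using neq by (simp add: \<epsilon>_def)
  have "isCont (dderiv (dderiv f u) v) x" "isCont (dderiv (dderiv f v) u) x"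
    using smooth_on_isCont[OF smooth_on_dderiv[OF smooth_on_dderiv[OF sm]]] uv assms by blast+
  then obtain d1 d2 where "d1 > 0" "d2 > 0" and
    d1: "\<And>y. dist y x < d1 \<Longrightarrow> dist (dderiv (dderiv f u) v y) (dderiv (dderiv f u) v x) < \<epsilon>" and
    d2: "\<And>y. dist y x < d2 \<Longrightarrow> dist (dderiv (dderiv f v) u y) (dderiv (dderiv f v) u x) < \<epsilon>"
    using \<open>\<epsilon> > 0\<close> unfolding continuous_at_eps_delta by (metis (no_types, lifting))
  define h where "h = min e (min d1 d2) / 3"
  have h: "0 < h" "2 * h < e" "2 * h < d1" "2 * h < d2"
    using \<open>e > 0\<close> \<open>d1 > 0\<close> \<open>d2 > 0\<close> by (auto simp: h_def)
  have sm': "smooth_on (ball x e) f" using smooth_on_subset[OF e sm] .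
  obtain y where y: "dist x y \<le> 2 * h"
    "f (x + h *\<^sub>R u + h *\<^sub>R v) - f (x + h *\<^sub>R u) - f (x + h *\<^sub>R v) + f x
      = h * (h * dderiv (dderiv f u) v y)"
    using second_difference_MVT[OF sm' u v h(1,2)] .
  obtain y' where y': "dist x y' \<le> 2 * h"
    "f (x + h *\<^sub>R v + h *\<^sub>R u) - f (x + h *\<^sub>R v) - f (x + h *\<^sub>R u) + f x
      = h * (h * dderiv (dderiv f v) u y')"
    using second_difference_MVT[OF sm' v u h(1,2)] .
  have "h * (h * dderiv (dderiv f u) v y) = h * (h * dderiv (dderiv f v) u y')"
    using y(2) y'(2) by (simp add: algebra_simps)
  then have "dderiv (dderiv f u) v y = dderiv (dderiv f v) u y'"
    using h(1) by simp
  moreover have "dist (dderiv (dderiv f u) v y) (dderiv (dderiv f u) v x) < \<epsilon>"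
    "dist (dderiv (dderiv f v) u y') (dderiv (dderiv f v) u x) < \<epsilon>"
    using d1[of y] d2[of y'] y(1) y'(1) h by (simp_all add: dist_commute)
  ultimately show False
    unfolding dist_real_def \<epsilon>_def by (simp add: abs_if split: if_splits)
qed

lemma dderiv_linear:
  assumes "f differentiable at x" "bounded_linear L"
  shows "dderiv (\<lambda>x. L (f x)) v x = L (dderiv f v x)"
  using dderiv_eqI[OF bounded_linear.has_derivative[OF assms(2) has_derivative_dderiv[OF assms(1)]]] .

lemma dderiv_dderiv_linear:
  assumes "smooth_on U f" "open U" "x \<in> U" "bounded_linear L" "u \<in> Basis"
  shows "dderiv (dderiv (\<lambda>x. L (f x)) u) v x = L (dderiv (dderiv f u) v x)"
proof -
  have "dderiv (dderiv (\<lambda>x. L (f x)) u) v x = dderiv (\<lambda>x. L (dderiv f u x)) v x"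
    using assms by (intro dderiv_cong[OF assms(2,3)] dderiv_linear smooth_on_differentiable)
  also have "\<dots> = L (dderiv (dderiv f u) v x)"
    using assms by (intro dderiv_linear smooth_on_differentiable[OF smooth_on_dderiv])
  finally show ?thesis .
qed

text \<open>Every real linear functional of \<open>f\<close> falls under the real case, and
  \<open>Re\<close> and \<open>Im\<close> separate complex numbers.\<close>

lemma dderiv_commute:
  fixes f :: "complex \<Rightarrow> complex"
  assumes "smooth_on U f" "open U" "x \<in> U"
  shows "dderiv (dderiv f 1) \<i> x = dderiv (dderiv f \<i>) 1 x"
proof -
  have "L (dderiv (dderiv f 1) \<i> x) = L (dderiv (dderiv f \<i>) 1 x)"
    if "bounded_linear L" for L :: "complex \<Rightarrow> real"
    using dderiv_commute_real[OF smooth_on_linear[OF assms(2) that assms(1)] assms(2,3), of 1 \<i>]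
      dderiv_dderiv_linear[OF assms that, of 1 \<i>] dderiv_dderiv_linear[OF assms that, of \<i> 1]
    by (simp add: Basis_complex_def)
  from this[OF bounded_linear_Re] this[OF bounded_linear_Im] show ?thesis
    by (simp add: complex_eq_iff)
qed

text \<open>The antiholomorphic companion of \<open>dz\<close>. For smooth functions
  \<open>dzb (dz f)\<close> is a quarter of the Laplacian, which is the form in which the Laplacian
  occurs below.\<close>

definition dzb :: "(complex \<Rightarrow> complex) \<Rightarrow> complex \<Rightarrow> complex" where
  "dzb g x = (dderiv g 1 x + \<i> * dderiv g \<i> x) / 2"

lemma dderiv_eq_wirtinger:
  assumes "g differentiable at x"
  shows "dderiv g v x = dz g x * v + dzb g x * cnj v"
proof -
  have "v = of_real (Re v) + \<i> * of_real (Im v)" "cnj v = of_real (Re v) - \<i> * of_real (Im v)"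
    by (simp_all add: complex_eq_iff)
  then have "dz g x * v + dzb g x * cnj v = dz g x * (of_real (Re v) + \<i> * of_real (Im v))
      + dzb g x * (of_real (Re v) - \<i> * of_real (Im v))"
    by metis
  also have "\<dots> = of_real (Re v) * dderiv g 1 x + of_real (Im v) * dderiv g \<i> x"
    by (simp add: dz_def dzb_def field_simps)
  finally show ?thesis
    using dderiv_complex[OF assms, of v] by (simp add: scaleR_conv_of_real)
qed

text \<open>Most of the calculus rules below arise by writing the real derivative as
  \<open>A * v + B * cnj v\<close> and reading off the two coefficients.\<close>

lemma wirtinger_eqI:
  assumes "(g has_derivative (\<lambda>v. A * v + B * cnj v)) (at x)"
  shows "dz g x = A" "dzb g x = B"
  by (simp_all add: dz_def dzb_def dderiv_eqI[OF assms] field_simps)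

lemma has_derivative_wirtinger:
  assumes "g differentiable at x"
  shows "(g has_derivative (\<lambda>v. dz g x * v + dzb g x * cnj v)) (at x)"
  using has_derivative_dderiv[OF assms] dderiv_eq_wirtinger[OF assms] by simp

lemma wirtinger_cong:
  assumes "open U" "x \<in> U" "\<And>y. y \<in> U \<Longrightarrow> f y = g y"
  shows "dz f x = dz g x" "dzb f x = dzb g x"
  using dderiv_cong[OF assms] by (simp_all add: dz_def dzb_def)

text \<open>Shows both operators as sums of partials times constants, the shape to which the closure
  rules for sums and bounded linear maps apply.\<close>

lemma wirtinger_alt:
  "dz f = (\<lambda>x. dderiv f 1 x * (1/2) + dderiv f \<i> x * (-\<i>/2))"
  "dzb f = (\<lambda>x. dderiv f 1 x * (1/2) + dderiv f \<i> x * (\<i>/2))"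
  by (rule ext, simp add: dz_def dzb_def field_simps)+

lemma smooth_on_wirtinger:
  assumes "smooth_on U f" "open U"
  shows "smooth_on U (dz f)" "smooth_on U (dzb f)"
proof -
  have s: "smooth_on U (dderiv f 1)" "smooth_on U (dderiv f \<i>)"
    using smooth_on_dderiv[OF assms(1)] by (auto simp: Basis_complex_def)
  then show "smooth_on U (dz f)" "smooth_on U (dzb f)"
    unfolding wirtinger_alt
    by (intro smooth_on_add smooth_on_linear[OF _ bounded_linear_mult_left] assms(2); simp)+
qed

lemma flatO_wirtinger:
  assumes "smooth_on (ball 0 e) f" "e > 0" "flatO f"
  shows "flatO (dz f)" "flatO (dzb f)"
proof -
  have s: "flatO (dderiv f 1)" "flatO (dderiv f \<i>)"
    using flatO_dderiv[OF assms(1,2) _ assms(3)] by auto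
  then show "flatO (dz f)" "flatO (dzb f)"
    unfolding wirtinger_alt
    by (intro flatO_add flatO_linear[OF _ bounded_linear_mult_left]; simp)+
qed

lemma wirtinger_commute:
  assumes "smooth_on U f" "open U" "x \<in> U"
  shows "dzb (dz f) x = dz (dzb f) x"
proof -
  have d: "dderiv f 1 differentiable at x" "dderiv f \<i> differentiable at x"
    using assms by (auto intro!: smooth_on_differentiable[OF smooth_on_dderiv] simp: Basis_complex_def)
  have "dderiv (\<lambda>x. dderiv f 1 x * a + dderiv f \<i> x * b) v x
      = dderiv (dderiv f 1) v x * a + dderiv (dderiv f \<i>) v x * b" for a b v
    by (intro dderiv_eqI has_derivative_add has_derivative_mult_left has_derivative_dderiv d)
  then show ?thesis
    unfolding dz_def[of "dzb f"] dzb_def[of "dz f"] wirtinger_alt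
    by (simp only: dderiv_commute[OF assms]) (simp add: field_simps)
qed

lemma wirtinger_add:
  assumes "f differentiable at x" "g differentiable at x"
  shows "dz (\<lambda>x. f x + g x) x = dz f x + dz g x" "dzb (\<lambda>x. f x + g x) x = dzb f x + dzb g x"
proof -
  have "((\<lambda>x. f x + g x) has_derivative (\<lambda>v. (dz f x + dz g x) * v + (dzb f x + dzb g x) * cnj v)) (at x)"
    using has_derivative_add[OF has_derivative_wirtinger[OF assms(1)] has_derivative_wirtinger[OF assms(2)]]
    by (simp add: algebra_simps)
  then show "dz (\<lambda>x. f x + g x) x = dz f x + dz g x" "dzb (\<lambda>x. f x + g x) x = dzb f x + dzb g x"
    by (rule wirtinger_eqI)+
qed

lemma dzb_mult:
  assumes "f differentiable at x" "g differentiable at x"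
  shows "dzb (\<lambda>x. f x * g x) x = dzb f x * g x + f x * dzb g x"
proof -
  have "((\<lambda>x. f x * g x) has_derivative (\<lambda>v. (dz f x * g x + f x * dz g x) * v
      + (dzb f x * g x + f x * dzb g x) * cnj v)) (at x)"
    using has_derivative_mult[OF has_derivative_wirtinger[OF assms(1)] has_derivative_wirtinger[OF assms(2)]]
    by (simp add: algebra_simps)
  then show ?thesis by (rule wirtinger_eqI)
qed

lemma wirtinger_cnj:
  assumes "f differentiable at x"
  shows "dz (\<lambda>x. cnj (f x)) x = cnj (dzb f x)" "dzb (\<lambda>x. cnj (f x)) x = cnj (dz f x)"
proof -
  have "((\<lambda>x. cnj (f x)) has_derivative (\<lambda>v. cnj (dzb f x) * v + cnj (dz f x) * cnj v)) (at x)"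
    using bounded_linear.has_derivative[OF bounded_linear_cnj has_derivative_wirtinger[OF assms]]
    by (simp add: algebra_simps)
  then show "dz (\<lambda>x. cnj (f x)) x = cnj (dzb f x)" "dzb (\<lambda>x. cnj (f x)) x = cnj (dz f x)"
    by (rule wirtinger_eqI)+
qed

lemma wirtinger_holomorphic:
  assumes "f holomorphic_on U" "open U" "x \<in> U"
  shows "dz f x = deriv f x" "dzb f x = 0"
proof -
  have "(f has_derivative (\<lambda>v. deriv f x * v + 0 * cnj v)) (at x)"
    using has_field_derivative_imp_has_derivative[OF holomorphic_derivI[OF assms]] by simp
  then show "dz f x = deriv f x" "dzb f x = 0" by (rule wirtinger_eqI)+
qed

text \<open>\<open>deriv a t * v\<close> is complex linear in \<open>v\<close>, so a holomorphic
  substitution does not mix the two operators. Applying both later yields the factor |a'|^2 in front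
  of the Laplacian.\<close>

lemma wirtinger_compose_holomorphic:
  assumes "g differentiable at (a t)" "a holomorphic_on U" "open U" "t \<in> U"
  shows "dz (\<lambda>t. g (a t)) t = dz g (a t) * deriv a t"
    "dzb (\<lambda>t. g (a t)) t = dzb g (a t) * cnj (deriv a t)"
proof -
  have "((\<lambda>t. g (a t)) has_derivative (\<lambda>v. (dz g (a t) * deriv a t) * v
      + (dzb g (a t) * cnj (deriv a t)) * cnj v)) (at t)"
    using has_derivative_compose_holomorphic[OF assms] dderiv_eq_wirtinger[OF assms(1)]
    by (simp add: algebra_simps)
  then show "dz (\<lambda>t. g (a t)) t = dz g (a t) * deriv a t"
    "dzb (\<lambda>t. g (a t)) t = dzb g (a t) * cnj (deriv a t)"
    by (rule wirtinger_eqI)+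
qed

lemma smooth_on_dz_power: "smooth_on U f \<Longrightarrow> open U \<Longrightarrow> smooth_on U ((dz ^^ n) f)"
  by (induction n) (auto intro: smooth_on_wirtinger)

lemma flatO_dz_power:
  "smooth_on (ball 0 e) f \<Longrightarrow> e > 0 \<Longrightarrow> flatO f \<Longrightarrow> flatO ((dz ^^ n) f)"
proof (induction n)
  case (Suc n)
  then show ?case
    using flatO_wirtinger(1)[OF smooth_on_dz_power[OF Suc.prems(1) open_ball] Suc.prems(2)] by simp
qed simp

lemma dz_power_holomorphic:
  assumes "f holomorphic_on U" "open U"
  shows "x \<in> U \<Longrightarrow> (dz ^^ n) f x = (deriv ^^ n) f x"
proof (induction n arbitrary: x)
  case (Suc n)
  have "dz ((dz ^^ n) f) x = dz ((deriv ^^ n) f) x"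
    by (rule wirtinger_cong(1)[OF assms(2) Suc.prems Suc.IH])
  also have "\<dots> = deriv ((deriv ^^ n) f) x"
    using wirtinger_holomorphic(1)[OF holomorphic_higher_deriv assms(2) Suc.prems] assms by blast
  finally show ?case by simp
qed simp

lemma dz_power_add:
  assumes "smooth_on U f" "smooth_on U g" "open U"
  shows "x \<in> U \<Longrightarrow> (dz ^^ n) (\<lambda>x. f x + g x) x = (dz ^^ n) f x + (dz ^^ n) g x"
proof (induction n arbitrary: x)
  case (Suc n)
  have "dz ((dz ^^ n) (\<lambda>x. f x + g x)) x = dz (\<lambda>x. (dz ^^ n) f x + (dz ^^ n) g x) x"
    by (rule wirtinger_cong(1)[OF assms(3) Suc.prems Suc.IH])
  also have "\<dots> = dz ((dz ^^ n) f) x + dz ((dz ^^ n) g) x"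
    using assms Suc.prems
    by (intro wirtinger_add smooth_on_differentiable[OF smooth_on_dz_power])
  finally show ?case by simp
qed simp

text \<open>If \<open>dzb (dz F)\<close> is flat, then every \<open>dz\<^sup>n F\<close> with \<open>n > 0\<close> is holomorphic up to a
  flat error, so that all derivatives of \<open>dz F\<close> at the origin are multiples of pure ones.\<close>

lemma flatO_from_pure_terms:
  fixes F :: "complex \<Rightarrow> real"
  assumes smF: "smooth_on (ball 0 e) F" and e: "e > 0" and F0: "F 0 = 0"
    and lap: "flatO (dzb (dz (\<lambda>z. complex_of_real (F z))))"
    and pure: "\<And>n. n > 0 \<Longrightarrow> (dz ^^ n) (\<lambda>z. complex_of_real (F z)) 0 = 0"
  shows "flatO F"
proof -
  define f where "f = (\<lambda>z. complex_of_real (F z))"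
  define u where "u n = (dz ^^ Suc n) f" for n
  have smf: "smooth_on (ball 0 e) f"
    unfolding f_def by (intro smooth_on_linear[OF _ bounded_linear_of_real smF]) simp
  have smu: "smooth_on (ball 0 e) (u n)" for n
    unfolding u_def using smooth_on_dz_power[OF smf] by blast
  have u_Suc: "u (Suc n) = dz (u n)" for n
    by (simp add: u_def)
  \<comment> \<open>\<open>dzb\<close> commutes with \<open>dz\<close> near \<open>0\<close>, and
    \<open>dz\<close> keeps flat functions flat, so the hypothesis, which is the case
    \<open>n = 0\<close>, propagates.\<close>
  have flat: "flatO (dzb (u n))" for n
  proof (induction n)
    case 0
    then show ?case using lap by (simp add: u_def f_def)
  next
    case (Suc n)
    have "flatO (dz (dzb (u n)))"
      using flatO_wirtinger(1)[OF smooth_on_wirtinger(2)[OF smu] e Suc] by simp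
    moreover have "\<forall>\<^sub>F t in nhds 0. dzb (u (Suc n)) t = dz (dzb (u n)) t"
      using eventually_in_ball0[OF e]
      by (rule eventually_mono) (metis open_ball u_Suc wirtinger_commute[OF smu])
    ultimately show ?case by (rule flatO_cong)
  qed
  have u0: "u n 0 = 0" for n
    using pure[of "Suc n"] unfolding u_def f_def by blast
  \<comment> \<open>Order \<open>N\<close> is proved for all \<open>n\<close> together: up to the
    flat \<open>dzb (u n)\<close>, the derivative of \<open>u n\<close> is given by
    \<open>u (Suc n)\<close>.\<close>
  have "\<forall>n. vanishes_to_order (u n) N" for N
  proof (induction N)
    case 0
    show ?case using smooth_on_isCont[OF smu] e by (auto intro: vanishes_to_order_0)
  next
    case (Suc N)
    show ?case
    proof
      fix n
      have "vanishes_to_order (dderiv (u n) v) N" for v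
      proof (rule vanishes_to_order_cong)
        show "vanishes_to_order (\<lambda>x. u (Suc n) x * v + dzb (u n) x * cnj v) N"
          using Suc flat[of n] unfolding flatO_def
          by (intro vanishes_to_order_add vanishes_to_order_linear[OF _ bounded_linear_mult_left]) auto
        show "\<forall>\<^sub>F t in nhds 0. dderiv (u n) v t = u (Suc n) t * v + dzb (u n) t * cnj v"
          using eventually_in_ball0[OF e]
          by (rule eventually_mono)
            (simp add: dderiv_eq_wirtinger[OF smooth_on_differentiable[OF smu]] u_Suc)
      qed
      then show "vanishes_to_order (u n) (Suc N)"
        using vanishes_to_order_SucI[OF smu e u0] by blast
    qed
  qed
  then have u_flat: "flatO (u 0)" unfolding flatO_def by blast
  have "vanishes_to_order f (Suc N)" for N
  proof (rule vanishes_to_order_SucI[OF smf e])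
    have ev: "\<forall>\<^sub>F t in nhds 0. dderiv f v t = u 0 t * v + cnj (u 0 t) * cnj v" for v
      using eventually_in_ball0[OF e]
    proof (rule eventually_mono)
      fix t :: complex assume "t \<in> ball 0 e"
      then have d: "f differentiable at t" using smooth_on_differentiable[OF smf] by simp
      \<comment> \<open>\<open>f\<close> is real-valued, so its \<open>dzb\<close> is the conjugate
        of its \<open>dz\<close>, and flatness of \<open>u 0\<close> controls the whole
        gradient.\<close>
      have "dzb f t = cnj (u 0 t)"
        using wirtinger_cnj(2)[OF d] by (simp add: u_def f_def)
      then show "dderiv f v t = u 0 t * v + cnj (u 0 t) * cnj v"
        using dderiv_eq_wirtinger[OF d, of v] by (simp add: u_def)
    qed
    have "flatO (\<lambda>t. u 0 t * v + cnj (u 0 t) * cnj v)" for v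
      using u_flat by (intro flatO_add flatO_linear[OF _ bounded_linear_mult_left]
          flatO_linear[OF _ bounded_linear_cnj])
    then have "flatO (dderiv f v)" for v using flatO_cong ev by blast
    then show "vanishes_to_order (dderiv f 1) N" "vanishes_to_order (dderiv f \<i>) N"
      unfolding flatO_def by blast+
  qed (simp add: f_def F0)
  then have "flatO f" unfolding flatO_def using vanishes_to_order_mono by (metis le_SucI order_refl)
  then show ?thesis
    using flatO_linear[OF _ bounded_linear_Re, of f] by (simp add: f_def)
qed

section \<open>Holomorphic functions of two variables\<close>

lemma holo2_onI:
  assumes "\<And>x. x \<in> U \<Longrightarrow> (f has_derivative D x) (at x)"
    "\<And>x v. x \<in> U \<Longrightarrow> D x (\<i> * fst v, \<i> * snd v) = \<i> * D x v"
  shows "holo2_on U f"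
  unfolding holo2_on_def using dderiv_eqI[OF assms(1)] assms differentiable_def by metis

lemma holo2_on_has_derivative:
  "holo2_on U f \<Longrightarrow> x \<in> U \<Longrightarrow> (f has_derivative (\<lambda>v. dderiv f v x)) (at x)"
  unfolding holo2_on_def using has_derivative_dderiv by blast

text \<open>\<open>holo2_on\<close> asks for compatibility with \<i>; real linearity of the
  derivative extends this to all complex factors.\<close>

lemma holo2_on_scale:
  assumes "holo2_on U f" "x \<in> U"
  shows "dderiv f (c * v, c * w) x = c * dderiv f (v, w) x"
proof -
  interpret bounded_linear "\<lambda>v. dderiv f v x"
    using has_derivative_bounded_linear[OF holo2_on_has_derivative[OF assms]] .
  have "(c * v, c * w) = Re c *\<^sub>R (v, w) + Im c *\<^sub>R (\<i> * v, \<i> * w)"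
    by (simp add: complex_eq_iff)
  moreover have "dderiv f (\<i> * v, \<i> * w) x = \<i> * dderiv f (v, w) x"
    using assms unfolding holo2_on_def by (metis fst_conv snd_conv)
  ultimately have "dderiv f (c * v, c * w) x = Re c *\<^sub>R dderiv f (v, w) x + Im c *\<^sub>R (\<i> * dderiv f (v, w) x)"
    by (simp only: add scaleR)
  then show ?thesis
    by (simp add: scaleR_conv_of_real) (metis complex_eq distrib_right mult.assoc mult.commute)
qed

lemma holo2_on_subset: "holo2_on U f \<Longrightarrow> V \<subseteq> U \<Longrightarrow> holo2_on V f"
  unfolding holo2_on_def by blast

lemma holo2_on_isCont: "holo2_on U f \<Longrightarrow> x \<in> U \<Longrightarrow> isCont f x"
  using holo2_on_has_derivative has_derivative_continuous by blast

lemma holo2_on_fst: "holo2_on U fst" and holo2_on_snd: "holo2_on U snd"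
  by (rule holo2_onI, rule bounded_linear.has_derivative[OF bounded_linear_fst has_derivative_ident]
      bounded_linear.has_derivative[OF bounded_linear_snd has_derivative_ident], simp)+

lemma holo2_on_add:
  assumes "holo2_on U f" "holo2_on U g"
  shows "holo2_on U (\<lambda>x. f x + g x)"
  by (rule holo2_onI, rule has_derivative_add[OF holo2_on_has_derivative[OF assms(1)]
        holo2_on_has_derivative[OF assms(2)]])
    (auto simp: holo2_on_scale[OF assms(1)] holo2_on_scale[OF assms(2)] distrib_left)

lemma holo2_on_compose:
  assumes f: "holo2_on V f" and A: "holo2_on U A" and B: "holo2_on U B"
    and V: "\<And>x. x \<in> U \<Longrightarrow> (A x, B x) \<in> V"
  shows "holo2_on U (\<lambda>x. f (A x, B x))"
proof (rule holo2_onI)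
  fix x assume x: "x \<in> U"
  show "((\<lambda>x. f (A x, B x)) has_derivative (\<lambda>v. dderiv f (dderiv A v x, dderiv B v x) (A x, B x))) (at x)"
    using has_derivative_compose[OF has_derivative_Pair[OF holo2_on_has_derivative[OF A x]
          holo2_on_has_derivative[OF B x]] holo2_on_has_derivative[OF f V[OF x]]] .
  show "dderiv f (dderiv A (\<i> * fst v, \<i> * snd v) x, dderiv B (\<i> * fst v, \<i> * snd v) x) (A x, B x)
      = \<i> * dderiv f (dderiv A v x, dderiv B v x) (A x, B x)" for v
    using holo2_on_scale[OF A x, of \<i> "fst v" "snd v"] holo2_on_scale[OF B x, of \<i> "fst v" "snd v"]
      holo2_on_scale[OF f V[OF x]] by simp
qed

lemma holo2_on_compose_holomorphic:
  assumes g: "g holomorphic_on S" "open S" and A: "holo2_on U A" and S: "\<And>x. x \<in> U \<Longrightarrow> A x \<in> S"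
  shows "holo2_on U (\<lambda>x. g (A x))"
proof (rule holo2_onI)
  fix x assume x: "x \<in> U"
  show "((\<lambda>x. g (A x)) has_derivative (\<lambda>v. deriv g (A x) * dderiv A v x)) (at x)"
    using has_derivative_compose[OF holo2_on_has_derivative[OF A x]
        has_field_derivative_imp_has_derivative[OF holomorphic_derivI[OF g S[OF x]]]] .
  show "deriv g (A x) * dderiv A (\<i> * fst v, \<i> * snd v) x = \<i> * (deriv g (A x) * dderiv A v x)" for v
    using holo2_on_scale[OF A x, of \<i> "fst v" "snd v"] by simp
qed

lemma holomorphic_on_compose_holo2:
  assumes f: "holo2_on V f" and a: "a holomorphic_on S" and b: "b holomorphic_on S" and "open S"
    and V: "\<And>t. t \<in> S \<Longrightarrow> (a t, b t) \<in> V"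
  shows "(\<lambda>t. f (a t, b t)) holomorphic_on S"
proof -
  have "((\<lambda>t. f (a t, b t)) has_field_derivative dderiv f (deriv a t, deriv b t) (a t, b t)) (at t)"
    if t: "t \<in> S" for t
  proof -
    have "((\<lambda>t. f (a t, b t)) has_derivative (\<lambda>h. dderiv f (deriv a t * h, deriv b t * h) (a t, b t))) (at t)"
      using has_derivative_compose[OF has_derivative_Pair[OF
            has_field_derivative_imp_has_derivative[OF holomorphic_derivI[OF a \<open>open S\<close> t]]
            has_field_derivative_imp_has_derivative[OF holomorphic_derivI[OF b \<open>open S\<close> t]]]
          holo2_on_has_derivative[OF f V[OF t]]] .
    moreover have "dderiv f (deriv a t * h, deriv b t * h) (a t, b t) = dderiv f (deriv a t, deriv b t) (a t, b t) * h" for h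
      using holo2_on_scale[OF f V[OF t], of h "deriv a t" "deriv b t"] by (simp add: mult.commute)
    ultimately show ?thesis
      by (simp add: has_field_derivative_def)
  qed
  then show ?thesis
    using holomorphic_on_open[OF \<open>open S\<close>] by blast
qed

section \<open>Local Lipschitz bounds, used to compare orders of vanishing\<close>

definition lipschitz_near :: "('a::real_normed_vector \<Rightarrow> 'b::real_normed_vector) \<Rightarrow> 'a \<Rightarrow> bool" where
  "lipschitz_near f p \<longleftrightarrow> (\<exists>L>0. \<exists>d>0. \<forall>x\<in>ball p d. \<forall>y\<in>ball p d. norm (f x - f y) \<le> L * norm (x - y))"

lemma lipschitz_nearI:
  assumes "d > 0" "\<And>x. x \<in> ball p d \<Longrightarrow> f differentiable at x"
    "\<And>x v. x \<in> ball p d \<Longrightarrow> norm (dderiv f v x) \<le> B * norm v"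
  shows "lipschitz_near f p"
proof -
  have "norm (f x - f y) \<le> max B 1 * norm (x - y)" if "x \<in> ball p d" "y \<in> ball p d" for x y
  proof (rule differentiable_bound[OF convex_ball _ _ that])
    fix z assume z: "z \<in> ball p d"
    show "(f has_derivative (\<lambda>v. dderiv f v z)) (at z within ball p d)"
      using has_derivative_dderiv[OF assms(2)[OF z]] has_derivative_at_withinI by blast
    show "onorm (\<lambda>v. dderiv f v z) \<le> max B 1"
    proof (rule onorm_bound)
      fix v
      have "norm (dderiv f v z) \<le> B * norm v" by (rule assms(3)[OF z])
      also have "\<dots> \<le> max B 1 * norm v" by (intro mult_right_mono) auto
      finally show "norm (dderiv f v z) \<le> max B 1 * norm v" .
    qed simp
  qed
  then show ?thesis
    unfolding lipschitz_near_def using \<open>d > 0\<close>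
    by (intro exI[of _ "max B 1"] conjI exI[of _ d]) auto
qed

text \<open>Cauchy's estimate on the complex lines through \<open>x\<close> bounds the derivative at \<open>x\<close>.\<close>

lemma holo2_on_lipschitz_near:
  assumes f: "holo2_on U f" and "open U" "p \<in> U"
  shows "lipschitz_near f p"
proof -
  obtain R0 where "R0 > 0" and R0: "cball p R0 \<subseteq> U"
    using \<open>open U\<close> \<open>p \<in> U\<close> open_contains_cball by blast
  \<comment> \<open>A point within \<open>R\<close> of \<open>p\<close>, moved by less than
    \<open>2 * R\<close>, stays within \<open>R0\<close> of \<open>p\<close>. Discs of radius
    \<open>2 * R\<close> leave room for Cauchy's estimate on the closed disc of radius
    \<open>R\<close>.\<close>
  define R where "R = R0 / 3"
  have "R > 0" using \<open>R0 > 0\<close> by (simp add: R_def)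
  have "compact (f ` cball p R0)"
    using holo2_on_isCont[OF f] R0
    by (intro compact_continuous_image continuous_at_imp_continuous_on) auto
  then obtain B where B: "\<And>x. x \<in> cball p R0 \<Longrightarrow> norm (f x) \<le> B"
    using compact_imp_bounded bounded_iff by (metis imageI)
  \<comment> \<open>For unit vectors the modulus of the parameter \<open>c\<close> is the distance
    covered on the complex line; general vectors follow by real homogeneity.\<close>
  have unit: "norm (dderiv f v x) \<le> B / R" if x: "x \<in> ball p R" and v: "norm v = 1" for x v
  proof -
    have nv: "norm (c * fst v, c * snd v) = cmod c" for c
    proof -
      have "norm (c * fst v, c * snd v) = cmod c * sqrt (cmod (fst v) ^ 2 + cmod (snd v) ^ 2)"
        by (simp add: norm_Pair norm_mult power_mult_distrib real_sqrt_mult flip: distrib_left)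
      moreover have "sqrt (cmod (fst v) ^ 2 + cmod (snd v) ^ 2) = 1"
        using v by (metis norm_Pair prod.collapse)
      ultimately show ?thesis by simp
    qed
    define k where "k c = f (fst x + c * fst v, snd x + c * snd v)" for c
    have inU: "(fst x + c * fst v, snd x + c * snd v) \<in> cball p R0" if "cmod c < 2 * R" for c
    proof -
      have "dist x (fst x + c * fst v, snd x + c * snd v) = cmod c"
      proof -
        have "(fst x + c * fst v, snd x + c * snd v) - x = (c * fst v, c * snd v)"
          by (simp add: prod_eq_iff)
        then show ?thesis using nv[of c] by (metis dist_commute dist_norm)
      qed
      then have "dist p (fst x + c * fst v, snd x + c * snd v) \<le> R + 2 * R"
        using x that dist_triangle[of p _ x] by (smt (verit) mem_ball)
      then show ?thesis by (simp add: R_def)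
    qed
    have hol: "k holomorphic_on ball 0 (2 * R)"
      unfolding k_def using inU R0
      by (intro holomorphic_on_compose_holo2[OF f] holomorphic_intros) auto
    have "norm ((deriv ^^ 1) k 0) \<le> fact 1 * B / R ^ 1"
    proof (rule Cauchy_inequality)
      show "k holomorphic_on ball 0 R" using holomorphic_on_subset[OF hol, of "ball 0 R"] \<open>R > 0\<close> by (simp add: subset_ball)
      show "continuous_on (cball 0 R) k"
        using \<open>R > 0\<close>
        by (intro continuous_on_subset[OF holomorphic_on_imp_continuous_on[OF hol]]) auto
      show "norm (k c) \<le> B" if "norm (0 - c) = R" for c
        unfolding k_def using that \<open>R > 0\<close> by (intro B inU) simp
    qed fact
    moreover have "deriv k 0 = dderiv f v x"
    proof -
      have l: "((\<lambda>c. (fst x + c * fst v, snd x + c * snd v)) has_derivative (\<lambda>h. (h * fst v, h * snd v))) (at 0)"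
        by (auto intro!: derivative_eq_intros)
      have x': "x \<in> U" using x \<open>R0 > 0\<close> by (intro subsetD[OF R0]) (simp add: R_def)
      have "(k has_derivative (\<lambda>h. dderiv f (h * fst v, h * snd v) x)) (at 0)"
        unfolding k_def using has_derivative_compose[OF l, of f "\<lambda>v. dderiv f v x"]
          holo2_on_has_derivative[OF f x'] by simp
      then have "(k has_field_derivative dderiv f v x) (at 0)"
        using holo2_on_scale[OF f x', of _ "fst v" "snd v"]
        by (simp add: has_field_derivative_def mult_commute_abs)
      then show ?thesis by (rule DERIV_imp_deriv)
    qed
    ultimately show ?thesis by simp
  qed
  show ?thesis
  proof (rule lipschitz_nearI[OF \<open>R > 0\<close>])
    fix x assume x: "x \<in> ball p R"
    then have x': "x \<in> U" using \<open>R0 > 0\<close> by (intro subsetD[OF R0]) (simp add: R_def)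
    then show diff: "f differentiable at x"
      using f unfolding holo2_on_def by blast
    interpret bounded_linear "\<lambda>v. dderiv f v x"
      using has_derivative_bounded_linear[OF has_derivative_dderiv[OF diff]] .
    fix v
    show "norm (dderiv f v x) \<le> B / R * norm v"
    proof (cases "v = 0")
      case False
      have "dderiv f v x = norm v *\<^sub>R dderiv f ((1 / norm v) *\<^sub>R v) x"
        using False by (simp flip: scaleR)
      moreover have "norm ((1 / norm v) *\<^sub>R v) = 1" using False by simp
      then have "norm (dderiv f ((1 / norm v) *\<^sub>R v) x) \<le> B / R"
        by (rule unit[OF x])
      then have "norm v * norm (dderiv f ((1 / norm v) *\<^sub>R v) x) \<le> norm v * (B / R)"
        by (intro mult_left_mono) auto
      ultimately show ?thesis
        by (metis norm_scaleR abs_norm_cancel mult.commute)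
    qed (simp add: zero)
  qed
qed

text \<open>The finitely many partial derivatives are continuous, hence bounded on a common ball
  around \<open>p\<close>.\<close>

lemma smooth_on_lipschitz_near:
  fixes f :: "'a::euclidean_space \<Rightarrow> 'b::real_normed_vector"
  assumes sm: "smooth_on U f" and "open U" "p \<in> U"
  shows "lipschitz_near f p"
proof -
  have "\<forall>\<^sub>F x in nhds p. norm (dderiv f b x) \<le> norm (dderiv f b p) + 1" if b: "b \<in> Basis" for b
  proof -
    have "isCont (dderiv f b) p"
      using smooth_on_isCont[OF smooth_on_dderiv[OF sm b]] assms by blast
    then have "\<forall>\<^sub>F x in nhds p. dist (dderiv f b x) (dderiv f b p) < 1"
      by (auto simp: isCont_def tendsto_at_iff_tendsto_nhds intro: tendstoD)
    then show ?thesis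
    proof (rule eventually_mono)
      show "norm (dderiv f b x) \<le> norm (dderiv f b p) + 1" if "dist (dderiv f b x) (dderiv f b p) < 1" for x
        using that norm_triangle_sub[of "dderiv f b x" "dderiv f b p"] by (simp add: dist_norm)
    qed
  qed
  then have "\<forall>\<^sub>F x in nhds p. \<forall>b\<in>Basis. norm (dderiv f b x) \<le> norm (dderiv f b p) + 1"
    by (intro eventually_ball_finite) auto
  then have "\<forall>\<^sub>F x in nhds p. x \<in> U \<and> (\<forall>b\<in>Basis. norm (dderiv f b x) \<le> norm (dderiv f b p) + 1)"
    using eventually_nhds_in_open[OF assms(2,3)] by eventually_elim blast
  then obtain d where "d > 0" and d: "\<And>x. dist x p < d \<Longrightarrow> x \<in> U \<and> (\<forall>b\<in>Basis. norm (dderiv f b x) \<le> norm (dderiv f b p) + 1)"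
    unfolding eventually_nhds_metric by blast
  show ?thesis
  proof (rule lipschitz_nearI[OF \<open>d > 0\<close>])
    fix x assume x: "x \<in> ball p d"
    show diff: "f differentiable at x"
      using d[of x] x smooth_on_differentiable[OF sm \<open>open U\<close>] by (auto simp: dist_commute)
    interpret bounded_linear "\<lambda>v. dderiv f v x"
      using has_derivative_bounded_linear[OF has_derivative_dderiv[OF diff]] .
    fix v
    have "dderiv f v x = dderiv f (\<Sum>b\<in>Basis. (v \<bullet> b) *\<^sub>R b) x"
      by (simp add: euclidean_representation)
    also have "\<dots> = (\<Sum>b\<in>Basis. (v \<bullet> b) *\<^sub>R dderiv f b x)"
      by (simp only: sum scaleR)
    finally have "norm (dderiv f v x) \<le> (\<Sum>b\<in>Basis. norm ((v \<bullet> b) *\<^sub>R dderiv f b x))"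
      using norm_sum by metis
    also have "\<dots> \<le> (\<Sum>b\<in>Basis. norm v * (norm (dderiv f b p) + 1))"
    proof (rule sum_mono)
      fix b :: 'a assume b: "b \<in> Basis"
      have "\<bar>v \<bullet> b\<bar> * norm (dderiv f b x) \<le> norm v * (norm (dderiv f b p) + 1)"
        using d[of x] x b Basis_le_norm[OF b, of v] by (intro mult_mono) (auto simp: dist_commute)
      then show "norm ((v \<bullet> b) *\<^sub>R dderiv f b x) \<le> norm v * (norm (dderiv f b p) + 1)" by simp
    qed
    also have "\<dots> = (\<Sum>b\<in>Basis. norm (dderiv f b p) + 1) * norm v"
      by (simp only: sum_distrib_left mult.commute)
    finally show "norm (dderiv f v x) \<le> (\<Sum>b\<in>Basis. norm (dderiv f b p) + 1) * norm v" .
  qed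
qed

lemma lipschitz_nearD:
  assumes "lipschitz_near f p"
  obtains L d where "L > 0" "d > 0"
    "\<And>x y. dist p x < d \<Longrightarrow> dist p y < d \<Longrightarrow> norm (f x - f y) \<le> L * norm (x - y)"
proof -
  obtain L d where "L > 0" "d > 0" "\<forall>x\<in>ball p d. \<forall>y\<in>ball p d. norm (f x - f y) \<le> L * norm (x - y)"
    using assms unfolding lipschitz_near_def by blast
  then show ?thesis using that[of L d] by simp
qed

lemma lipschitz_near_bounded_linear:
  assumes "lipschitz_near f p" "bounded_linear A"
  shows "lipschitz_near (\<lambda>x. A (f x)) p"
proof -
  obtain L d where L: "L > 0" "d > 0"
    "\<And>x y. dist p x < d \<Longrightarrow> dist p y < d \<Longrightarrow> norm (f x - f y) \<le> L * norm (x - y)"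
    using lipschitz_nearD[OF assms(1)] by blast
  obtain K where K: "K > 0" "\<And>x. norm (A x) \<le> norm x * K"
    using bounded_linear.pos_bounded[OF assms(2)] by blast
  have "norm (A (f x) - A (f y)) \<le> (L * K) * norm (x - y)" if "x \<in> ball p d" "y \<in> ball p d" for x y
  proof -
    have "norm (A (f x - f y)) \<le> norm (f x - f y) * K" by (rule K)
    also have "\<dots> \<le> L * norm (x - y) * K" using L(3) that K(1) by (intro mult_right_mono) auto
    finally show ?thesis
      using linear_diff[OF bounded_linear.linear[OF assms(2)]] by (simp add: mult_ac)
  qed
  then show ?thesis unfolding lipschitz_near_def using L K by (meson mult_pos_pos)
qed

lemma lipschitz_near_add:
  assumes "lipschitz_near f p" "lipschitz_near g p"
  shows "lipschitz_near (\<lambda>x. f x + g x) p"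
proof -
  obtain L d where L: "L > 0" "d > 0"
    "\<And>x y. dist p x < d \<Longrightarrow> dist p y < d \<Longrightarrow> norm (f x - f y) \<le> L * norm (x - y)"
    using lipschitz_nearD[OF assms(1)] by blast
  obtain K e where K: "K > 0" "e > 0"
    "\<And>x y. dist p x < e \<Longrightarrow> dist p y < e \<Longrightarrow> norm (g x - g y) \<le> K * norm (x - y)"
    using lipschitz_nearD[OF assms(2)] by blast
  have "norm ((f x + g x) - (f y + g y)) \<le> (L + K) * norm (x - y)"
    if "x \<in> ball p (min d e)" "y \<in> ball p (min d e)" for x y
  proof -
    have "norm ((f x + g x) - (f y + g y)) \<le> norm (f x - f y) + norm (g x - g y)"
      by (rule norm_diff_triangle_ineq)
    also have "\<dots> \<le> (L + K) * norm (x - y)"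
      using L(3)[of x y] K(3)[of x y] that by (simp add: distrib_right)
    finally show ?thesis .
  qed
  then show ?thesis
    unfolding lipschitz_near_def using L K by (intro exI[of _ "L + K"] conjI exI[of _ "min d e"]) auto
qed

lemma lipschitz_near_compose:
  assumes "lipschitz_near f p" "lipschitz_near g (f p)"
  shows "lipschitz_near (\<lambda>x. g (f x)) p"
proof -
  obtain L d where L: "L > 0" "d > 0"
    "\<And>x y. dist p x < d \<Longrightarrow> dist p y < d \<Longrightarrow> norm (f x - f y) \<le> L * norm (x - y)"
    using lipschitz_nearD[OF assms(1)] by blast
  obtain K e where K: "K > 0" "e > 0"
    "\<And>x y. dist (f p) x < e \<Longrightarrow> dist (f p) y < e \<Longrightarrow> norm (g x - g y) \<le> K * norm (x - y)"
    using lipschitz_nearD[OF assms(2)] by blast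
  define d' where "d' = min d (e / L)"
  have "d' > 0" using L K by (simp add: d'_def)
  have near: "dist (f p) (f x) < e" if "x \<in> ball p d'" for x
  proof -
    have "dist (f p) (f x) \<le> L * dist p x"
      using L(3)[of p x] that L(2) by (simp add: dist_norm d'_def)
    also have "\<dots> < e" using that L(1) by (simp add: d'_def field_simps)
    finally show ?thesis .
  qed
  have "norm (g (f x) - g (f y)) \<le> (K * L) * norm (x - y)" if "x \<in> ball p d'" "y \<in> ball p d'" for x y
  proof -
    have "norm (g (f x) - g (f y)) \<le> K * norm (f x - f y)"
      using K(3) near that by blast
    also have "\<dots> \<le> K * (L * norm (x - y))"
      using L(3)[of x y] that K(1) by (intro mult_left_mono) (auto simp: d'_def)
    finally show ?thesis by (simp add: mult.assoc)
  qed
  then show ?thesis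
    unfolding lipschitz_near_def using L K \<open>d' > 0\<close> by (meson mult_pos_pos)
qed

lemma lipschitz_near_Pair:
  fixes f :: "'a::real_normed_vector \<Rightarrow> 'b::real_normed_vector \<times> 'c::real_normed_vector"
  assumes "lipschitz_near (\<lambda>x. fst (f x)) p" "lipschitz_near (\<lambda>x. snd (f x)) p"
  shows "lipschitz_near f p"
proof -
  have "bounded_linear (\<lambda>x::'b. (x, 0::'c))" "bounded_linear (\<lambda>x::'c. (0::'b, x))"
    by (intro bounded_linear_Pair bounded_linear_ident bounded_linear_zero)+
  from lipschitz_near_add[OF lipschitz_near_bounded_linear[OF assms(1) this(1)]
      lipschitz_near_bounded_linear[OF assms(2) this(2)]]
  show ?thesis by simp
qed

lemma lipschitz_near_isCont: "lipschitz_near f p \<Longrightarrow> isCont f p"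
proof -
  assume "lipschitz_near f p"
  then obtain L d where L: "L > 0" "d > 0"
    "\<And>x y. dist p x < d \<Longrightarrow> dist p y < d \<Longrightarrow> norm (f x - f y) \<le> L * norm (x - y)"
    using lipschitz_nearD by blast
  show "isCont f p"
    unfolding continuous_at_eps_delta
  proof (intro allI impI)
    fix e :: real assume "e > 0"
    have "dist (f x) (f p) < e" if "dist x p < min d (e / L)" for x
    proof -
      have "dist (f x) (f p) \<le> L * dist x p"
        using L(3)[of x p] that L(2) by (simp add: dist_norm dist_commute norm_minus_commute)
      also have "\<dots> < e" using that L(1) by (simp add: field_simps)
      finally show ?thesis .
    qed
    then show "\<exists>d>0. \<forall>x. dist x p < d \<longrightarrow> dist (f x) (f p) < e"
      using L \<open>e > 0\<close> by (intro exI[of _ "min d (e / L)"]) auto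
  qed
qed

section \<open>Defining functions in good coordinates\<close>

text \<open>A one-dimensional implicit function theorem with an explicit distance: slope at least
  \<kappa> brings \<open>g\<close> to zero within \<open>\<bar>g 0\<bar> / \<kappa>\<close>, and the
  smallness assumption keeps that interval inside the range of the derivative bounds.\<close>

lemma zero_of_steep_function:
  fixes g :: "real \<Rightarrow> real"
  assumes "\<kappa> > 0" and small: "\<bar>g 0\<bar> \<le> \<kappa> * \<eta>"
    and deriv: "\<And>\<tau>. \<bar>\<tau>\<bar> \<le> \<eta> \<Longrightarrow> DERIV g \<tau> :> g' \<tau>" "\<And>\<tau>. \<bar>\<tau>\<bar> \<le> \<eta> \<Longrightarrow> g' \<tau> \<ge> \<kappa>"
  obtains \<tau> where "\<bar>\<tau>\<bar> \<le> \<bar>g 0\<bar> / \<kappa>" "g \<tau> = 0"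
proof -
  define T where "T = \<bar>g 0\<bar> / \<kappa>"
  have T: "0 \<le> T" "T \<le> \<eta>" "\<kappa> * T = \<bar>g 0\<bar>"
    using assms(1,2) by (auto simp: T_def field_simps)
  have slope: "g b - g a \<ge> \<kappa> * (b - a)" if ab: "a \<le> b" "-T \<le> a" "b \<le> T" for a b
  proof (cases "a = b")
    case False
    then have "a < b" using ab by simp
    have "DERIV g x :> g' x" if "a \<le> x" "x \<le> b" for x
      using that ab T by (intro deriv) auto
    from MVT2[OF \<open>a < b\<close> this] obtain z where z: "a < z" "z < b" "g b - g a = (b - a) * g' z" by blast
    moreover have "(b - a) * g' z \<ge> (b - a) * \<kappa>"
      using z ab T deriv(2)[of z] by (intro mult_left_mono) auto
    ultimately show ?thesis by (simp add: mult.commute)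
  qed simp
  have cont: "isCont g x" if "-T \<le> x" "x \<le> T" for x
    using that T by (intro DERIV_isCont[OF deriv(1)]) auto
  have "g T \<ge> 0" "g (-T) \<le> 0"
    using slope[of 0 T] slope[of "-T" 0] T by auto
  then obtain \<tau> where "-T \<le> \<tau>" "\<tau> \<le> T" "g \<tau> = 0"
    using IVT[of g "-T" 0 T] cont T(1) by auto
  then show ?thesis using that[of \<tau>] by (auto simp: T_def)
qed

text \<open>The defining function that belongs to the coordinate, pulled back to the ambient space
  so that it can be compared with \<open>ldf\<close> point by point.\<close>

definition rho :: "(complex \<times> complex \<Rightarrow> complex \<times> complex) \<Rightarrow> (complex \<Rightarrow> real) \<Rightarrow> complex \<times> complex \<Rightarrow> real" where
  "rho \<Phi> F q = 2 * Re (snd (\<Phi> q)) + F (fst (\<Phi> q))"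

lemma good_coordinateE:
  assumes "good_coordinate M p \<Phi> F"
  obtains U \<Psi> W where "open U" "p \<in> U" "holo_map2_on U \<Phi>" "inj_on \<Phi> U" "open (\<Phi> ` U)"
    "holo_map2_on (\<Phi> ` U) \<Psi>" "\<And>x. x \<in> U \<Longrightarrow> \<Psi> (\<Phi> x) = x" "\<Phi> p = 0"
    "open W" "\<And>q. q \<in> U \<Longrightarrow> fst (\<Phi> q) \<in> W" "smooth_on W F" "F 0 = 0" "\<And>v. dderiv F v 0 = 0"
    "\<And>q. q \<in> U \<Longrightarrow> q \<in> M \<longleftrightarrow> rho \<Phi> F q = 0"
proof -
  obtain U where U: "p \<in> U" "holo_chart U \<Phi>" "\<Phi> p = 0"
    "\<exists>W. open W \<and> (\<lambda>q. fst (\<Phi> q)) ` U \<subseteq> W \<and> smooth_on W F"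
    "F 0 = 0" "\<forall>v. dderiv F v 0 = 0" "M \<inter> U = {q\<in>U. 2 * Re (snd (\<Phi> q)) + F (fst (\<Phi> q)) = 0}"
    using assms unfolding good_coordinate_def by blast
  obtain W where W: "open W" "(\<lambda>q. fst (\<Phi> q)) ` U \<subseteq> W" "smooth_on W F"
    using U(4) by blast
  obtain \<Psi> where \<Psi>: "open U" "holo_map2_on U \<Phi>" "inj_on \<Phi> U" "open (\<Phi> ` U)"
    "holo_map2_on (\<Phi> ` U) \<Psi>" "\<forall>x\<in>U. \<Psi> (\<Phi> x) = x"
    using U(2) unfolding holo_chart_def by blast
  show ?thesis
  proof (rule that[of U \<Psi> W])
    show "q \<in> M \<longleftrightarrow> rho \<Phi> F q = 0" if "q \<in> U" for q
      using U(7) that unfolding rho_def by blast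
    show "fst (\<Phi> q) \<in> W" if "q \<in> U" for q
      using W(2) that by blast
  qed (use U W \<Psi> in auto)
qed

lemma holo_map2_lipschitz_near:
  "holo_map2_on U \<Phi> \<Longrightarrow> open U \<Longrightarrow> p \<in> U \<Longrightarrow> lipschitz_near \<Phi> p"
  unfolding holo_map2_on_def by (intro lipschitz_near_Pair holo2_on_lipschitz_near) auto

lemma rho_lipschitz_near:
  assumes "good_coordinate M p \<Phi> F"
  shows "lipschitz_near (rho \<Phi> F) p"
proof -
  obtain U \<Psi> W where g: "open U" "p \<in> U" "holo_map2_on U \<Phi>" "\<Phi> p = 0"
    "open W" "\<And>q. q \<in> U \<Longrightarrow> fst (\<Phi> q) \<in> W" "smooth_on W F"
    using good_coordinateE[OF assms] by metis
  have \<Phi>: "lipschitz_near \<Phi> p"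
    using holo_map2_lipschitz_near g by blast
  have "bounded_linear (\<lambda>q :: complex \<times> complex. 2 * Re (snd q))"
    by (intro bounded_linear_const_mult bounded_linear_compose[OF bounded_linear_Re bounded_linear_snd])
  then have 1: "lipschitz_near (\<lambda>q. 2 * Re (snd (\<Phi> q))) p"
    by (rule lipschitz_near_bounded_linear[OF \<Phi>])
  have "lipschitz_near F (fst (\<Phi> p))"
    using smooth_on_lipschitz_near g by metis
  then have "lipschitz_near (\<lambda>q. F (fst (\<Phi> q))) p"
    by (rule lipschitz_near_compose[OF lipschitz_near_bounded_linear[OF \<Phi> bounded_linear_fst]])
  from lipschitz_near_add[OF 1 this] show ?thesis
    unfolding rho_def[abs_def] .
qed

lemma isCont_eventually_dist:
  "isCont f p \<Longrightarrow> f p = c \<Longrightarrow> e > 0 \<Longrightarrow> \<forall>\<^sub>F x in nhds p. dist c (f x) < e"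
  using tendstoD[of f c "nhds p" e] by (auto simp: isCont_def tendsto_at_iff_tendsto_nhds dist_commute)

text \<open>A defining function is comparable to the distance to \<open>M\<close>: moving \<open>w\<close> by \<open>rho/2\<close>
  (respectively along a coordinate direction transverse to \<open>M\<close>) leads to a point of \<open>M\<close>.\<close>

lemma ldf_le_rho:
  assumes ldf: "local_defining_function M p r" and good: "good_coordinate M p \<Phi> F"
  obtains K where "\<forall>\<^sub>F q in nhds p. \<bar>r q\<bar> \<le> K * \<bar>rho \<Phi> F q\<bar>"
proof -
  obtain V where V: "open V" "p \<in> V" "smooth_on V r" "\<And>x. x \<in> V \<Longrightarrow> x \<in> M \<longleftrightarrow> r x = 0"
    using ldf unfolding local_defining_function_def by blast
  obtain U \<Psi> W where g: "open U" "p \<in> U" "holo_map2_on U \<Phi>" "open (\<Phi> ` U)"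
    "holo_map2_on (\<Phi> ` U) \<Psi>" "\<And>x. x \<in> U \<Longrightarrow> \<Psi> (\<Phi> x) = x" "\<Phi> p = 0"
    "\<And>q. q \<in> U \<Longrightarrow> q \<in> M \<longleftrightarrow> rho \<Phi> F q = 0"
    using good_coordinateE[OF good] by metis
  have "0 \<in> \<Phi> ` U" "\<Psi> 0 = p" using g(2,6,7) by (metis imageI)+
  obtain \<delta>0 where \<delta>0: "\<delta>0 > 0" "ball 0 \<delta>0 \<subseteq> \<Phi> ` U"
    using \<open>0 \<in> \<Phi> ` U\<close> g(4) openE by blast
  have \<Psi>: "lipschitz_near \<Psi> 0"
    using holo_map2_lipschitz_near g(4,5) \<open>0 \<in> \<Phi> ` U\<close> by blast
  obtain L \<delta>1 where L: "L > 0" "\<delta>1 > 0"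
    "\<And>x y. dist 0 x < \<delta>1 \<Longrightarrow> dist 0 y < \<delta>1 \<Longrightarrow> norm (\<Psi> x - \<Psi> y) \<le> L * norm (x - y)"
    using lipschitz_nearD[OF \<Psi>] by blast
  obtain K d where K: "K > 0" "d > 0"
    "\<And>x y. dist p x < d \<Longrightarrow> dist p y < d \<Longrightarrow> norm (r x - r y) \<le> K * norm (x - y)"
    using lipschitz_nearD[OF smooth_on_lipschitz_near[OF V(3,1,2)]] by blast
  obtain d' where d': "d' > 0" "ball p d' \<subseteq> V" using V openE by blast
  define \<delta> where "\<delta> = min \<delta>0 \<delta>1"
  \<comment> \<open>The first component, hence \<open>F\<close>, is unchanged, while
    \<open>2 * Re\<close> of the second drops by exactly \<open>rho \<Phi> F q\<close>; for
    \<open>q\<close> near \<open>p\<close> the point \<open>\<Psi> (m q)\<close> therefore lies on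
    \<open>M\<close>.\<close>
  define m where "m q = (fst (\<Phi> q), snd (\<Phi> q) - complex_of_real (rho \<Phi> F q / 2))" for q
  have "isCont \<Phi> p" "isCont (rho \<Phi> F) p"
    using holo_map2_lipschitz_near g rho_lipschitz_near[OF good] lipschitz_near_isCont by blast+
  then have "isCont m p"
    unfolding m_def by (intro continuous_intros) auto
  have "m p = 0" using g(7) g(8)[OF g(2)] good unfolding m_def good_coordinate_def
    by (auto simp: rho_def zero_prod_def)
  have "isCont (\<lambda>q. \<Psi> (m q)) p"
    using isCont_o2[OF \<open>isCont m p\<close>, of \<Psi>] lipschitz_near_isCont[OF \<Psi>] \<open>m p = 0\<close> by simp
  have "\<delta> > 0" using L \<delta>0 by (simp add: \<delta>_def)
  have "\<forall>\<^sub>F q in nhds p. dist 0 (m q) < \<delta>" "\<forall>\<^sub>F q in nhds p. dist 0 (\<Phi> q) < \<delta>"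
    by (rule isCont_eventually_dist; fact)+
  moreover have "\<forall>\<^sub>F q in nhds p. dist p (\<Psi> (m q)) < min d d'" "\<forall>\<^sub>F q in nhds p. dist p q < d"
    by (rule isCont_eventually_dist; simp add: \<open>isCont (\<lambda>q. \<Psi> (m q)) p\<close> \<open>m p = 0\<close> \<open>\<Psi> 0 = p\<close> \<open>d > 0\<close> \<open>d' > 0\<close>)+
  moreover note eventually_nhds_in_open[OF g(1,2)]
  ultimately have "\<forall>\<^sub>F q in nhds p. \<bar>r q\<bar> \<le> (K * L) * \<bar>rho \<Phi> F q\<bar>"
  proof eventually_elim
    case (elim q)
    define q' where "q' = \<Psi> (m q)"
    have "m q \<in> \<Phi> ` U" using elim(1) \<delta>0 by (auto simp: \<delta>_def)
    then have q': "q' \<in> U" "\<Phi> q' = m q" unfolding q'_def using g(6) by auto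
    have "rho \<Phi> F q' = 0" unfolding rho_def[of _ _ q'] q'(2) by (simp add: m_def rho_def field_simps)
    moreover have "q' \<in> V" using elim(3) d'(2) unfolding q'_def by auto
    ultimately have "r q' = 0" using g(8) V(4) q' by blast
    then have "\<bar>r q\<bar> \<le> K * norm (q - q')"
      using K(3)[of q q'] elim by (simp add: q'_def)
    also have "q - q' = \<Psi> (\<Phi> q) - \<Psi> (m q)" using g(6) elim by (simp add: q'_def)
    also have "K * norm \<dots> \<le> K * (L * norm (\<Phi> q - m q))"
      using L(3)[of "\<Phi> q" "m q"] elim K by (intro mult_left_mono) (auto simp: \<delta>_def)
    also have "norm (\<Phi> q - m q) = \<bar>rho \<Phi> F q\<bar> / 2"
    proof -
      have "\<Phi> q - m q = (0, complex_of_real (rho \<Phi> F q / 2))"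
        by (simp add: m_def prod_eq_iff)
      then show ?thesis by (simp add: norm_Pair1 norm_Pair2 norm_divide)
    qed
    finally show ?case using K L by (simp add: field_simps)
  qed
  then show ?thesis using that by blast
qed

text \<open>The nonzero derivative of \<open>r\<close> at \<open>p\<close> excludes degenerate
  functions such as the square of a defining function. It yields a basis direction in which
  \<open>r\<close> has slope at least \<kappa> near \<open>p\<close>; a zero of \<open>r\<close>
  reached in this direction is a zero of \<open>rho\<close>, and \<open>rho\<close> is
  Lipschitz.\<close>

lemma rho_le_ldf:
  assumes ldf: "local_defining_function M p r" and good: "good_coordinate M p \<Phi> F"
  obtains K where "\<forall>\<^sub>F q in nhds p. \<bar>rho \<Phi> F q\<bar> \<le> K * \<bar>r q\<bar>"
proof -
  obtain V where V: "open V" "p \<in> V" "smooth_on V r" "\<And>x. x \<in> V \<Longrightarrow> x \<in> M \<longleftrightarrow> r x = 0"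
    "frechet_derivative r (at p) \<noteq> (\<lambda>_. 0)"
    using ldf unfolding local_defining_function_def by blast
  obtain U \<Psi> W where g: "open U" "p \<in> U" "\<And>q. q \<in> U \<Longrightarrow> q \<in> M \<longleftrightarrow> rho \<Phi> F q = 0"
    using good_coordinateE[OF good] by metis
  obtain L d1 where L: "L > 0" "d1 > 0"
    "\<And>x y. dist p x < d1 \<Longrightarrow> dist p y < d1 \<Longrightarrow> norm (rho \<Phi> F x - rho \<Phi> F y) \<le> L * norm (x - y)"
    using lipschitz_nearD[OF rho_lipschitz_near[OF good]] by blast
  have rdiff: "r differentiable at x" if "x \<in> V" for x
    using smooth_on_differentiable[OF V(3,1) that] .
  interpret bounded_linear "\<lambda>v. dderiv r v p"
    using has_derivative_bounded_linear[OF has_derivative_dderiv[OF rdiff[OF V(2)]]] .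
  obtain b where b: "b \<in> Basis" "dderiv r b p \<noteq> 0"
  proof -
    obtain v where v: "dderiv r v p \<noteq> 0" using V(5) unfolding dderiv_def by (metis ext)
    have "dderiv r v p = (\<Sum>b\<in>Basis. (v \<bullet> b) *\<^sub>R dderiv r b p)"
      by (subst euclidean_representation[of v, symmetric]) (simp only: sum scaleR)
    then have "\<not> (\<forall>b\<in>Basis. dderiv r b p = 0)"
      using v by (metis (no_types, lifting) scaleR_zero_right sum.neutral)
    then show ?thesis using that by blast
  qed
  \<comment> \<open>The sign turns the direction so that \<open>r\<close> increases along it; half
    of the slope at \<open>p\<close> persists nearby by continuity.\<close>
  define \<sigma> where "\<sigma> = sgn (dderiv r b p)"
  define \<kappa> where "\<kappa> = \<bar>dderiv r b p\<bar> / 2"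
  have "\<kappa> > 0" "\<bar>\<sigma>\<bar> = 1" using b by (auto simp: \<kappa>_def \<sigma>_def abs_sgn_eq)
  have "isCont (dderiv r b) p"
    using smooth_on_isCont[OF smooth_on_dderiv[OF V(3) b(1)]] V by blast
  from isCont_eventually_dist[OF this refl \<open>\<kappa> > 0\<close>]
  have "\<forall>\<^sub>F x in nhds p. x \<in> V \<and> x \<in> U \<and> \<sigma> * dderiv r b x \<ge> \<kappa>"
    using eventually_nhds_in_open[OF V(1,2)] eventually_nhds_in_open[OF g(1,2)]
  proof eventually_elim
    case (elim x)
    have "\<sigma> * dderiv r b p = 2 * \<kappa>" unfolding \<sigma>_def \<kappa>_def by (simp add: mult_sgn_abs abs_sgn)
    moreover have "\<sigma> * dderiv r b p - \<sigma> * dderiv r b x < \<kappa>"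
    proof -
      have "\<sigma> * dderiv r b p - \<sigma> * dderiv r b x \<le> \<bar>\<sigma> * (dderiv r b p - dderiv r b x)\<bar>"
        by (simp add: algebra_simps)
      then show ?thesis using elim(1) \<open>\<bar>\<sigma>\<bar> = 1\<close> by (simp add: abs_mult dist_real_def)
    qed
    ultimately show ?case using elim by simp
  qed
  then obtain d2 where d2: "d2 > 0"
    "\<And>x. dist x p < d2 \<Longrightarrow> x \<in> V \<and> x \<in> U \<and> \<sigma> * dderiv r b x \<ge> \<kappa>"
    unfolding eventually_nhds_metric by blast
  \<comment> \<open>The distance from \<open>p\<close> to \<open>q\<close> and the displacement from
    \<open>q\<close>, each at most \<eta>, add up and must stay below
    \<open>min d1 d2\<close>.\<close>
  define \<eta> where "\<eta> = min d1 d2 / 4"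
  have "\<eta> > 0" using L d2 by (simp add: \<eta>_def)
  have "isCont r p" using smooth_on_isCont[OF V(3,1,2)] .
  moreover have "r p = 0"
  proof -
    have "rho \<Phi> F p = 0" using good unfolding good_coordinate_def rho_def by auto
    then show ?thesis using V g by blast
  qed
  ultimately have "\<forall>\<^sub>F q in nhds p. dist 0 (r q) < \<kappa> * \<eta>" "\<forall>\<^sub>F q in nhds p. dist p q < \<eta>"
    using isCont_eventually_dist[of p r 0 "\<kappa> * \<eta>"] isCont_eventually_dist[OF continuous_ident, of p p \<eta>]
      \<open>\<kappa> > 0\<close> \<open>\<eta> > 0\<close> by (simp_all only: mult_pos_pos)
  then have "\<forall>\<^sub>F q in nhds p. \<bar>rho \<Phi> F q\<bar> \<le> (L / \<kappa>) * \<bar>r q\<bar>"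
  proof eventually_elim
    case (elim q)
    define x where "x \<tau> = q + \<tau> *\<^sub>R (\<sigma> *\<^sub>R b)" for \<tau>
    have nb: "norm (\<tau> *\<^sub>R (\<sigma> *\<^sub>R b)) = \<bar>\<tau>\<bar>" for \<tau>
      using b(1) \<open>\<bar>\<sigma>\<bar> = 1\<close> by (simp add: abs_mult)
    have near: "dist p (x \<tau>) < min d1 d2" if "\<bar>\<tau>\<bar> \<le> \<eta>" for \<tau>
    proof -
      have "dist p (x \<tau>) \<le> dist p q + dist q (x \<tau>)" by (rule dist_triangle)
      also have "dist q (x \<tau>) = \<bar>\<tau>\<bar>" using nb by (simp add: x_def dist_norm)
      finally show ?thesis using that elim \<open>\<eta> > 0\<close> unfolding \<eta>_def by simp
    qed
    have x2: "x \<tau> \<in> V" "x \<tau> \<in> U" "\<sigma> * dderiv r b (x \<tau>) \<ge> \<kappa>" if "\<bar>\<tau>\<bar> \<le> \<eta>" for \<tau>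
      using d2(2)[of "x \<tau>"] near[OF that] by (auto simp: dist_commute)
    have "DERIV (\<lambda>\<tau>. r (x \<tau>)) \<tau> :> \<sigma> * dderiv r b (x \<tau>)" if "\<bar>\<tau>\<bar> \<le> \<eta>" for \<tau>
    proof -
      have d: "r differentiable at (x \<tau>)" using rdiff x2 that by blast
      then interpret r': bounded_linear "\<lambda>v. dderiv r v (x \<tau>)"
        by (intro has_derivative_bounded_linear[OF has_derivative_dderiv])
      show ?thesis
        using has_vector_derivative_line[of r q \<tau> "\<sigma> *\<^sub>R b" UNIV] d r'.scaleR[of \<sigma> b]
        by (simp add: x_def has_real_derivative_iff_has_vector_derivative)
    qed
    moreover have "\<bar>r (x 0)\<bar> \<le> \<kappa> * \<eta>" using elim by (simp add: x_def)
    ultimately obtain \<tau> where \<tau>: "\<bar>\<tau>\<bar> \<le> \<bar>r (x 0)\<bar> / \<kappa>" "r (x \<tau>) = 0"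
      using zero_of_steep_function[OF \<open>\<kappa> > 0\<close>, of "\<lambda>\<tau>. r (x \<tau>)" \<eta> "\<lambda>\<tau>. \<sigma> * dderiv r b (x \<tau>)"] x2(3)
      by blast
    have "\<bar>\<tau>\<bar> \<le> \<eta>"
    proof -
      have "\<bar>r (x 0)\<bar> / \<kappa> \<le> \<eta>"
        using \<open>\<bar>r (x 0)\<bar> \<le> \<kappa> * \<eta>\<close> \<open>\<kappa> > 0\<close> by (simp add: pos_divide_le_eq mult.commute)
      then show ?thesis using \<tau>(1) by linarith
    qed
    then have "rho \<Phi> F (x \<tau>) = 0"
      using x2 \<tau>(2) V(4) g(3) by blast
    then have "\<bar>rho \<Phi> F q\<bar> \<le> L * norm (q - x \<tau>)"
      using L(3)[of q "x \<tau>"] near[OF \<open>\<bar>\<tau>\<bar> \<le> \<eta>\<close>] near[of 0] \<open>\<eta> > 0\<close> by (simp add: x_def)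
    also have "norm (q - x \<tau>) = \<bar>\<tau>\<bar>" using nb by (simp add: x_def)
    also have "L * \<bar>\<tau>\<bar> \<le> L * (\<bar>r (x 0)\<bar> / \<kappa>)" using \<tau>(1) L(1) by (intro mult_left_mono) auto
    finally show ?case by (simp add: x_def)
  qed
  then show ?thesis using that by blast
qed

text \<open>\<open>2 * Re (w - g z) + (F z + 2 * Re (g z))\<close> equals
  \<open>2 * Re w + F z\<close>, so the new pair describes the same set. The two conditions on
  \<open>g\<close> at \<open>0\<close> preserve the normalisation of \<open>F\<close> to first
  order.\<close>

lemma good_coordinate_shear:
  assumes good: "good_coordinate M p \<Phi> F" and "R > 0" and g: "g holomorphic_on ball 0 R"
    and g0: "g 0 = 0" "deriv g 0 = 0"
  shows "good_coordinate M p (\<lambda>q. (fst (\<Phi> q), snd (\<Phi> q) - g (fst (\<Phi> q)))) (\<lambda>z. F z + 2 * Re (g z))"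
proof -
  obtain U \<Psi> W where c: "open U" "p \<in> U" "holo_map2_on U \<Phi>" "inj_on \<Phi> U" "open (\<Phi> ` U)"
    "holo_map2_on (\<Phi> ` U) \<Psi>" "\<And>x. x \<in> U \<Longrightarrow> \<Psi> (\<Phi> x) = x" "\<Phi> p = 0"
    "open W" "\<And>q. q \<in> U \<Longrightarrow> fst (\<Phi> q) \<in> W" "smooth_on W F" "F 0 = 0" "\<And>v. dderiv F v 0 = 0"
    "\<And>q. q \<in> U \<Longrightarrow> q \<in> M \<longleftrightarrow> rho \<Phi> F q = 0"
    using good_coordinateE[OF good] by blast
  define \<Phi>' where "\<Phi>' q = (fst (\<Phi> q), snd (\<Phi> q) - g (fst (\<Phi> q)))" for q
  define \<Psi>' where "\<Psi>' y = \<Psi> (fst y, snd y + g (fst y))" for y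
  define U' where "U' = {q \<in> U. fst (\<Phi> q) \<in> ball 0 R}"
  define s where "s y = (fst y, snd y + g (fst y))" for y
  define D where "D = (ball 0 R :: complex set) \<times> (UNIV :: complex set)"
  have holo: "holo2_on U (\<lambda>q. fst (\<Phi> q))" "holo2_on U (\<lambda>q. snd (\<Phi> q))"
    "holo2_on (\<Phi> ` U) (\<lambda>q. fst (\<Psi> q))" "holo2_on (\<Phi> ` U) (\<lambda>q. snd (\<Psi> q))"
    using c(3,6) unfolding holo_map2_on_def by auto
  have cont1: "continuous_on U (\<lambda>q. fst (\<Phi> q))"
    using holo2_on_isCont[OF holo(1)] continuous_at_imp_continuous_on by blast
  have openU': "open U'"
    unfolding U'_def using continuous_open_preimage[OF cont1 c(1) open_ball, of 0 R]
    by (simp add: vimage_def Int_def)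
  have openD: "open D"
    unfolding D_def by (intro open_Times) auto
  have conts: "continuous_on D s"
    unfolding s_def D_def
    by (intro continuous_intros continuous_on_compose2[OF holomorphic_on_imp_continuous_on[OF g]]) auto
  \<comment> \<open>Writing the image as a preimage under the inverse shear \<open>s\<close> gives
    its openness from continuity of \<open>s\<close>.\<close>
  have image: "\<Phi>' ` U' = D \<inter> s -` (\<Phi> ` U)"
  proof (intro equalityI subsetI)
    fix y assume "y \<in> \<Phi>' ` U'"
    then obtain q where "q \<in> U'" "y = \<Phi>' q" by blast
    then show "y \<in> D \<inter> s -` (\<Phi> ` U)" by (auto simp: \<Phi>'_def U'_def D_def s_def)
  next
    fix y assume y: "y \<in> D \<inter> s -` (\<Phi> ` U)"
    then obtain q where q: "q \<in> U" "\<Phi> q = s y" by auto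
    then have "fst (\<Phi> q) = fst y" "snd (\<Phi> q) = snd y + g (fst y)" by (auto simp: s_def)
    then have "q \<in> U'" "y = \<Phi>' q"
      using q(1) y by (auto simp: U'_def D_def \<Phi>'_def prod_eq_iff)
    then show "y \<in> \<Phi>' ` U'" by blast
  qed
  have s\<Phi>': "s (\<Phi>' q) = \<Phi> q" for q by (simp add: s_def \<Phi>'_def)
  have left_inv: "\<Psi>' (\<Phi>' q) = q" if "q \<in> U'" for q
    using that c(7) s\<Phi>'[of q] by (simp add: \<Psi>'_def s_def U'_def)
  have "holo_map2_on U' \<Phi>'"
  proof -
    have "holo2_on U' (\<lambda>q. fst (\<Phi> q))" "holo2_on U' (\<lambda>q. snd (\<Phi> q))"
      using holo holo2_on_subset[of U _ U'] by (auto simp: U'_def)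
    moreover have "holo2_on U' (\<lambda>q. - g (fst (\<Phi> q)))"
      using calculation(1) g
      by (intro holo2_on_compose_holomorphic[of "\<lambda>z. - g z" "ball 0 R"]) (auto intro: holomorphic_intros simp: U'_def)
    ultimately show ?thesis
      unfolding holo_map2_on_def \<Phi>'_def using holo2_on_add[of U' "\<lambda>q. snd (\<Phi> q)" "\<lambda>q. - g (fst (\<Phi> q))"] by simp
  qed
  moreover have "holo_map2_on (\<Phi>' ` U') \<Psi>'"
  proof -
    have "holo2_on (\<Phi>' ` U') (\<lambda>y. g (fst y))"
      using g by (intro holo2_on_compose_holomorphic[of g "ball 0 R"] holo2_on_fst) (auto simp: image D_def)
    then have "holo2_on (\<Phi>' ` U') (\<lambda>y. snd y + g (fst y))"
      by (rule holo2_on_add[OF holo2_on_snd])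
    then show ?thesis
      unfolding holo_map2_on_def \<Psi>'_def
      by (intro conjI holo2_on_compose[OF holo(3)] holo2_on_compose[OF holo(4)] holo2_on_fst)
        (auto simp: image s_def)
  qed
  moreover have "open (\<Phi>' ` U')"
    unfolding image using continuous_open_preimage[OF conts openD c(5)] .
  moreover have "inj_on \<Phi>' U'" using left_inv by (rule inj_on_inverseI)
  ultimately have chart: "holo_chart U' \<Phi>'"
    unfolding holo_chart_def using openU' left_inv by blast
  let ?F = "\<lambda>z. F z + 2 * Re (g z)"
  have "smooth_on (ball 0 R) (\<lambda>z. 2 * Re (g z))"
    by (intro smooth_on_linear[OF open_ball _ smooth_on_holomorphic[OF open_ball g]]
        bounded_linear_const_mult bounded_linear_Re)
  then have smooth: "smooth_on (W \<inter> ball 0 R) ?F"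
    using c(9,11) by (intro smooth_on_add open_Int open_ball) (auto elim: smooth_on_subset[rotated])
  have dF: "dderiv ?F v 0 = 0" for v
  proof -
    have "0 \<in> W" using c(2,8,10) by (metis fst_zero)
    then have 1: "(F has_derivative (\<lambda>v. dderiv F v 0)) (at 0)"
      using c(9,11) by (intro has_derivative_dderiv smooth_on_differentiable[of W])
    have "(g has_derivative (\<lambda>v. deriv g 0 * v)) (at 0)"
      using holomorphic_derivI[OF g open_ball, of 0] \<open>R > 0\<close> has_field_derivative_imp_has_derivative by auto
    then have "((\<lambda>z. 2 * Re (g z)) has_derivative (\<lambda>v. 2 * Re (deriv g 0 * v))) (at 0)"
      by (intro bounded_linear.has_derivative[of "\<lambda>z. 2 * Re z"] bounded_linear_const_mult bounded_linear_Re)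
    from has_derivative_add[OF 1 this] have "dderiv ?F v 0 = dderiv F v 0 + 2 * Re (deriv g 0 * v)"
      by (rule dderiv_eqI)
    then show ?thesis using c(13) g0 by simp
  qed
  have "M \<inter> U' = {q\<in>U'. 2 * Re (snd (\<Phi>' q)) + ?F (fst (\<Phi>' q)) = 0}"
    using c(14) by (auto simp: U'_def \<Phi>'_def rho_def)
  moreover have "p \<in> U'" "\<Phi>' p = 0" "?F 0 = 0"
    using c(2,8,12) \<open>R > 0\<close> g0 by (auto simp: U'_def \<Phi>'_def zero_prod_def)
  moreover have "open (W \<inter> ball 0 R)" "(\<lambda>q. fst (\<Phi>' q)) ` U' \<subseteq> W \<inter> ball 0 R"
    using c(9,10) by (auto simp: U'_def \<Phi>'_def)
  ultimately show ?thesis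
    unfolding good_coordinate_def \<Phi>'_def[symmetric]
    using chart smooth dF by (intro exI[of _ U'] conjI exI[of _ "W \<inter> ball 0 R"]) auto
qed

section \<open>Contact orders of holomorphic curves\<close>

lemma eventually_nhds0_D:
  assumes "\<forall>\<^sub>F t in nhds (0::complex). P t"
  obtains d where "d > 0" "\<And>t. cmod t < d \<Longrightarrow> P t"
  using assms unfolding eventually_nhds_metric by auto

lemma factor_lower_bound:
  assumes "isCont g 0" "g 0 \<noteq> (0::complex)" "\<forall>\<^sub>F t in nhds 0. f t = t ^ n * g t"
  obtains c where "c > 0" "\<forall>\<^sub>F t in nhds 0. c * cmod t ^ n \<le> cmod (f t)"
proof -
  have "\<forall>\<^sub>F t in nhds 0. dist (g 0) (g t) < cmod (g 0) / 2"
    using assms by (intro isCont_eventually_dist) auto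
  then have "\<forall>\<^sub>F t in nhds 0. (cmod (g 0) / 2) * cmod t ^ n \<le> cmod (f t)"
    using assms(3)
  proof eventually_elim
    case (elim t)
    have "cmod (g 0) / 2 \<le> cmod (g t)"
      using elim(1) norm_triangle_sub[of "g 0" "g t"] by (simp add: dist_norm)
    then have "cmod (g 0) / 2 * cmod t ^ n \<le> cmod (g t) * cmod t ^ n"
      by (rule mult_right_mono) simp
    then show ?case
      unfolding elim(2) by (simp add: norm_mult norm_power mult.commute)
  qed
  then show ?thesis using assms(2) by (intro that[of "cmod (g 0) / 2"]) auto
qed

lemma vanishes_to_order_lower_bound:
  assumes "c > 0" "\<forall>\<^sub>F t in nhds 0. c * cmod t ^ n \<le> cmod (f t)" "vanishes_to_order f k"
  shows "k \<le> n"
proof (rule ccontr)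
  assume "\<not> k \<le> n"
  then have k: "k = n + Suc (k - n - 1)" by simp
  obtain C where C: "C > 0" "\<forall>\<^sub>F t in nhds 0. cmod (f t) \<le> C * cmod t ^ k"
    using vanishes_to_order_pos[OF assms(3)] by blast
  have "\<forall>\<^sub>F t in nhds 0. c * cmod t ^ n \<le> C * cmod t ^ k"
    using assms(2) C(2) by eventually_elim linarith
  then have "\<forall>\<^sub>F t in nhds (0::complex). c * cmod t ^ n \<le> C * cmod t ^ k \<and> cmod t < 1"
    using eventually_cmod_less[OF zero_less_one] by eventually_elim blast
  then obtain d where d: "d > 0" "\<And>t. cmod t < d \<Longrightarrow> c * cmod t ^ n \<le> C * cmod t ^ k \<and> cmod t < 1"
    using eventually_nhds0_D by blast
  define q where "q = c / C"
  have "q > 0" using C(1) assms(1) by (simp add: q_def)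
  \<comment> \<open>If \<open>k > n\<close>, the two bounds give \<open>c \<le> C * s\<close> for
    small \<open>s\<close>; a test radius below \<open>c / C\<close> refutes this.\<close>
  define s where "s = min d q / 2"
  have s: "0 < s" "s < d" "s < q" using d(1) \<open>q > 0\<close> by (auto simp: s_def)
  then have "cmod (of_real s) = s" by simp
  then have *: "c * s ^ n \<le> C * s ^ k" "s < 1" using d(2)[of "of_real s"] s by metis+
  have "s ^ k \<le> s ^ n * s"
    using s *(2) by (subst k) (simp add: power_add mult_left_le power_le_one mult.assoc)
  then have "c * s ^ n \<le> C * (s ^ n * s)"
    using *(1) C(1) by (meson mult_left_mono order_trans less_imp_le)
  then have "c \<le> C * s" using s(1) by (simp add: mult.left_commute)
  then show False using s(3) C(1) by (simp add: q_def field_simps)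
qed

text \<open>The factor case also records that \<open>b\<close> is not constant, because the open
  mapping theorem asks for it later.\<close>

lemma holomorphic_order_cases:
  assumes "b holomorphic_on ball 0 e" "e > 0" "b 0 = 0"
  obtains (zero) "\<And>t. t \<in> ball 0 e \<Longrightarrow> b t = 0"
    | (factor) n g r where "n > 0" "0 < r" "r \<le> e" "g holomorphic_on ball 0 r"
      "\<And>t. t \<in> ball 0 r \<Longrightarrow> b t = t ^ n * g t" "g 0 \<noteq> 0" "\<not> b constant_on ball 0 e"
proof (cases "b constant_on ball 0 e")
  case True
  then have "b t = 0" if "t \<in> ball 0 e" for t
    using assms that unfolding constant_on_def by (metis centre_in_ball)
  then show ?thesis using zero by blast
next
  case False
  have "0 \<in> ball 0 e" using \<open>e > 0\<close> by simp
  then show ?thesis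
  proof (rule holomorphic_factor_zero_nonconstant[OF assms(1) open_ball connected_ball _ assms(3) False])
    fix g r and n :: nat
    assume "0 < n" "0 < r" "ball 0 r \<subseteq> ball (0::complex) e" "g holomorphic_on ball 0 r"
      "\<And>w. w \<in> ball 0 r \<Longrightarrow> b w = (w - 0)^n * g w" "\<And>w. w \<in> ball 0 r \<Longrightarrow> g w \<noteq> 0"
    then show thesis
      by (intro factor[of n r g] False) (auto simp: ball_subset_ball_iff)
  qed
qed

lemma holomorphic_isCont0:
  "g holomorphic_on ball 0 r \<Longrightarrow> r > 0 \<Longrightarrow> isCont g 0"
  using holomorphic_on_imp_continuous_on continuous_on_interior by (metis interior_ball centre_in_ball)

lemma vanishes_to_order_holomorphic_factor:
  assumes "r > 0" "g holomorphic_on ball 0 r" "\<And>t. t \<in> ball 0 r \<Longrightarrow> b t = t ^ n * g t"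
  shows "vanishes_to_order b n"
proof -
  obtain C d where "d > 0" and C: "\<And>t. cmod t < d \<Longrightarrow> norm (g t) \<le> C * cmod t ^ 0"
    using vanishes_to_order_ball[OF vanishes_to_order_0[OF holomorphic_isCont0[OF assms(2,1)]]] by metis
  have "norm (b t) \<le> C * cmod t ^ n" if "cmod t < min d r" for t
    using assms(3)[of t] C[of t] that
    by (simp add: norm_mult norm_power) (metis mult.commute mult_right_mono norm_ge_zero zero_le_power)
  then show ?thesis
    unfolding vanishes_to_order_def using \<open>d > 0\<close> assms(1) by (metis min_less_iff_conj)
qed

text \<open>The growth order \<open>m\<close> is the multiplicity of the zero, since
  \<open>t ^ n * g t\<close> with \<open>g 0 \<noteq> 0\<close> has order exactly \<open>n\<close>.
  This turns upper bounds into lower ones, as needed to divide by \<open>deriv a\<close> and to pass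
  from powers of \<open>t\<close> to powers of \<open>a t\<close>.\<close>

lemma holomorphic_exact_order:
  assumes a: "a holomorphic_on ball 0 e" "e > 0" and m: "m > 0"
    and van: "vanishes_to_order a m" "\<not> vanishes_to_order a (Suc m)"
  obtains c where "c > 0" "\<forall>\<^sub>F t in nhds 0. c * cmod t ^ m \<le> cmod (a t)"
    "\<forall>\<^sub>F t in nhds 0. c * cmod t ^ (m - 1) \<le> cmod (deriv a t)" "\<not> a constant_on ball 0 e"
proof -
  have a0: "a 0 = 0" using vanishes_to_order_eq_0 van(1) m by blast
  show ?thesis
    using a a0
  proof (cases rule: holomorphic_order_cases)
    case zero
    have "\<forall>\<^sub>F t in nhds 0. norm (a t) \<le> 0 * cmod t ^ Suc m"
      by (rule eventually_mono[OF eventually_in_ball0[OF a(2)]]) (simp add: zero)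
    then have "vanishes_to_order a (Suc m)" unfolding vanishes_to_order_iff by blast
    then show ?thesis using van by blast
  next
    case (factor n g r)
    have ev: "\<forall>\<^sub>F t in nhds 0. a t = t ^ n * g t"
      by (rule eventually_mono[OF eventually_in_ball0[OF factor(2)]]) (rule factor(5))
    obtain c where c: "c > 0" "\<forall>\<^sub>F t in nhds 0. c * cmod t ^ n \<le> cmod (a t)"
      using factor_lower_bound[OF holomorphic_isCont0[OF factor(4,2)] factor(6) ev] .
    have "m \<le> n" using vanishes_to_order_lower_bound[OF c van(1)] .
    moreover have "\<not> Suc m \<le> n"
      using vanishes_to_order_holomorphic_factor[OF factor(2,4,5)] vanishes_to_order_mono van(2) by blast
    ultimately have "n = m" by simp
    \<comment> \<open>What the derivative of \<open>t ^ m * g t\<close> leaves after extracting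
      \<open>t ^ (m - 1)\<close>; its value at \<open>0\<close> is
      \<open>of_nat m * g 0\<close>.\<close>
    define k where "k t = of_nat m * g t + t * deriv g t" for t
    have "k holomorphic_on ball 0 r"
      unfolding k_def by (intro holomorphic_intros factor(4)) auto
    then have "isCont k 0" using holomorphic_isCont0 factor(2) by blast
    have "deriv a t = t ^ (m - 1) * k t" if t: "t \<in> ball 0 r" for t
    proof -
      have "((\<lambda>t. t ^ m * g t) has_field_derivative t ^ (m - 1) * k t) (at t)"
      proof -
        have "t ^ m = t ^ (m - 1) * t" using m by (metis power_minus_mult)
        then show ?thesis
          unfolding k_def using holomorphic_derivI[OF factor(4) open_ball t]
          by (auto intro!: derivative_eq_intros simp: algebra_simps)
      qed
      then have "(a has_field_derivative t ^ (m - 1) * k t) (at t)"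
        by (rule DERIV_cong_ev[OF refl _ refl, THEN iffD2, rotated])
          (use eventually_nhds_in_open[OF open_ball t] in \<open>auto elim!: eventually_mono simp: factor(5) \<open>n = m\<close>\<close>)
      then show ?thesis by (rule DERIV_imp_deriv)
    qed
    then have ev': "\<forall>\<^sub>F t in nhds 0. deriv a t = t ^ (m - 1) * k t"
      by (rule eventually_mono[OF eventually_in_ball0[OF factor(2)]])
    have "k 0 \<noteq> 0" using factor(6) m by (simp add: k_def)
    obtain c' where c': "c' > 0" "\<forall>\<^sub>F t in nhds 0. c' * cmod t ^ (m - 1) \<le> cmod (deriv a t)"
      using factor_lower_bound[OF \<open>isCont k 0\<close> \<open>k 0 \<noteq> 0\<close> ev'] .
    show ?thesis
    proof (rule that[of "min c c'"])
      show "min c c' > 0" using c c' by simp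
      show "\<forall>\<^sub>F t in nhds 0. min c c' * cmod t ^ m \<le> cmod (a t)"
        using c(2) by (rule eventually_mono) (rule order_trans[OF mult_right_mono], auto simp: \<open>n = m\<close>)
      show "\<forall>\<^sub>F t in nhds 0. min c c' * cmod t ^ (m - 1) \<le> cmod (deriv a t)"
        using c'(2) by (rule eventually_mono) (rule order_trans[OF mult_right_mono], auto)
    qed (rule factor(7))
  qed
qed

text \<open>On a ray on which the leading term \<open>t\<^sup>n g(0)\<close> is a positive real, \<open>\<bar>b\<bar>\<close> and \<open>Re b\<close>
  have the same order.\<close>

lemma vanishes_to_order_from_Re:
  assumes b: "b holomorphic_on ball 0 e" "e > 0" "b 0 = 0"
    and van: "vanishes_to_order (\<lambda>t. Re (b t)) N"
  shows "vanishes_to_order b N"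
  using b
proof (cases rule: holomorphic_order_cases)
  case zero
  have "\<forall>\<^sub>F t in nhds 0. norm (b t) \<le> 0 * cmod t ^ N"
    by (rule eventually_mono[OF eventually_in_ball0[OF b(2)]]) (simp add: zero)
  then show ?thesis unfolding vanishes_to_order_iff by blast
next
  case (factor n g r)
  \<comment> \<open>An \<open>n\<close>-th root of the phase conjugate to that of
    \<open>g 0\<close>; along the ray through it the leading term of \<open>b\<close> is
    \<open>cmod (g 0)\<close> times the \<open>n\<close>-th power of the radius.\<close>
  define \<omega> where "\<omega> = cis (- Arg (g 0) / real n)"
  have \<omega>: "\<omega> ^ n * g 0 = of_real (cmod (g 0))" "cmod \<omega> = 1"
  proof -
    have "\<omega> ^ n = cis (- Arg (g 0))"
      using Complex.DeMoivre[of "- Arg (g 0) / real n" n] factor(1) by (simp add: \<omega>_def)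
    moreover have "g 0 = of_real (cmod (g 0)) * cis (Arg (g 0))"
      using rcis_cmod_Arg[of "g 0"] by (simp add: rcis_def)
    ultimately have "\<omega> ^ n * g 0 = of_real (cmod (g 0)) * (cis (- Arg (g 0)) * cis (Arg (g 0)))"
      by (metis mult.left_commute)
    then show "\<omega> ^ n * g 0 = of_real (cmod (g 0))" by (simp add: cis_mult)
  qed (simp add: \<omega>_def)
  obtain C where C: "C > 0" "\<forall>\<^sub>F t in nhds 0. norm (Re (b t)) \<le> C * cmod t ^ N"
    using vanishes_to_order_pos[OF van] by blast
  have "\<forall>\<^sub>F t in nhds 0. dist (g 0) (g t) < cmod (g 0) / 2"
    using factor(6) by (intro isCont_eventually_dist holomorphic_isCont0[OF factor(4,2)]) auto
  then have "\<forall>\<^sub>F t in nhds 0. t \<in> ball 0 r \<and> \<bar>Re (b t)\<bar> \<le> C * cmod t ^ N \<and> dist (g 0) (g t) < cmod (g 0) / 2"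
    using C(2) eventually_in_ball0[OF factor(2)] by eventually_elim simp
  then obtain d where d: "d > 0" "\<And>t. cmod t < d \<Longrightarrow>
      t \<in> ball 0 r \<and> \<bar>Re (b t)\<bar> \<le> C * cmod t ^ N \<and> dist (g 0) (g t) < cmod (g 0) / 2"
    using eventually_nhds0_D by blast
  have ray: "cmod (g 0) / 2 * s ^ n \<le> C * s ^ N" if s: "0 \<le> s" "s < d" for s :: real
  proof -
    define t where "t = of_real s * \<omega>"
    have t: "cmod t = s" using s \<omega>(2) by (simp add: t_def norm_mult)
    have bt: "b t = of_real (s ^ n) * (\<omega> ^ n * g t)"
      using d(2)[of t] t s factor(5)[of t] by (simp add: t_def power_mult_distrib)
    have "cmod (g 0) - Re (\<omega> ^ n * g t) = Re (\<omega> ^ n * (g 0 - g t))"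
      using \<omega>(1) by (simp add: right_diff_distrib)
    also have "\<dots> \<le> cmod (\<omega> ^ n * (g 0 - g t))" by (rule complex_Re_le_cmod)
    also have "\<dots> \<le> cmod (g 0) / 2"
      using d(2)[of t] t s \<omega>(2) by (simp add: norm_mult norm_power dist_norm)
    finally have "cmod (g 0) / 2 * s ^ n \<le> Re (\<omega> ^ n * g t) * s ^ n"
      using s by (intro mult_right_mono) auto
    also have "\<dots> = Re (b t)" unfolding bt by (simp only: Re_complex_of_real Im_complex_of_real times_complex.sel mult_zero_left diff_zero mult.commute)
    also have "\<dots> \<le> \<bar>Re (b t)\<bar>" by simp
    also have "\<dots> \<le> C * s ^ N" using d(2)[of t] t s by simp
    finally show ?thesis .
  qed
  have "N \<le> n"
  proof (rule vanishes_to_order_lower_bound)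
    show "cmod (g 0) / 2 > 0" using factor(6) by simp
    \<comment> \<open>The estimate on the one ray involves only the radius, so it reads as a
      comparison of the powers \<open>n\<close> and \<open>N\<close> for all small
      \<open>t\<close>.\<close>
    show "\<forall>\<^sub>F t in nhds 0. cmod (g 0) / 2 * cmod t ^ n \<le> cmod (of_real (C * cmod t ^ N) :: complex)"
      using eventually_cmod_less[OF d(1)]
    proof (rule eventually_mono)
      fix t :: complex assume "cmod t < d"
      then show "cmod (g 0) / 2 * cmod t ^ n \<le> cmod (of_real (C * cmod t ^ N) :: complex)"
        using order_trans[OF ray[of "cmod t"] abs_ge_self] unfolding norm_of_real by simp
    qed
    show "vanishes_to_order (\<lambda>t. of_real (C * cmod t ^ N) :: complex) N"
      unfolding vanishes_to_order_iff using C(1) by (intro exI[of _ C]) (simp add: norm_mult norm_power)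
  qed
  then show ?thesis
    using vanishes_to_order_holomorphic_factor[OF factor(2,4,5)] vanishes_to_order_mono by blast
qed

text \<open>A finite supremum of natural numbers is attained. The order 0 hypothesis separates
  \<open>m = 0\<close> from the empty set, whose supremum is also 0.\<close>

lemma vanish_ord_enat:
  assumes "vanish_ord h = enat m" "vanishes_to_order h 0"
  shows "vanishes_to_order h m" "\<not> vanishes_to_order h (Suc m)"
proof -
  let ?S = "{enat N | N. vanishes_to_order h N}"
  have le: "N \<le> m" if "vanishes_to_order h N" for N
    using Sup_upper[of "enat N" ?S] that assms(1) unfolding vanish_ord_def by auto
  then show "\<not> vanishes_to_order h (Suc m)" by force
  show "vanishes_to_order h m"
  proof (rule ccontr)
    assume n: "\<not> ?thesis"
    then have "m > 0" using assms(2) by (cases m) auto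
    have "N \<le> m - 1" if "vanishes_to_order h N" for N
      using le[OF that] n that by (cases "N = m") auto
    then have "Sup ?S \<le> enat (m - 1)" by (intro Sup_least) auto
    then show False using assms(1) \<open>m > 0\<close> unfolding vanish_ord_def by simp
  qed
qed

lemma less_vanish_ordD:
  assumes "enat N < vanish_ord h"
  shows "vanishes_to_order h N"
  using assms vanishes_to_order_mono unfolding vanish_ord_def less_Sup_iff by fastforce

lemma vanish_ord_eqI:
  assumes "vanishes_to_order h m" "\<not> vanishes_to_order h (Suc m)"
  shows "vanish_ord h = enat m"
  unfolding vanish_ord_def
proof (rule antisym)
  have "N \<le> m" if "vanishes_to_order h N" for N
    using that assms(2) vanishes_to_order_mono not_less_eq_eq by blast
  then show "Sup {enat N | N. vanishes_to_order h N} \<le> enat m" by (intro Sup_least) auto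
  show "enat m \<le> Sup {enat N | N. vanishes_to_order h N}" using assms(1) by (intro Sup_upper) auto
qed

section \<open>Curves in \<open>Gamma\<close> and their contact with \<open>M\<close>\<close>

lemma Gamma_differentiable:
  assumes "\<gamma> \<in> Gamma p"
  shows "\<gamma> differentiable at 0" "\<gamma> 0 = p"
proof -
  obtain \<epsilon> where "\<epsilon> > 0" "(\<lambda>t. fst (\<gamma> t)) holomorphic_on ball 0 \<epsilon>" "(\<lambda>t. snd (\<gamma> t)) holomorphic_on ball 0 \<epsilon>"
    using assms unfolding Gamma_def by blast
  then have "(\<lambda>t. fst (\<gamma> t)) differentiable at 0" "(\<lambda>t. snd (\<gamma> t)) differentiable at 0"
    by (auto intro!: field_differentiable_imp_differentiable elim!: holomorphic_on_imp_differentiable_at)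
  then have "(\<lambda>t. (fst (\<gamma> t), snd (\<gamma> t))) differentiable at 0" 
    unfolding differentiable_def using has_derivative_Pair by blast
  then show "\<gamma> differentiable at 0" by simp
  show "\<gamma> 0 = p" using assms by (simp add: Gamma_def)
qed

lemma Delta1_infinite_curve:
  assumes "Delta1 M p = \<infinity>"
  obtains \<gamma> m where "\<gamma> \<in> Gamma p" "m > 0" "vanishes_to_order (\<lambda>t. \<gamma> t - p) m"
    "\<not> vanishes_to_order (\<lambda>t. \<gamma> t - p) (Suc m)" "vanishes_to_order (\<lambda>t. ldf M p (\<gamma> t)) (K * m)"
proof -
  have "ereal (real K) < Delta1 M p" using assms by simp
  then obtain \<gamma> where \<gamma>: "\<gamma> \<in> Gamma p" and
    ratio: "ereal (real K) < ereal_of_enat (vanish_ord (\<lambda>t. ldf M p (\<gamma> t))) / ereal_of_enat (vanish_ord (\<lambda>t. \<gamma> t - p))"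
    unfolding Delta1_def less_SUP_iff by blast
  have v1: "vanishes_to_order (\<lambda>t. \<gamma> t - p) 1"
    using Gamma_differentiable[OF \<gamma>] by (intro vanishes_to_order_1) auto
  \<comment> \<open>In \<open>ereal\<close> every quotient by \<infinity> is 0, even
    \<open>\<infinity> / \<infinity>\<close>, so such a curve cannot have a ratio above
    \<open>K\<close>.\<close>
  have "vanish_ord (\<lambda>t. \<gamma> t - p) \<noteq> \<infinity>"
  proof
    assume "vanish_ord (\<lambda>t. \<gamma> t - p) = \<infinity>"
    then have "ereal (real K) < 0" using ratio by simp
    then show False by simp
  qed
  then obtain m where m: "vanish_ord (\<lambda>t. \<gamma> t - p) = enat m" by auto
  note vm = vanish_ord_enat[OF m vanishes_to_order_mono[OF v1]]
  have "m > 0" using vm(2) v1 by (cases m) auto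
  have "enat (K * m) < vanish_ord (\<lambda>t. ldf M p (\<gamma> t))"
  proof (cases "vanish_ord (\<lambda>t. ldf M p (\<gamma> t))")
    case (enat n)
    then have "real K < real n / real m" using ratio m \<open>m > 0\<close> by simp
    then have "real (K * m) < real n" using \<open>m > 0\<close> by (simp add: field_simps)
    then show ?thesis using enat by (simp only: enat_ord_simps of_nat_less_iff)
  qed simp
  from less_vanish_ordD[OF this] vm show ?thesis using that[OF \<gamma> \<open>m > 0\<close>] by simp
qed

lemma vanishes_to_order_wirtinger:
  assumes "smooth_on (ball 0 e) f" "e > 0" "vanishes_to_order f (2 * N)"
  shows "vanishes_to_order (dz f) N" "vanishes_to_order (dzb f) N"
proof -
  have s: "vanishes_to_order (dderiv f 1) N" "vanishes_to_order (dderiv f \<i>) N"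
    using vanishes_to_order_dderiv[OF assms(1,2) _ assms(3)] by auto
  then show "vanishes_to_order (dz f) N" "vanishes_to_order (dzb f) N"
    unfolding wirtinger_alt
    by (intro vanishes_to_order_add vanishes_to_order_linear[OF _ bounded_linear_mult_left]; simp)+
qed

lemma vanishes_to_order_Pair_iff:
  fixes h :: "complex \<Rightarrow> 'a::real_normed_vector \<times> 'b::real_normed_vector"
  shows "vanishes_to_order h N \<longleftrightarrow> vanishes_to_order (\<lambda>t. fst (h t)) N \<and> vanishes_to_order (\<lambda>t. snd (h t)) N"
proof
  assume *: "vanishes_to_order (\<lambda>t. fst (h t)) N \<and> vanishes_to_order (\<lambda>t. snd (h t)) N"
  have bl: "bounded_linear (\<lambda>x::'a. (x, 0::'b))" "bounded_linear (\<lambda>x::'b. (0::'a, x))"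
    by (intro bounded_linear_Pair bounded_linear_ident bounded_linear_zero)+
  have "vanishes_to_order (\<lambda>t. (fst (h t), 0) + (0, snd (h t))) N"
    by (rule vanishes_to_order_add[OF vanishes_to_order_linear[OF conjunct1[OF *] bl(1)]
          vanishes_to_order_linear[OF conjunct2[OF *] bl(2)]])
  then show "vanishes_to_order h N" by simp
qed (auto intro: vanishes_to_order_linear bounded_linear_fst bounded_linear_snd)

lemma lipschitz_near_eventually:
  assumes "lipschitz_near f p" "isCont \<gamma> 0" "\<gamma> 0 = p"
  obtains L where "\<forall>\<^sub>F t in nhds (0::complex). norm (f (\<gamma> t) - f p) \<le> L * norm (\<gamma> t - p)"
proof -
  obtain L d where L: "L > 0" "d > 0"
    "\<And>x y. dist p x < d \<Longrightarrow> dist p y < d \<Longrightarrow> norm (f x - f y) \<le> L * norm (x - y)"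
    using lipschitz_nearD[OF assms(1)] by blast
  have "\<forall>\<^sub>F t in nhds 0. norm (f (\<gamma> t) - f p) \<le> L * norm (\<gamma> t - p)"
    using isCont_eventually_dist[OF assms(2,3) L(2)]
    by (rule eventually_mono) (use L in auto)
  then show ?thesis using that by blast
qed

lemma good_coordinate_smooth_ball:
  assumes "good_coordinate M p \<Phi> F"
  obtains e where "e > 0" "smooth_on (ball 0 e) F"
proof -
  obtain U \<Psi> W where "p \<in> U" "\<Phi> p = 0" "open W" "\<And>q. q \<in> U \<Longrightarrow> fst (\<Phi> q) \<in> W" "smooth_on W F"
    using good_coordinateE[OF assms] by metis
  then have "0 \<in> W" by (metis fst_zero)
  then obtain e where "e > 0" "ball 0 e \<subseteq> W" using \<open>open W\<close> openE by blast
  then show ?thesis using that smooth_on_subset \<open>smooth_on W F\<close> by blast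
qed

text \<open>The vanishing gradient gives both partials order 1 by differentiability, and integration
  adds one more.\<close>

lemma good_coordinate_vanishes_2:
  assumes "good_coordinate M p \<Phi> F"
  shows "vanishes_to_order F 2"
proof -
  obtain e where e: "e > 0" "smooth_on (ball 0 e) F" using good_coordinate_smooth_ball[OF assms] .
  have F0: "F 0 = 0" "\<And>v. dderiv F v 0 = 0"
    using assms unfolding good_coordinate_def by auto
  have "vanishes_to_order (dderiv F v) 1" if "v \<in> Basis" for v
    using smooth_on_differentiable[OF smooth_on_dderiv[OF e(2) that]] e F0
    by (intro vanishes_to_order_1) auto
  then have "vanishes_to_order F (Suc 1)"
    using e F0 by (intro vanishes_to_order_SucI) (auto simp: Basis_complex_def)
  then show ?thesis by (simp add: numeral_2_eq_2)
qed

text \<open>The chart is Lipschitz in both directions, so the order of the curve is preserved; the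
  two bounds between \<open>r\<close> and \<open>rho\<close> do the same for contact. Afterwards
  only the functions \<open>a\<close>, \<open>b\<close> and \<open>F\<close> of one complex variable
  remain.\<close>

lemma curve_in_good_coordinate:
  assumes ldf: "local_defining_function M p r" and good: "good_coordinate M p \<Phi> F"
    and \<gamma>: "\<gamma> \<in> Gamma p"
  obtains e a b where "e > 0" "a holomorphic_on ball 0 e" "b holomorphic_on ball 0 e" "a 0 = 0" "b 0 = 0"
    "\<And>N. vanishes_to_order (\<lambda>t. \<gamma> t - p) N \<longleftrightarrow> vanishes_to_order a N \<and> vanishes_to_order b N"
    "\<And>N. vanishes_to_order (\<lambda>t. r (\<gamma> t)) N \<longleftrightarrow> vanishes_to_order (\<lambda>t. F (a t) + 2 * Re (b t)) N"
proof -
  obtain U \<Psi> W where c: "open U" "p \<in> U" "holo_map2_on U \<Phi>" "open (\<Phi> ` U)"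
    "holo_map2_on (\<Phi> ` U) \<Psi>" "\<And>x. x \<in> U \<Longrightarrow> \<Psi> (\<Phi> x) = x" "\<Phi> p = 0"
    using good_coordinateE[OF good] by metis
  have "0 \<in> \<Phi> ` U" "\<Psi> 0 = p" using c(2,6,7) by (metis imageI)+
  obtain \<epsilon> where \<epsilon>: "\<epsilon> > 0" "(\<lambda>t. fst (\<gamma> t)) holomorphic_on ball 0 \<epsilon>" "(\<lambda>t. snd (\<gamma> t)) holomorphic_on ball 0 \<epsilon>"
    using \<gamma> unfolding Gamma_def by blast
  have \<gamma>0: "\<gamma> 0 = p" "isCont \<gamma> 0"
    using Gamma_differentiable[OF \<gamma>] differentiable_imp_continuous_within by blast+
  have inU: "\<forall>\<^sub>F t in nhds 0. \<gamma> t \<in> U"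
    using eventually_compose_filterlim[OF eventually_nhds_in_open[OF c(1,2)], of \<gamma> "nhds 0"] \<gamma>0
    by (auto simp: isCont_def tendsto_at_iff_tendsto_nhds)
  then obtain d where d: "d > 0" "\<And>t. cmod t < d \<Longrightarrow> \<gamma> t \<in> U" using eventually_nhds0_D by blast
  define e where "e = min d \<epsilon>"
  define a where "a t = fst (\<Phi> (\<gamma> t))" for t
  define b where "b t = snd (\<Phi> (\<gamma> t))" for t
  have "e > 0" using d \<epsilon> by (simp add: e_def)
  have hol: "(\<lambda>t. f (\<gamma> t)) holomorphic_on ball 0 e" if "holo2_on U f" for f
  proof -
    have "(\<lambda>t. f (fst (\<gamma> t), snd (\<gamma> t))) holomorphic_on ball 0 e"
      using d(2) by (intro holomorphic_on_compose_holo2[OF that] holomorphic_on_subset[OF \<epsilon>(2)]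
          holomorphic_on_subset[OF \<epsilon>(3)]) (auto simp: e_def)
    then show ?thesis by simp
  qed
  have holab: "a holomorphic_on ball 0 e" "b holomorphic_on ball 0 e"
    unfolding a_def b_def using c(3) hol[of "\<lambda>q. fst (\<Phi> q)"] hol[of "\<lambda>q. snd (\<Phi> q)"]
    unfolding holo_map2_on_def by auto
  have ab0: "a 0 = 0" "b 0 = 0" using \<gamma>0 c(7) by (auto simp: a_def b_def)
  have \<Phi>: "lipschitz_near \<Phi> p" and \<Psi>: "lipschitz_near \<Psi> 0"
    using holo_map2_lipschitz_near c \<open>0 \<in> \<Phi> ` U\<close> by blast+
  have cont\<Phi>: "isCont (\<lambda>t. \<Phi> (\<gamma> t)) 0"
    using isCont_o2[OF \<gamma>0(2), of \<Phi>] lipschitz_near_isCont[OF \<Phi>] \<gamma>0(1) by simp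
  obtain L where L: "\<forall>\<^sub>F t in nhds 0. norm (\<Phi> (\<gamma> t) - \<Phi> p) \<le> L * norm (\<gamma> t - p)"
    using lipschitz_near_eventually[OF \<Phi> \<gamma>0(2,1)] .
  obtain L' where L': "\<forall>\<^sub>F t in nhds 0. norm (\<Psi> (\<Phi> (\<gamma> t)) - \<Psi> 0) \<le> L' * norm (\<Phi> (\<gamma> t) - 0)"
    using lipschitz_near_eventually[OF \<Psi> cont\<Phi>] \<gamma>0 c(7) by auto
  have "\<forall>\<^sub>F t in nhds 0. norm (\<gamma> t - p) \<le> L' * norm (\<Phi> (\<gamma> t))"
    using L' inU by eventually_elim (simp add: c(6) \<open>\<Psi> 0 = p\<close>)
  then have "vanishes_to_order (\<lambda>t. \<gamma> t - p) N \<longleftrightarrow> vanishes_to_order (\<lambda>t. \<Phi> (\<gamma> t)) N" for N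
    using vanishes_to_order_compare[of "\<lambda>t. \<Phi> (\<gamma> t)" N "\<lambda>t. \<gamma> t - p" L']
      vanishes_to_order_compare[of "\<lambda>t. \<gamma> t - p" N "\<lambda>t. \<Phi> (\<gamma> t)" L] L c(7) by auto
  then have van\<gamma>: "vanishes_to_order (\<lambda>t. \<gamma> t - p) N \<longleftrightarrow> vanishes_to_order a N \<and> vanishes_to_order b N" for N
    unfolding a_def b_def using vanishes_to_order_Pair_iff[of "\<lambda>t. \<Phi> (\<gamma> t)" N] by simp
  obtain K where K: "\<forall>\<^sub>F q in nhds p. \<bar>r q\<bar> \<le> K * \<bar>rho \<Phi> F q\<bar>" using ldf_le_rho[OF ldf good] .
  obtain K' where K': "\<forall>\<^sub>F q in nhds p. \<bar>rho \<Phi> F q\<bar> \<le> K' * \<bar>r q\<bar>" using rho_le_ldf[OF ldf good] .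
  have lim: "(\<gamma> \<longlongrightarrow> p) (nhds 0)" using \<gamma>0 tendsto_at_iff_tendsto_nhds[of \<gamma> 0] by (simp add: isCont_def)
  have "vanishes_to_order (\<lambda>t. r (\<gamma> t)) N \<longleftrightarrow> vanishes_to_order (\<lambda>t. rho \<Phi> F (\<gamma> t)) N" for N
    using vanishes_to_order_compare[of "\<lambda>t. r (\<gamma> t)" N "\<lambda>t. rho \<Phi> F (\<gamma> t)" K']
      vanishes_to_order_compare[of "\<lambda>t. rho \<Phi> F (\<gamma> t)" N "\<lambda>t. r (\<gamma> t)" K]
      eventually_compose_filterlim[OF K lim] eventually_compose_filterlim[OF K' lim] by auto
  then have "vanishes_to_order (\<lambda>t. r (\<gamma> t)) N \<longleftrightarrow> vanishes_to_order (\<lambda>t. F (a t) + 2 * Re (b t)) N" for N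
    by (simp add: rho_def a_def b_def add.commute)
  then show ?thesis using that[OF \<open>e > 0\<close> holab ab0 van\<gamma>] by blast
qed

text \<open>Since \<open>F = O(\<bar>z\<bar>\<^sup>2)\<close>, contact with \<open>M\<close> of order above that of the curve forces
  \<open>b\<close> to vanish to higher order, so the order of the curve is that of \<open>a\<close>.\<close>

lemma vanishes_to_order_second_component:
  assumes F: "vanishes_to_order F 2" and b: "b holomorphic_on ball 0 e" "e > 0" "b 0 = 0"
    and m: "m > 0" and a: "vanishes_to_order a m"
    and van: "vanishes_to_order (\<lambda>t. F (a t) + 2 * Re (b t)) (Suc m)"
  shows "vanishes_to_order b (Suc m)"
proof -
  have "vanishes_to_order (\<lambda>t. F (a t)) (m * 2)"
    by (rule vanishes_to_order_compose[OF F a m])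
  then have "vanishes_to_order (\<lambda>t. F (a t)) (Suc m)"
    by (rule vanishes_to_order_mono) (use m in simp)
  then have "vanishes_to_order (\<lambda>t. - F (a t)) (Suc m)"
    using vanishes_to_order_linear bounded_linear_minus[OF bounded_linear_ident] by blast
  from vanishes_to_order_linear[OF vanishes_to_order_add[OF van this] bounded_linear_mult_right[of "1/2"]]
  have "vanishes_to_order (\<lambda>t. Re (b t)) (Suc m)" by simp
  then show ?thesis using vanishes_to_order_from_Re[OF b] by blast
qed

lemma Delta1_infinite_imp_flat_laplacian:
  assumes ldf: "local_defining_function M p (ldf M p)" and good: "good_coordinate M p \<Phi> F"
    and Delta1: "Delta1 M p = \<infinity>"
  shows "flatO (dzb (dz (\<lambda>z. complex_of_real (F z))))"
  unfolding flatO_def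
proof
  fix L :: nat
  define Fc where "Fc = (\<lambda>z. complex_of_real (F z))"
  define G where "G = dzb (dz Fc)"
  obtain R where R: "R > 0" "smooth_on (ball 0 R) F" using good_coordinate_smooth_ball[OF good] .
  have smF: "smooth_on (ball 0 R) Fc"
    unfolding Fc_def by (intro smooth_on_linear[OF open_ball bounded_linear_of_real R(2)])
  have smdz: "smooth_on (ball 0 R) (dz Fc)" and smG: "smooth_on (ball 0 R) G"
    unfolding G_def using smooth_on_wirtinger smF by blast+
  obtain \<gamma> m where \<gamma>: "\<gamma> \<in> Gamma p" and m: "m > 0" and vm: "vanishes_to_order (\<lambda>t. \<gamma> t - p) m"
    "\<not> vanishes_to_order (\<lambda>t. \<gamma> t - p) (Suc m)" "vanishes_to_order (\<lambda>t. ldf M p (\<gamma> t)) (4 * (L + 2) * m)"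
    using Delta1_infinite_curve[OF Delta1] .
  obtain e0 a b where e0: "e0 > 0" and a0: "a holomorphic_on ball 0 e0" and b0: "b holomorphic_on ball 0 e0"
    and ab0: "a 0 = 0" "b 0 = 0"
    and van: "\<And>N. vanishes_to_order (\<lambda>t. \<gamma> t - p) N \<longleftrightarrow> vanishes_to_order a N \<and> vanishes_to_order b N"
    "\<And>N. vanishes_to_order (\<lambda>t. ldf M p (\<gamma> t)) N \<longleftrightarrow> vanishes_to_order (\<lambda>t. F (a t) + 2 * Re (b t)) N"
    using curve_in_good_coordinate[OF ldf good \<gamma>] by blast
  have contact: "vanishes_to_order (\<lambda>t. F (a t) + 2 * Re (b t)) (4 * (L + 2) * m)"
    using van(2) vm(3) by blast
  have "2 * m \<le> 4 * (L + 2) * m" by (intro mult_right_mono) auto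
  then have "Suc m \<le> 4 * (L + 2) * m" using m by linarith
  then have vb: "vanishes_to_order b (Suc m)"
    using vanishes_to_order_second_component[OF good_coordinate_vanishes_2[OF good] b0 e0 ab0(2) m]
      van(1) vm(1) vanishes_to_order_mono[OF contact] by blast
  then have va: "vanishes_to_order a m" "\<not> vanishes_to_order a (Suc m)" using van(1) vm by blast+
  have "\<forall>\<^sub>F t in nhds 0. dist 0 (a t) < R"
    by (rule isCont_eventually_dist[OF holomorphic_isCont0[OF a0 e0] ab0(1) R(1)])
  then obtain e1 where e1: "e1 > 0" "\<And>t. cmod t < e1 \<Longrightarrow> dist 0 (a t) < R" using eventually_nhds0_D by blast
  define e where "e = min e0 e1"
  have "e > 0" using e0 e1 by (simp add: e_def)
  have a: "a holomorphic_on ball 0 e" and b: "b holomorphic_on ball 0 e"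
    using a0 b0 by (auto elim!: holomorphic_on_subset simp: e_def)
  have aR: "a t \<in> ball 0 R" if "t \<in> ball 0 e" for t using e1(2)[of t] that by (simp add: e_def)
  \<comment> \<open>With \<open>b + cnj b\<close> in place of \<open>2 * Re b\<close>,
    \<open>dz\<close> removes \<open>cnj b\<close> and \<open>dzb\<close> then removes
    \<open>deriv b\<close>, so only \<open>F\<close> composed with \<open>a\<close>
    contributes.\<close>
  define f where "f t = Fc (a t) + (b t + cnj (b t))" for t
  have smFa: "smooth_on (ball 0 e) (\<lambda>t. Fc (a t))"
    using aR by (intro smooth_on_compose_holomorphic[OF _ _ a _ smF]) auto
  have smb: "smooth_on (ball 0 e) b" "smooth_on (ball 0 e) (\<lambda>t. cnj (b t))"
    using smooth_on_holomorphic[OF open_ball b] smooth_on_linear[OF open_ball bounded_linear_cnj] by blast+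
  have smf: "smooth_on (ball 0 e) f"
    unfolding f_def by (intro smooth_on_add smFa smb open_ball)
  have "vanishes_to_order (\<lambda>t. complex_of_real (F (a t) + 2 * Re (b t))) (4 * (L + 2) * m)"
    by (rule vanishes_to_order_linear[OF contact bounded_linear_of_real])
  moreover have "f = (\<lambda>t. complex_of_real (F (a t) + 2 * Re (b t)))"
    by (rule ext) (simp add: f_def Fc_def complex_eq_iff)
  moreover have "4 * (L + 2) * m = 2 * (2 * ((L + 2) * m))" by (simp add: algebra_simps)
  ultimately have "vanishes_to_order f (2 * (2 * ((L + 2) * m)))" by metis
  from vanishes_to_order_wirtinger(1)[OF smf \<open>e > 0\<close> this]
  have vanf: "vanishes_to_order (dzb (dz f)) ((L + 2) * m)"
    using vanishes_to_order_wirtinger(2)[OF smooth_on_wirtinger(1)[OF smf open_ball] \<open>e > 0\<close>] by blast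
  have dzf: "dz f t = dz Fc (a t) * deriv a t + deriv b t" if t: "t \<in> ball 0 e" for t
  proof -
    note d = smooth_on_differentiable[OF _ open_ball t]
    have "dz f t = dz (\<lambda>t. Fc (a t)) t + (dz b t + dz (\<lambda>t. cnj (b t)) t)"
      unfolding f_def
      by (simp add: wirtinger_add(1) d[OF smFa] d[OF smb(1)] d[OF smb(2)] d[OF smooth_on_add[OF open_ball smb]])
    then show ?thesis
      using wirtinger_compose_holomorphic(1)[OF smooth_on_differentiable[OF smF open_ball aR[OF t]] a open_ball t]
        wirtinger_holomorphic[OF b open_ball t] wirtinger_cnj(1)[OF d[OF smb(1)]] by simp
  qed
  have lap: "dzb (dz f) t = G (a t) * cnj (deriv a t) * deriv a t" if t: "t \<in> ball 0 e" for t
  proof -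
    have da: "deriv a holomorphic_on ball 0 e" "deriv b holomorphic_on ball 0 e"
      using holomorphic_deriv a b by blast+
    have sm: "smooth_on (ball 0 e) (\<lambda>t. dz Fc (a t))"
      using aR by (intro smooth_on_compose_holomorphic[OF _ _ a _ smdz]) auto
    have d: "(\<lambda>t. dz Fc (a t)) differentiable at t" "deriv a differentiable at t" "deriv b differentiable at t"
      using smooth_on_differentiable[OF _ open_ball t] sm smooth_on_holomorphic[OF open_ball] da by blast+
    have "dzb (dz f) t = dzb (\<lambda>t. dz Fc (a t) * deriv a t + deriv b t) t"
      by (rule wirtinger_cong(2)[OF open_ball t dzf])
    also have "\<dots> = dzb (\<lambda>t. dz Fc (a t) * deriv a t) t + dzb (deriv b) t"
      by (rule wirtinger_add(2)) (intro differentiable_mult d)+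
    also have "\<dots> = dzb (\<lambda>t. dz Fc (a t)) t * deriv a t"
      using dzb_mult[OF d(1,2)] wirtinger_holomorphic(2)[OF da(1) open_ball t]
        wirtinger_holomorphic(2)[OF da(2) open_ball t] by simp
    also have "dzb (\<lambda>t. dz Fc (a t)) t = G (a t) * cnj (deriv a t)"
      unfolding G_def
      by (rule wirtinger_compose_holomorphic(2)[OF smooth_on_differentiable[OF smdz open_ball aR[OF t]] a open_ball t])
    finally show ?thesis .
  qed
  obtain c where c: "c > 0" "\<forall>\<^sub>F t in nhds 0. c * cmod t ^ m \<le> cmod (a t)"
    "\<forall>\<^sub>F t in nhds 0. c * cmod t ^ (m - 1) \<le> cmod (deriv a t)" and nonconst: "\<not> a constant_on ball 0 e"
    using holomorphic_exact_order[OF a \<open>e > 0\<close> m va] .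
  obtain C where C: "C > 0" "\<forall>\<^sub>F t in nhds 0. norm (dzb (dz f) t) \<le> C * cmod t ^ ((L + 2) * m)"
    using vanishes_to_order_pos[OF vanf] by blast
  have "\<forall>\<^sub>F t in nhds 0. t \<noteq> 0 \<longrightarrow> cmod (G (a t)) \<le> C / c ^ (L + 2) * cmod (a t) ^ L"
    using c(2,3) C(2) eventually_in_ball0[OF \<open>e > 0\<close>] eventually_cmod_less[OF zero_less_one]
  proof eventually_elim
    case (elim t)
    show ?case
    proof
      assume "t \<noteq> 0"
      define s where "s = cmod t"
      have s: "0 < s" "s < 1" using \<open>t \<noteq> 0\<close> elim by (auto simp: s_def)
      define T where "T = s ^ (m - 1)"
      have "T > 0" using s by (simp add: T_def)
      \<comment> \<open>Splits off the order \<open>2 * (m - 1)\<close> of the two factors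
        \<open>deriv a\<close>; the remaining \<open>L * m + 2\<close> still exceeds
        \<open>m * L\<close>, the order of \<open>cmod (a t) ^ L\<close>.\<close>
      have "(L + 2) * m = (L * m + 2) + (m - 1) + (m - 1)" using m by (cases m) (auto simp: algebra_simps)
      then have pow: "s ^ ((L + 2) * m) = s ^ (L * m + 2) * T * T"
        unfolding T_def by (simp only: power_add)
      have "cmod (G (a t)) * (c * T) * (c * T) \<le> cmod (G (a t)) * cmod (deriv a t) * cmod (deriv a t)"
        using elim(2) c(1) \<open>T > 0\<close> by (intro mult_mono) (auto simp: s_def T_def)
      also have "\<dots> = norm (dzb (dz f) t)" using lap elim by (simp add: norm_mult)
      also have "\<dots> \<le> C * (s ^ (L * m + 2) * T * T)" using elim(3) pow by (simp add: s_def)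
      finally have "(cmod (G (a t)) * c ^ 2) * (T * T) \<le> (C * s ^ (L * m + 2)) * (T * T)"
        by (simp add: mult_ac power2_eq_square)
      then have "cmod (G (a t)) * c ^ 2 \<le> C * s ^ (L * m + 2)"
        using \<open>T > 0\<close> by (simp only: mult_le_cancel_right_pos mult_pos_pos)
      also have "\<dots> \<le> C * s ^ (m * L)"
        using C(1) s by (intro mult_left_mono power_decreasing) auto
      finally have "cmod (G (a t)) * c ^ 2 * c ^ L \<le> C * s ^ (m * L) * c ^ L"
        using c(1) by (intro mult_right_mono) auto
      also have "\<dots> = C * (c * s ^ m) ^ L" by (simp add: power_mult power_mult_distrib)
      also have "\<dots> \<le> C * cmod (a t) ^ L"
        using elim(1) c(1) C(1) s by (intro mult_left_mono power_mono) (auto simp: s_def)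
      finally have "cmod (G (a t)) * c ^ (L + 2) \<le> C * cmod (a t) ^ L"
        by (simp only: power_add mult_ac)
      then show "cmod (G (a t)) \<le> C / c ^ (L + 2) * cmod (a t) ^ L"
        using c(1) by (simp add: pos_le_divide_eq)
    qed
  qed
  then obtain \<delta> where \<delta>: "\<delta> > 0" "\<And>t. cmod t < \<delta> \<Longrightarrow> t \<noteq> 0 \<Longrightarrow> cmod (G (a t)) \<le> C / c ^ (L + 2) * cmod (a t) ^ L"
    using eventually_nhds0_D by blast
  \<comment> \<open>Every \<open>z\<close> near \<open>0\<close> is \<open>a t\<close> for some
    small \<open>t\<close>, with \<open>t\<close> nonzero if \<open>z\<close> is; the bound along
    the curve thus becomes one on a punctured neighbourhood in the \<open>z\<close>-plane.\<close>
  have "open (a ` ball 0 (min \<delta> e))"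
    by (rule open_mapping_thm[OF a open_ball connected_ball open_ball _ nonconst]) auto
  moreover have "0 \<in> a ` ball 0 (min \<delta> e)"
    using ab0(1) \<delta>(1) \<open>e > 0\<close> by (intro image_eqI[of _ _ 0]) auto
  ultimately have "\<forall>\<^sub>F z in nhds 0. z \<in> a ` ball 0 (min \<delta> e)"
    by (rule eventually_nhds_in_open)
  then have "\<forall>\<^sub>F z in at 0. z \<in> a ` ball 0 (min \<delta> e)"
    unfolding eventually_at_filter by (auto elim: eventually_mono)
  then have "\<forall>\<^sub>F z in at 0. norm (G z) \<le> C / c ^ (L + 2) * cmod z ^ L"
    using eventually_neq_at_within[of 0 0 UNIV]
  proof eventually_elim
    case (elim z)
    then obtain t where "z = a t" "cmod t < \<delta>" by auto
    moreover have "t \<noteq> 0" using calculation elim(2) ab0(1) by auto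
    ultimately show ?case using \<delta>(2) by blast
  qed
  moreover have "isCont G 0" using smooth_on_isCont[OF smG open_ball] R(1) by simp
  ultimately show "vanishes_to_order (dzb (dz (\<lambda>z. complex_of_real (F z)))) L"
    using vanishes_to_order_punctured unfolding G_def Fc_def by blast
qed

section \<open>The three conditions\<close>

lemma good_coordinate_flat_iff:
  assumes "good_coordinate M p \<Phi> F"
  shows "flat_at0 F \<longleftrightarrow> flatO F"
  using good_coordinate_smooth_ball[OF assms] flat_at0_iff_flatO by metis

text \<open>Contact forces \<open>b\<close> to order 2, so the order 1 of the curve comes from
  \<open>a\<close>. Hence \<open>a\<close> has a local holomorphic inverse \<open>g\<close>, and the
  curve is the graph of \<open>b\<close> after \<open>g\<close>.\<close>

lemma regular_curve_imp_flat_coordinate: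
  assumes ldf: "local_defining_function M p (ldf M p)" and good: "good_coordinate M p \<Phi> F"
    and \<gamma>: "\<gamma> \<in> Gamma_reg p" and tangent: "tangent_inf_order M p \<gamma>"
  shows "\<exists>\<Phi> F. good_coordinate M p \<Phi> F \<and> flat_at0 F"
proof -
  have \<gamma>G: "\<gamma> \<in> Gamma p" and ord: "vanish_ord (\<lambda>t. \<gamma> t - p) = enat 1"
    using \<gamma> by (auto simp: Gamma_reg_def one_enat_def)
  have "vanishes_to_order (\<lambda>t. \<gamma> t - p) 1"
    using Gamma_differentiable[OF \<gamma>G] by (intro vanishes_to_order_1) auto
  from vanish_ord_enat[OF ord vanishes_to_order_mono[OF this]]
  have v1: "vanishes_to_order (\<lambda>t. \<gamma> t - p) 1" "\<not> vanishes_to_order (\<lambda>t. \<gamma> t - p) (Suc 1)"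
    by simp_all
  obtain e a b where e: "e > 0" and a: "a holomorphic_on ball 0 e" and b: "b holomorphic_on ball 0 e"
    and ab0: "a 0 = 0" "b 0 = 0"
    and van: "\<And>N. vanishes_to_order (\<lambda>t. \<gamma> t - p) N \<longleftrightarrow> vanishes_to_order a N \<and> vanishes_to_order b N"
    "\<And>N. vanishes_to_order (\<lambda>t. ldf M p (\<gamma> t)) N \<longleftrightarrow> vanishes_to_order (\<lambda>t. F (a t) + 2 * Re (b t)) N"
    using curve_in_good_coordinate[OF ldf good \<gamma>G] by blast
  have contact: "flatO (\<lambda>t. F (a t) + 2 * Re (b t))"
    using tangent van(2) unfolding tangent_inf_order_def flatO_def by blast
  have va1: "vanishes_to_order a 1" using van(1) v1 by blast
  have vb: "vanishes_to_order b (Suc 1)"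
    using contact by (intro vanishes_to_order_second_component[OF good_coordinate_vanishes_2[OF good] b e ab0(2) _ va1])
      (auto simp: flatO_def)
  then have va2: "\<not> vanishes_to_order a (Suc 1)" using van(1) v1 by blast
  obtain c where c: "c > 0" "\<forall>\<^sub>F t in nhds 0. c * cmod t ^ 1 \<le> cmod (a t)"
    "\<forall>\<^sub>F t in nhds 0. c * cmod t ^ (1 - 1) \<le> cmod (deriv a t)"
    using holomorphic_exact_order[OF a e zero_less_one va1 va2] by blast
  \<comment> \<open>The exponent \<open>1 - 1\<close> is 0, so the lower bound for
    \<open>deriv a\<close> holds at \<open>t = 0\<close> itself.\<close>
  have "deriv a 0 \<noteq> 0"
    using eventually_nhds_x_imp_x[OF c(3)] c(1) by auto
  then obtain r where r: "r > 0" "ball (0::complex) r \<subseteq> ball 0 e" "inj_on a (ball 0 r)"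
    using has_complex_derivative_locally_injective[OF a _ open_ball] e by (metis centre_in_ball)
  have ar: "a holomorphic_on ball 0 r" and br: "b holomorphic_on ball 0 r"
    using a b r(2) holomorphic_on_subset by blast+
  obtain g where g: "g holomorphic_on a ` ball 0 r" "\<And>t. t \<in> ball 0 r \<Longrightarrow> g (a t) = t"
    using holomorphic_has_inverse[OF ar open_ball r(3)] by metis
  have "open (a ` ball 0 r)" using open_mapping_thm3[OF ar open_ball r(3)] .
  moreover have "0 \<in> a ` ball 0 r" using ab0(1) r(1) by (intro image_eqI[of _ _ 0]) auto
  ultimately obtain R where R: "R > 0" "ball 0 R \<subseteq> a ` ball 0 r" using openE by blast
  have gR: "g holomorphic_on ball 0 R" using g(1) R(2) holomorphic_on_subset by blast
  have gin: "g z \<in> ball 0 r" "a (g z) = z" if z: "z \<in> ball 0 R" for z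
  proof -
    obtain t where "t \<in> ball 0 r" "z = a t" using R(2) z by blast
    then show "g z \<in> ball 0 r" "a (g z) = z" using g(2) by auto
  qed
  have g0: "g 0 = 0" using g(2)[of 0] ab0(1) r(1) by simp
  have vg: "vanishes_to_order g 1"
    using holomorphic_on_imp_differentiable_at[OF gR open_ball] R(1) g0
    by (intro vanishes_to_order_1 field_differentiable_imp_differentiable) auto
  define h where "h z = b (g z)" for z
  have "(b \<circ> g) holomorphic_on ball 0 R"
    using gin(1) by (intro holomorphic_on_compose_gen[OF gR br]) blast
  then have h: "h holomorphic_on ball 0 R" by (simp add: h_def[abs_def] comp_def)
  have h0: "h 0 = 0" using g0 ab0 by (simp add: h_def)
  \<comment> \<open>Order 2 of \<open>h\<close> serves to show \<open>deriv h 0 = 0\<close>, which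
    the shear requires; the halved order 1 of \<open>dz h\<close> still forces the value 0 at the
    origin.\<close>
  have "vanishes_to_order h (1 * Suc 1)"
    unfolding h_def using vanishes_to_order_compose[OF vb vg] by simp
  then have "vanishes_to_order (dz h) 1"
    using vanishes_to_order_wirtinger(1)[OF smooth_on_holomorphic[OF open_ball h] R(1), of 1] by (simp add: numeral_2_eq_2)
  then have "dz h 0 = 0" by (rule vanishes_to_order_eq_0) simp
  then have h1: "deriv h 0 = 0"
    using wirtinger_holomorphic(1)[OF h open_ball] R(1) by simp
  note good' = good_coordinate_shear[OF good R(1) h h0 h1]
  have "flatO (\<lambda>z. F z + 2 * Re (h z))"
    unfolding flatO_def
  proof
    fix N
    have "vanishes_to_order (\<lambda>t. F (a t) + 2 * Re (b t)) N"
      using contact unfolding flatO_def by blast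
    \<comment> \<open>Substituting \<open>t = g z\<close> turns contact along the curve into a bound
      in \<open>z\<close>; as \<open>g\<close> vanishes to order 1, no order is lost.\<close>
    from vanishes_to_order_compose[OF this vg]
    have "vanishes_to_order (\<lambda>z. F (a (g z)) + 2 * Re (b (g z))) N" by simp
    then show "vanishes_to_order (\<lambda>z. F z + 2 * Re (h z)) N"
      by (rule vanishes_to_order_cong)
        (use eventually_in_ball0[OF R(1)] in \<open>auto elim!: eventually_mono simp: h_def gin(2)\<close>)
  qed
  then show ?thesis using good' good_coordinate_flat_iff by blast
qed

lemma flat_coordinate_imp_regular_curve:
  assumes ldf: "local_defining_function M p (ldf M p)" and good: "good_coordinate M p \<Phi> F"
    and flat: "flat_at0 F"
  shows "\<exists>\<gamma>\<in>Gamma_reg p. tangent_inf_order M p \<gamma>"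
proof -
  obtain U \<Psi> W where c: "open U" "p \<in> U" "holo_map2_on U \<Phi>" "open (\<Phi> ` U)"
    "holo_map2_on (\<Phi> ` U) \<Psi>" "\<And>x. x \<in> U \<Longrightarrow> \<Psi> (\<Phi> x) = x" "\<Phi> p = 0"
    using good_coordinateE[OF good] by metis
  have z: "0 \<in> \<Phi> ` U" "\<Psi> 0 = p" using c(2,6,7) by (metis imageI)+
  obtain \<delta> where \<delta>: "\<delta> > 0" "ball 0 \<delta> \<subseteq> \<Phi> ` U" using z(1) c(4) openE by blast
  \<comment> \<open>The first coordinate serves as parameter; the second is 0, so \<open>rho\<close>
    along this curve is just \<open>F t\<close>.\<close>
  define \<gamma> where "\<gamma> t = \<Psi> (t, 0)" for t :: complex
  have in\<Phi>: "(t, 0) \<in> \<Phi> ` U" if "t \<in> ball 0 \<delta>" for t :: complex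
    using \<delta>(2) that by (auto simp: dist_norm norm_Pair intro!: subsetD[OF \<delta>(2)])
  have \<Phi>\<gamma>: "\<Phi> (\<gamma> t) = (t, 0)" if "t \<in> ball 0 \<delta>" for t
    using in\<Phi>[OF that] c(6) unfolding \<gamma>_def by force
  have hol: "(\<lambda>t. fst (\<gamma> t)) holomorphic_on ball 0 \<delta>" "(\<lambda>t. snd (\<gamma> t)) holomorphic_on ball 0 \<delta>"
    unfolding \<gamma>_def using c(5) in\<Phi> unfolding holo_map2_on_def
    by (auto intro!: holomorphic_on_compose_holo2[of "\<Phi> ` U" "\<lambda>q. fst (\<Psi> q)" "\<lambda>t. t" _ "\<lambda>_. 0"]
        holomorphic_on_compose_holo2[of "\<Phi> ` U" "\<lambda>q. snd (\<Psi> q)" "\<lambda>t. t" _ "\<lambda>_. 0"])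
  have \<gamma>0: "\<gamma> 0 = p" using z(2) by (simp add: \<gamma>_def zero_prod_def)
  have "\<exists>t\<in>ball 0 \<delta>. \<gamma> t \<noteq> p"
  proof (intro bexI)
    show "complex_of_real (\<delta> / 2) \<in> ball 0 \<delta>" using \<delta>(1) by (simp only: mem_ball dist_0_norm norm_of_real)
    from \<Phi>\<gamma>[OF this] show "\<gamma> (complex_of_real (\<delta> / 2)) \<noteq> p" using c(7) \<delta>(1) by (auto simp: zero_prod_def)
  qed
  then have \<gamma>: "\<gamma> \<in> Gamma p" using hol \<gamma>0 \<delta>(1) unfolding Gamma_def by blast
  have v1: "vanishes_to_order (\<lambda>t. \<gamma> t - p) 1"
    using Gamma_differentiable[OF \<gamma>] by (intro vanishes_to_order_1) auto
  have cont: "isCont \<gamma> 0"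
    using Gamma_differentiable(1)[OF \<gamma>] differentiable_imp_continuous_within by blast
  \<comment> \<open>In coordinates the curve is \<open>(t, 0)\<close>, and the Lipschitz bound for
    \<Phi> prevents it from approaching \<open>p\<close> faster than \<open>t\<close> approaches
    \<open>0\<close>.\<close>
  have "\<not> vanishes_to_order (\<lambda>t. \<gamma> t - p) (Suc 1)"
  proof
    assume v2: "vanishes_to_order (\<lambda>t. \<gamma> t - p) (Suc 1)"
    obtain L where "\<forall>\<^sub>F t in nhds 0. norm (\<Phi> (\<gamma> t) - \<Phi> p) \<le> L * norm (\<gamma> t - p)"
      using lipschitz_near_eventually[OF holo_map2_lipschitz_near[OF c(3,1,2)] cont \<gamma>0] .
    then have "\<forall>\<^sub>F t in nhds 0. norm t \<le> L * norm (\<gamma> t - p)"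
      using eventually_in_ball0[OF \<delta>(1)] by eventually_elim (simp add: \<Phi>\<gamma> c(7) norm_Pair)
    then have "vanishes_to_order (\<lambda>t::complex. t) (Suc 1)"
      by (rule vanishes_to_order_compare[OF v2])
    then have "Suc 1 \<le> 1"
      by (intro vanishes_to_order_lower_bound[of 1 1 "\<lambda>t. t"]) auto
    then show False by simp
  qed
  then have "vanish_ord (\<lambda>t. \<gamma> t - p) = 1"
    using vanish_ord_eqI[OF v1] by (simp add: one_enat_def)
  then have "\<gamma> \<in> Gamma_reg p" using \<gamma> by (simp add: Gamma_reg_def)
  moreover have "tangent_inf_order M p \<gamma>"
    unfolding tangent_inf_order_def
  proof
    fix N
    obtain K where K: "\<forall>\<^sub>F q in nhds p. \<bar>ldf M p q\<bar> \<le> K * \<bar>rho \<Phi> F q\<bar>" using ldf_le_rho[OF ldf good] .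
    have "(\<gamma> \<longlongrightarrow> p) (nhds 0)" using cont \<gamma>0 tendsto_at_iff_tendsto_nhds[of \<gamma> 0] by (simp add: isCont_def)
    from eventually_compose_filterlim[OF K this] eventually_in_ball0[OF \<delta>(1)]
    have *: "\<forall>\<^sub>F t in nhds 0. norm (ldf M p (\<gamma> t)) \<le> K * norm (F t)"
      by eventually_elim (simp add: rho_def \<Phi>\<gamma>)
    have "vanishes_to_order F N"
      using flat good_coordinate_flat_iff[OF good] unfolding flatO_def by blast
    then show "vanishes_to_order (\<lambda>t. ldf M p (\<gamma> t)) N"
      using * by (rule vanishes_to_order_compare)
  qed
  ultimately show ?thesis by blast
qed

text \<open>A flat coordinate thereby also satisfies the third condition, because the zero series
  has infinite radius of convergence.\<close>

lemma flat_imp_S_coeff_0: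
  assumes good: "good_coordinate M p \<Phi> F" and flat: "flat_at0 F"
  shows "S_coeff F = (\<lambda>_. 0)"
proof -
  obtain e where e: "e > 0" "smooth_on (ball 0 e) F" using good_coordinate_smooth_ball[OF good] .
  have "flatO (\<lambda>z. complex_of_real (F z))"
    using flat good_coordinate_flat_iff[OF good] flatO_linear[OF _ bounded_linear_of_real] by blast
  then have "flatO ((dz ^^ n) (\<lambda>z. complex_of_real (F z)))" for n
    using e by (intro flatO_dz_power smooth_on_linear[OF open_ball bounded_linear_of_real])
  then show ?thesis
    unfolding S_coeff_def by (intro ext) (simp add: flatO_eq_0)
qed

text \<open>\<open>2 * Re (g z)\<close> is harmonic, so the shear does not affect the Laplacian,
  which is flat because \<open>Delta1\<close> is infinite. By \<open>flatO_from_pure_terms\<close>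
  it remains to cancel the derivatives \<open>dz ^^ n\<close> at \<open>0\<close>, and
  \<open>g\<close> is built from their values.\<close>

lemma convergent_coordinate_imp_flat_coordinate:
  assumes ldf: "local_defining_function M p (ldf M p)" and good: "good_coordinate M p \<Phi> F"
    and Delta1: "Delta1 M p = \<infinity>" and conv: "conv_radius (S_coeff F) > 0"
  shows "\<exists>\<Phi> F. good_coordinate M p \<Phi> F \<and> flat_at0 F"
proof -
  obtain R where R: "R > 0" "ereal R < conv_radius (S_coeff F)"
    using ereal_dense2[OF conv] by auto
  obtain e where e: "e > 0" "smooth_on (ball 0 e) F" using good_coordinate_smooth_ball[OF good] .
  define S where "S z = (\<Sum>n. S_coeff F n * z ^ n)" for z
  define g where "g z = - S z" for z
  have fps: "S = eval_fps (Abs_fps (S_coeff F))" by (simp add: S_def[abs_def] eval_fps_def[abs_def])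
  have radius: "ball 0 R \<subseteq> eball 0 (fps_conv_radius (Abs_fps (S_coeff F)))"
    using R(2) by (auto simp: fps_conv_radius_def eball_def intro: less_trans[of _ "ereal R"])
  have S: "S holomorphic_on ball 0 R"
    unfolding fps using radius by (intro holomorphic_on_eval_fps) 
  have Sderiv: "(deriv ^^ n) S 0 = fact n * S_coeff F n" for n
  proof -
    have "fps_conv_radius (Abs_fps (S_coeff F)) > 0" using conv by (simp add: fps_conv_radius_def)
    from fps_nth_conv_deriv[OF this, of n] show ?thesis by (simp add: fps)
  qed
  have g: "g holomorphic_on ball 0 R" unfolding g_def by (intro holomorphic_intros S)
  have gderiv: "(deriv ^^ n) g 0 = - (fact n * S_coeff F n)" for n
    using higher_deriv_uminus[OF S open_ball, of 0 n] Sderiv[of n] R(1) by (simp add: g_def[abs_def])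
  \<comment> \<open>\<open>S_coeff\<close> is 0 below index 2 by definition, which gives exactly the
    two conditions of the shear.\<close>
  have g0: "g 0 = 0" "deriv g 0 = 0"
    using gderiv[of 0] gderiv[of 1] by (auto simp: S_coeff_def)
  define F' where "F' z = F z + 2 * Re (g z)" for z
  have good': "good_coordinate M p (\<lambda>q. (fst (\<Phi> q), snd (\<Phi> q) - g (fst (\<Phi> q)))) F'"
    unfolding F'_def using good_coordinate_shear[OF good R(1) g g0] .
  define r where "r = min e R"
  have r: "r > 0" using e R by (simp add: r_def)
  define B where "B = ball (0::complex) r"
  have B: "open B" "0 \<in> B" using r by (auto simp: B_def)
  define Fc where "Fc = (\<lambda>z. complex_of_real (F z))"
  have sm: "smooth_on B F" by (rule smooth_on_subset[OF _ e(2)]) (auto simp: B_def r_def)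
  have gB: "g holomorphic_on B" using g by (rule holomorphic_on_subset) (auto simp: B_def r_def)
  have smF: "smooth_on B Fc" unfolding Fc_def by (rule smooth_on_linear[OF B(1) bounded_linear_of_real sm])
  have smg: "smooth_on B g" "smooth_on B (\<lambda>z. cnj (g z))"
    using smooth_on_holomorphic[OF B(1) gB] smooth_on_linear[OF B(1) bounded_linear_cnj] by blast+
  have smgg: "smooth_on B (\<lambda>z. g z + cnj (g z))" by (rule smooth_on_add[OF B(1) smg])
  have F'c: "(\<lambda>z. complex_of_real (F' z)) = (\<lambda>z. Fc z + (g z + cnj (g z)))"
    by (rule ext) (simp add: F'_def Fc_def complex_eq_iff)
  have d: "f differentiable at z" if "smooth_on B f" "z \<in> B" for f :: "complex \<Rightarrow> complex" and z
    using smooth_on_differentiable[OF that(1) B(1) that(2)] .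
  have dz_cnj_g: "dz (\<lambda>z. cnj (g z)) z = 0" if "z \<in> B" for z
    using wirtinger_cnj(1)[OF d[OF smg(1) that]] wirtinger_holomorphic(2)[OF gB B(1) that] by simp
  \<comment> \<open>At least one \<open>dz\<close> is required: it annihilates
    \<open>cnj (g z)\<close>, which is itself nonzero in general.\<close>
  have dz_power_cnj_g: "(dz ^^ Suc n) (\<lambda>z. cnj (g z)) z = 0" if "z \<in> B" for n z
    using that
  proof (induction n arbitrary: z)
    case (Suc n)
    have "dz ((dz ^^ Suc n) (\<lambda>z. cnj (g z))) z = dz (\<lambda>_. 0) z"
      by (rule wirtinger_cong(1)[OF B(1) Suc.prems Suc.IH])
    also have "\<dots> = 0" using wirtinger_holomorphic(1)[OF holomorphic_on_const[of 0 UNIV]] by simp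
    finally show ?case by simp
  qed (simp add: dz_cnj_g)
  have dz_eq: "dz (\<lambda>z. complex_of_real (F' z)) z = dz Fc z + deriv g z" if z: "z \<in> B" for z
    unfolding F'c using dz_cnj_g[OF z] wirtinger_holomorphic(1)[OF gB B(1) z]
    by (simp add: wirtinger_add(1)[OF d[OF smF z] d[OF smgg z]]
        wirtinger_add(1)[OF d[OF smg(1) z] d[OF smg(2) z]])
  have "flatO F'"
  proof (rule flatO_from_pure_terms[of r])
    have "smooth_on B (\<lambda>z. 2 * Re (g z))"
      by (intro smooth_on_linear[OF B(1) _ smg(1)] bounded_linear_const_mult bounded_linear_Re)
    then show "smooth_on (ball 0 r) F'"
      unfolding F'_def B_def[symmetric] by (intro smooth_on_add B(1) sm)
    show "F' 0 = 0" using good' unfolding good_coordinate_def by blast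
    have "dzb (dz (\<lambda>z. complex_of_real (F' z))) z = dzb (dz Fc) z" if z: "z \<in> B" for z
    proof -
      have g': "deriv g holomorphic_on B" by (rule holomorphic_deriv[OF gB B(1)])
      have "dzb (dz (\<lambda>z. complex_of_real (F' z))) z = dzb (\<lambda>z. dz Fc z + deriv g z) z"
        by (rule wirtinger_cong(2)[OF B(1) z dz_eq])
      also have "\<dots> = dzb (dz Fc) z + dzb (deriv g) z"
        using d[OF smooth_on_wirtinger(1)[OF smF B(1)] z] d[OF smooth_on_holomorphic[OF B(1) g'] z]
        by (rule wirtinger_add(2))
      finally show ?thesis using wirtinger_holomorphic(2)[OF g' B(1) z] by simp
    qed
    then have "\<forall>\<^sub>F z in nhds 0. dzb (dz (\<lambda>z. complex_of_real (F' z))) z = dzb (dz Fc) z"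
      using eventually_nhds_in_open[OF B] by (auto elim: eventually_mono)
    then show "flatO (dzb (dz (\<lambda>z. complex_of_real (F' z))))"
      using flatO_cong Delta1_infinite_imp_flat_laplacian[OF ldf good Delta1] unfolding Fc_def by blast
    show "(dz ^^ n) (\<lambda>z. complex_of_real (F' z)) 0 = 0" if "n > 0" for n
    \<comment> \<open>\<open>S_coeff\<close> carries no linear term, so for index 1 the vanishing
      gradient of \<open>F\<close> is used together with \<open>deriv g 0 = 0\<close>.\<close>
    proof (cases "n = 1")
      case True
      have "dderiv F v 0 = 0" for v using good unfolding good_coordinate_def by blast
      then have "dderiv Fc v 0 = 0" for v
        unfolding Fc_def using dderiv_linear[OF smooth_on_differentiable[OF sm B] bounded_linear_of_real] by simp
      then have "dz Fc 0 = 0" by (simp add: dz_def)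
      then show ?thesis using True dz_eq[OF B(2)] g0 by simp
    next
      case False
      then have "2 \<le> n" using that by simp
      have "(dz ^^ n) (\<lambda>z. complex_of_real (F' z)) 0
          = (dz ^^ n) Fc 0 + ((dz ^^ n) g 0 + (dz ^^ n) (\<lambda>z. cnj (g z)) 0)"
        unfolding F'c using dz_power_add[OF smF smgg B(1,2)] dz_power_add[OF smg B(1,2)] by simp
      also have "(dz ^^ n) (\<lambda>z. cnj (g z)) 0 = 0"
        using dz_power_cnj_g[OF B(2), of "n - 1"] that by simp
      also have "(dz ^^ n) g 0 = - (fact n * S_coeff F n)"
        using dz_power_holomorphic[OF gB B(1,2)] gderiv by simp
      also have "fact n * S_coeff F n = (dz ^^ n) Fc 0"
        using \<open>2 \<le> n\<close> by (simp add: S_coeff_def Fc_def)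
      finally show ?thesis by simp
    qed
  qed (rule r)
  then show ?thesis using good' good_coordinate_flat_iff by blast
qed

theorem theorem5p5:
  fixes M :: "(complex \<times> complex) set" and p :: "complex \<times> complex"
  assumes "smooth_real_hypersurface M"
    and "p \<in> M"
    and "\<exists>\<Phi> F. good_coordinate M p \<Phi> F"
    and "Delta1 M p = \<infinity>"
  shows "((\<exists>\<gamma>\<in>Gamma_reg p. tangent_inf_order M p \<gamma>)
            \<longleftrightarrow> (\<exists>\<Phi> F. good_coordinate M p \<Phi> F \<and> flat_at0 F))
       \<and> ((\<exists>\<Phi> F. good_coordinate M p \<Phi> F \<and> flat_at0 F)
            \<longleftrightarrow> (\<exists>\<Phi> F. good_coordinate M p \<Phi> F \<and> conv_radius (S_coeff F) > 0))"
proof -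
  \<comment> \<open>The hypersurface hypothesis provides some defining function at \<open>p\<close>,
    so the \<open>SOME\<close> in \<open>ldf\<close> really yields one.\<close>
  have ldf: "local_defining_function M p (ldf M p)"
    using assms(1,2) someI_ex[of "local_defining_function M p"]
    unfolding smooth_real_hypersurface_def ldf_def by blast
  have "\<exists>\<Phi> F. good_coordinate M p \<Phi> F \<and> conv_radius (S_coeff F) > 0"
    if "good_coordinate M p \<Phi> F" "flat_at0 F" for \<Phi> F
    using flat_imp_S_coeff_0[OF that] that(1) by (intro exI[of _ \<Phi>] exI[of _ F]) simp
  then show ?thesis
    using regular_curve_imp_flat_coordinate[OF ldf] flat_coordinate_imp_regular_curve[OF ldf]
      convergent_coordinate_imp_flat_coordinate[OF ldf _ assms(4)] assms(3) by blast
qed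

end
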